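(* Let the dimension $n$ be fixed. Let $\mathcal{P}$ be a set of polytopes in $\mathbb{R}^n$ that is closed under taking sub-polytopes, let $\Omega_{\mathcal{P}}$ be a set of basic functions for $\mathcal{P}$, and let $\mathcal{S}(\mathcal{P})$ be the set of functions that are sliceable over all $P\in\mathcal{P}$ and are given with an evaluation oracle. Let $f=\sum_{j=1}^m g_j s_j$ with $m$ finite, $g_j\in\Omega_{\mathcal{P}}$ and $s_j\in\mathcal{S}(\mathcal{P})$ for $j=1,\dots,m$, and suppose that there is an evaluation oracle for $f$. Then for every $P\in\mathcal{P}$ there exists a fully polynomial-time approximation scheme (FPTAS) for the problem $$\min\{f(\mathbf{x}):\mathbf{x}\in P\cap\mathbb{Z}^n\},$$ where the size of the input is the sum of the sizes of $g_j$, $s_j$ for $j=1,\dots,m$, and of $P$.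
   Context: Polytopes are bounded sets $P=\{\mathbf{x}\in\mathbb{R}^n : A\mathbf{x}\le\mathbf{b}\}$ with $A\in\mathbb{Z}^{k\times n}$, $\mathbf{b}\in\mathbb{Z}^k$; the size of $P$ is the sum of the binary encoding lengths of $A$ and $\mathbf{b}$. "Closed under taking sub-polytopes" means: if $P\in\mathcal{P}$ and $\bar P\subseteq P$ is a polytope, then $\bar P\in\mathcal{P}$. Approximate solutions: let $\mathbf{x}_{\min}$ be an optimal solution of $\min\{f(\mathbf{x}):\mathbf{x}\in P\cap\mathbb{Z}^n\}$ and $\epsilon>0$. A point $\mathbf{x}_\epsilon$ is an $\epsilon$-approximate solution if $\mathbf{x}_\epsilon\in P\cap\mathbb{Z}^n$ and one of the following holds: (1) $f(\mathbf{x}_{\min})>0$ and $f(\mathbf{x}_\epsilon)\le(1+\epsilon)f(\mathbf{x}_{\min})$; (2) $f(\mathbf{x}_{\min})<0$ and $f(\mathbf{x}_\epsilon)\le\frac{1}{1+\epsilon}f(\mathbf{x}_{\min})$; (3) $f(\mathbf{x}_{\min})=0$ and $f(\mathbf{x}_\epsilon)=f(\mathbf{x}_{\min})$. An algorithm is an FPTAS if for any $\epsilon>0$, in time polynomial in $\frac1\epsilon$ and the size of the input, it correctly determines whether $P\cap\mathbb{Z}^n\ne\emptyset$ and, if so, outputs an $\epsilon$-approximate solution (oracle calls are allowed where an oracle is given). Basic functions: a set of basic functions $\Omega_{\mathcal{P}}$ is a class of real-valued functions with a common encoding structure for all elements such that: (i) $\Omega_{\mathcal{P}}$ is closed under addition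 and under multiplication by scalars $\lambda>0$; (ii) each $f\in\Omega_{\mathcal{P}}$ admits an FPTAS for $\min\{f(\mathbf{x}):\mathbf{x}\in P\cap\mathbb{Z}^n\}$ over each polytope $P\in\mathcal{P}$ (the input being the encoding of $f$ and $P$); (iii) all functions in $\Omega_{\mathcal{P}}$ are sign compatible, i.e. $\operatorname{sign}(f(\mathbf{x}))=\operatorname{sign}(g(\mathbf{x}))$ for all $f,g\in\Omega_{\mathcal{P}}$, $\mathbf{x}\in P$, $P\in\mathcal{P}$. Slices: for $\mathbf{k}\in\mathbb{Z}^l$, $\mathbf{c}^0\in\mathbb{Z}^l$, $\mathbf{c}^1,\dots,\mathbf{c}^l\in\mathbb{Z}^n$ and $\epsilon>0$, let $L_j(\mathbf{x})=\mathbf{c}^j\cdot\mathbf{x}+c^0_j$ and let $B_{\mathbf{k}}(\mathbf{c}^0,\mathbf{c}^1,\dots,\mathbf{c}^l,\epsilon)$ be the set of all $\mathbf{x}\in\mathbb{R}^n$ such that for every $j=1,\dots,l$: $(1+\epsilon)^{k_j-1}\le L_j(\mathbf{x})\le(1+\epsilon)^{k_j}$ if $k_j\ge1$; $L_j(\mathbf{x})=0$ if $k_j=0$; $-(1+\epsilon)^{-k_j}\le L_j(\mathbf{x})\le-(1+\epsilon)^{-k_j-1}$ if $k_j\le-1$. Sliceable functions: for $C\subseteq\mathbb{R}^n$, a function $s:C\to\mathbb{R}_{\ge0}$ is sliceable over $C$ if there exist $\mathbf{c}^0\in\mathbb{Z}^l$, $\mathbf{c}^1,\dots,\mathbf{c}^l\in\mathbb{Z}^n$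 and $\zeta\in\mathbb{Z}_{\ge1}$ such that for all $\epsilon>0$ and all $\mathbf{k}\in\mathbb{Z}^l$ one has $s(\mathbf{x})\le(1+\epsilon)s(\mathbf{y})$ for all $\mathbf{x},\mathbf{y}\in C\cap B_{\mathbf{k}}(\mathbf{c}^0,\mathbf{c}^1,\dots,\mathbf{c}^l,\epsilon/\zeta)\cap\mathbb{Z}^n$. These data are the slicing parameters of $s$; the size of a sliceable function is the sum of the binary sizes of $\mathbf{c}^0,\dots,\mathbf{c}^l$ and the unary encoding size of $\zeta$. The slicing parameters of each $s_j$ and the encodings of each $g_j$ are part of the input.
   Formalization: Closure of the basic functions under addition and positive scaling is also required effectively: an encoding of a positive combination is computable in polynomial time from scalars and encodings. Otherwise padded encodings of sums make the claim fail unless P = NP. *)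

theory Defs
  imports "HOL-Analysis.Analysis" "HOL-Library.Log_Nat"
begin

section \<open>Machine model\<close>

text \<open>
  Algorithms are programs of a small deterministic WHILE language over nested lists whose atoms are
  integers and real numbers. Every evaluation of an expression is charged the total size of the
  operands and of all intermediate results (logarithmic cost), integers being measured by their
  binary length.

  Real numbers that are not integer data (oracle answers, scalars) are atoms. The number model is a
  parameter of the development: a set \<open>K\<close> of the numbers that can be represented and a function
  \<open>\<sigma>\<close> giving the size of a number. With \<open>K = \<rat>\<close> and \<open>\<sigma>\<close> the binary length of numerator and
  denominator the model is polynomially equivalent to Turing machines; with \<open>K = UNIV\<close>
  and \<open>\<sigma>\<close> constantly 1 it is the usual model in which integer data are measured in bits, whereas
  exact real numbers are stored, compared and combined arithmetically at unit cost.
\<close>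

datatype val = VInt int | VNum real | VList "val list"

fun vsize :: "(real \<Rightarrow> nat) \<Rightarrow> val \<Rightarrow> nat" where
  "vsize \<sigma> (VInt i) = 1 + floorlog 2 (nat \<bar>i\<bar>)"
| "vsize \<sigma> (VNum r) = 1 + \<sigma> r"
| "vsize \<sigma> (VList vs) = 1 + sum_list (map (vsize \<sigma>) vs)"

datatype binop = AddOp | SubOp | MulOp | DivOp | LessOp

datatype expr =
    EVar nat | EInt int | ENil | ECons expr expr | EHd expr | ETl expr
  | EKind expr | EToNum expr | EBin binop expr expr

fun int_bin :: "binop \<Rightarrow> int \<Rightarrow> int \<Rightarrow> val" where
  "int_bin AddOp a b = VInt (a + b)"
| "int_bin SubOp a b = VInt (a - b)"
| "int_bin MulOp a b = VInt (a * b)"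
| "int_bin DivOp a b = VInt (a div b)"
| "int_bin LessOp a b = VInt (of_bool (a < b))"

fun num_bin :: "binop \<Rightarrow> real \<Rightarrow> real \<Rightarrow> val" where
  "num_bin AddOp a b = VNum (a + b)"
| "num_bin SubOp a b = VNum (a - b)"
| "num_bin MulOp a b = VNum (a * b)"
| "num_bin DivOp a b = VNum (a / b)"
| "num_bin LessOp a b = VInt (of_bool (a < b))"

text \<open>Operations applied to values of the wrong kind return the empty list. There are no real
  constants in programs; the only numbers a program can create by itself are obtained from
  integers by \<open>EToNum\<close> and arithmetic. In particular there is no rounding operation from numbers
  to integers.\<close>

fun bin_val :: "binop \<Rightarrow> val \<Rightarrow> val \<Rightarrow> val" where
  "bin_val op (VInt a) (VInt b) = int_bin op a b"
| "bin_val op (VNum a) (VNum b) = num_bin op a b"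
| "bin_val op _ _ = VList []"

fun cons_val :: "val \<Rightarrow> val \<Rightarrow> val" where
  "cons_val v (VList vs) = VList (v # vs)"
| "cons_val v _ = VList []"

fun hd_val :: "val \<Rightarrow> val" where
  "hd_val (VList (v # vs)) = v"
| "hd_val _ = VList []"

fun tl_val :: "val \<Rightarrow> val" where
  "tl_val (VList (v # vs)) = VList vs"
| "tl_val _ = VList []"

fun kind_val :: "val \<Rightarrow> val" where
  "kind_val (VList []) = VInt 0"
| "kind_val (VList (v # vs)) = VInt 1"
| "kind_val (VInt i) = VInt 2"
| "kind_val (VNum r) = VInt 3"

fun num_val :: "val \<Rightarrow> val" where
  "num_val (VInt i) = VNum (of_int i)"
| "num_val _ = VList []"

type_synonym store = "nat \<Rightarrow> val"

fun eval_expr :: "expr \<Rightarrow> store \<Rightarrow> val" where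
  "eval_expr (EVar x) s = s x"
| "eval_expr (EInt i) s = VInt i"
| "eval_expr ENil s = VList []"
| "eval_expr (ECons e1 e2) s = cons_val (eval_expr e1 s) (eval_expr e2 s)"
| "eval_expr (EHd e) s = hd_val (eval_expr e s)"
| "eval_expr (ETl e) s = tl_val (eval_expr e s)"
| "eval_expr (EKind e) s = kind_val (eval_expr e s)"
| "eval_expr (EToNum e) s = num_val (eval_expr e s)"
| "eval_expr (EBin op e1 e2) s = bin_val op (eval_expr e1 s) (eval_expr e2 s)"

fun subexprs :: "expr \<Rightarrow> expr list" where
  "subexprs (ECons e1 e2) = ECons e1 e2 # subexprs e1 @ subexprs e2"
| "subexprs (EHd e) = EHd e # subexprs e"
| "subexprs (ETl e) = ETl e # subexprs e"
| "subexprs (EKind e) = EKind e # subexprs e"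
| "subexprs (EToNum e) = EToNum e # subexprs e"
| "subexprs (EBin op e1 e2) = EBin op e1 e2 # subexprs e1 @ subexprs e2"
| "subexprs e = [e]"

definition expr_cost :: "(real \<Rightarrow> nat) \<Rightarrow> expr \<Rightarrow> store \<Rightarrow> nat" where
  "expr_cost \<sigma> e s = (\<Sum>e' \<leftarrow> subexprs e. vsize \<sigma> (eval_expr e' s))"

datatype com =
    Skip
  | Assign nat expr
  | Query nat expr
  | Seq com com
  | IfC expr com com
  | WhileC expr com

text \<open>An oracle is a partial function on values; a query outside its domain blocks the program.
  A condition is false iff its value is \<open>VInt 0\<close>. \<open>exec \<sigma> orc c s t s'\<close>: started in store \<open>s\<close>,
  the program \<open>c\<close> terminates in store \<open>s'\<close> after time \<open>t\<close>.\<close>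

type_synonym oracle_fun = "val \<Rightarrow> val option"

inductive exec :: "(real \<Rightarrow> nat) \<Rightarrow> oracle_fun \<Rightarrow> com \<Rightarrow> store \<Rightarrow> nat \<Rightarrow> store \<Rightarrow> bool"
  for \<sigma> :: "real \<Rightarrow> nat" and orc :: oracle_fun where
  exec_Skip: "exec \<sigma> orc Skip s 1 s"
| exec_Assign: "exec \<sigma> orc (Assign x e) s (expr_cost \<sigma> e s) (s(x := eval_expr e s))"
| exec_Query: "orc (eval_expr e s) = Some v \<Longrightarrow>
    exec \<sigma> orc (Query x e) s (expr_cost \<sigma> e s + vsize \<sigma> v) (s(x := v))"
| exec_Seq: "exec \<sigma> orc c1 s t1 s1 \<Longrightarrow> exec \<sigma> orc c2 s1 t2 s2 \<Longrightarrow>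
    exec \<sigma> orc (Seq c1 c2) s (t1 + t2) s2"
| exec_IfTrue: "eval_expr e s \<noteq> VInt 0 \<Longrightarrow> exec \<sigma> orc c1 s t s' \<Longrightarrow>
    exec \<sigma> orc (IfC e c1 c2) s (expr_cost \<sigma> e s + t) s'"
| exec_IfFalse: "eval_expr e s = VInt 0 \<Longrightarrow> exec \<sigma> orc c2 s t s' \<Longrightarrow>
    exec \<sigma> orc (IfC e c1 c2) s (expr_cost \<sigma> e s + t) s'"
| exec_WhileFalse: "eval_expr e s = VInt 0 \<Longrightarrow>
    exec \<sigma> orc (WhileC e c) s (expr_cost \<sigma> e s) s"
| exec_WhileTrue: "eval_expr e s \<noteq> VInt 0 \<Longrightarrow> exec \<sigma> orc c s t1 s1 \<Longrightarrow>
    exec \<sigma> orc (WhileC e c) s1 t2 s2 \<Longrightarrow>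
    exec \<sigma> orc (WhileC e c) s (expr_cost \<sigma> e s + t1 + t2) s2"

text \<open>Register 0 holds the input at the start and the output at the end.\<close>

definition computes ::
  "(real \<Rightarrow> nat) \<Rightarrow> oracle_fun \<Rightarrow> com \<Rightarrow> val \<Rightarrow> nat \<Rightarrow> val \<Rightarrow> bool" where
  "computes \<sigma> orc c v t w \<longleftrightarrow>
     (\<exists>s'. exec \<sigma> orc c ((\<lambda>_. VList [])(0 := v)) t s' \<and> s' 0 = w)"

definition no_oracle :: oracle_fun where
  "no_oracle = (\<lambda>_. None)"


section \<open>Integer points, polytopes and their encodings\<close>

text \<open>The dimension \<open>n\<close> is \<open>CARD('n)\<close>. To write vectors as lists we fix an arbitrary order of the
  coordinates.\<close>

definition coords :: "'n::finite list" where
  "coords = (SOME xs. distinct xs \<and> set xs = UNIV)"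

definition real_vec :: "int ^ 'n \<Rightarrow> real ^ 'n::finite" where
  "real_vec z = (\<chi> i. real_of_int (z $ i))"

definition int_points :: "(real ^ 'n::finite) set" where
  "int_points = range real_vec"

definition enc_vec :: "int ^ 'n::finite \<Rightarrow> val" where
  "enc_vec z = VList (map (\<lambda>i. VInt (z $ i)) coords)"

text \<open>A pair \<open>(a, b)\<close> is used both for the inequality \<open>a \<bullet> x \<le> b\<close> and for the affine form
  \<open>a \<bullet> x + b\<close>.\<close>

type_synonym 'n row = "(int ^ 'n) \<times> int"

definition enc_rows :: "'n::finite row list \<Rightarrow> val" where
  "enc_rows rs = VList (map (\<lambda>(a, b). VList [enc_vec a, VInt b]) rs)"

definition polyhedron_of :: "'n::finite row list \<Rightarrow> (real ^ 'n) set" where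
  "polyhedron_of rs = {x. \<forall>(a, b) \<in> set rs. real_vec a \<bullet> x \<le> real_of_int b}"

definition int_polytope :: "(real ^ 'n::finite) set \<Rightarrow> bool" where
  "int_polytope P \<longleftrightarrow> bounded P \<and> (\<exists>rs. P = polyhedron_of rs)"

definition closed_under_subpolytopes :: "(real ^ 'n::finite) set set \<Rightarrow> bool" where
  "closed_under_subpolytopes \<P> \<longleftrightarrow>
     (\<forall>P \<in> \<P>. \<forall>Q. int_polytope Q \<and> Q \<subseteq> P \<longrightarrow> Q \<in> \<P>)"


section \<open>Approximation schemes\<close>

definition eps_approx ::
  "(real ^ 'n::finite \<Rightarrow> real) \<Rightarrow> (real ^ 'n) set \<Rightarrow> real \<Rightarrow> real ^ 'n \<Rightarrow> bool" where
  "eps_approx f P \<epsilon> x \<longleftrightarrow>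
     x \<in> P \<inter> int_points \<and>
     (\<exists>xmin. is_arg_min f (\<lambda>y. y \<in> P \<inter> int_points) xmin \<and>
        (f xmin > 0 \<and> f x \<le> (1 + \<epsilon>) * f xmin \<or>
         f xmin < 0 \<and> f x \<le> 1 / (1 + \<epsilon>) * f xmin \<or>
         f xmin = 0 \<and> f x = f xmin))"

text \<open>An instance of a minimization problem: the input handed to the algorithm, the oracle it may
  call, and the (abstract) objective function and feasible region that these describe.\<close>

record ('n::finite) problem =
  input :: val
  orac :: oracle_fun
  objective :: "real ^ 'n \<Rightarrow> real"
  region :: "(real ^ 'n) set"

text \<open>The accuracy is a positive rational \<open>\<epsilon> = p / q\<close> that is part of the input. The output is
  \<open>VInt 0\<close> for "no integer point" and an encoded integer point otherwise. A polynomial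
  bound in \<open>1 / \<epsilon>\<close> and the input size \<open>N\<close> is written in the form \<open>d * (1 / \<epsilon> + N) ^ d\<close>.\<close>

definition fptas ::
  "(real \<Rightarrow> nat) \<Rightarrow> com \<Rightarrow> ('n::finite) problem set \<Rightarrow> bool" where
  "fptas \<sigma> c I \<longleftrightarrow>
     (\<exists>d::nat. \<forall>X \<in> I. \<forall>p q :: int. p > 0 \<longrightarrow> q > 0 \<longrightarrow>
        (let \<epsilon> = real_of_int p / real_of_int q;
             v = VList [VInt p, VInt q, input X]
         in \<exists>t w. computes \<sigma> (orac X) c v t w \<and>
              real t \<le> real d * (1 / \<epsilon> + real (vsize \<sigma> v)) ^ d \<and>
              (if region X \<inter> int_points = {} then w = VInt 0
               else \<exists>z. w = enc_vec z \<and>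
                      eps_approx (objective X) (region X) \<epsilon> (real_vec z))))"


section \<open>Basic functions\<close>

text \<open>
  The common encoding structure is a partial decoding function \<open>dec\<close>, whose range is the class of
  basic functions. Closure under positive scalars refers to the representable numbers \<open>K\<close>.
  As these closure properties concern encoded functions, they are also required
  effectively: an encoding of a sum of positive multiples of basic functions can be computed in
  polynomial time from the scalars and the encodings of the summands. (The iteration of a
  polynomial-time binary addition need not be polynomial, hence the version for lists.)
\<close>

definition effective_conic ::
  "(real \<Rightarrow> nat) \<Rightarrow> real set \<Rightarrow> (val \<Rightarrow> (real ^ 'n::finite \<Rightarrow> real) option) \<Rightarrow> bool" where
  "effective_conic \<sigma> K dec \<longleftrightarrow>
     (\<exists>c. \<exists>d::nat. \<forall>us :: (real \<times> val) list.
        us \<noteq> [] \<longrightarrow> (\<forall>(r, u) \<in> set us. r \<in> K \<and> r > 0 \<and> u \<in> dom dec) \<longrightarrow>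
        (let v = VList (map (\<lambda>(r, u). VList [VNum r, u]) us)
         in \<exists>t w. computes \<sigma> no_oracle c v t w \<and> t \<le> d * vsize \<sigma> v ^ d \<and>
              dec w = Some (\<lambda>x. \<Sum>(r, u) \<leftarrow> us. r * the (dec u) x)))"

definition basic_problems ::
  "(real ^ 'n::finite) set set \<Rightarrow> (val \<Rightarrow> (real ^ 'n \<Rightarrow> real) option) \<Rightarrow> 'n problem set" where
  "basic_problems \<P> dec =
     {\<lparr>input = VList [u, enc_rows rs], orac = no_oracle, objective = f, region = polyhedron_of rs\<rparr>
      | u f rs. dec u = Some f \<and> polyhedron_of rs \<in> \<P>}"

definition basic_functions ::
  "(real \<Rightarrow> nat) \<Rightarrow> real set \<Rightarrow> (real ^ 'n::finite) set set \<Rightarrow>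
   (val \<Rightarrow> (real ^ 'n \<Rightarrow> real) option) \<Rightarrow> bool" where
  "basic_functions \<sigma> K \<P> dec \<longleftrightarrow>
     (\<forall>f \<in> ran dec. \<forall>g \<in> ran dec. (\<lambda>x. f x + g x) \<in> ran dec) \<and>
     (\<forall>f \<in> ran dec. \<forall>r \<in> K. r > 0 \<longrightarrow> (\<lambda>x. r * f x) \<in> ran dec) \<and>
     effective_conic \<sigma> K dec \<and>
     (\<exists>c. fptas \<sigma> c (basic_problems \<P> dec)) \<and>
     (\<forall>f \<in> ran dec. \<forall>g \<in> ran dec. \<forall>P \<in> \<P>. \<forall>x \<in> P. sgn (f x) = sgn (g x))"


section \<open>Sliceable functions\<close>

definition affine_form :: "'n::finite row \<Rightarrow> real ^ 'n \<Rightarrow> real" where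
  "affine_form r x = real_vec (fst r) \<bullet> x + real_of_int (snd r)"

text \<open>The slicing forms \<open>L\<^sub>j\<close> are given as a list of length \<open>l\<close>; of the index \<open>k\<close> only
  the first \<open>l\<close> entries matter.\<close>

definition slice :: "'n::finite row list \<Rightarrow> (nat \<Rightarrow> int) \<Rightarrow> real \<Rightarrow> (real ^ 'n) set" where
  "slice cs k \<epsilon> = {x. \<forall>j < length cs.
     (k j \<ge> 1 \<longrightarrow> (1 + \<epsilon>) powi (k j - 1) \<le> affine_form (cs ! j) x \<and>
                   affine_form (cs ! j) x \<le> (1 + \<epsilon>) powi (k j)) \<and>
     (k j = 0 \<longrightarrow> affine_form (cs ! j) x = 0) \<and>
     (k j \<le> -1 \<longrightarrow> - ((1 + \<epsilon>) powi (- k j)) \<le> affine_form (cs ! j) x \<and>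
                    affine_form (cs ! j) x \<le> - ((1 + \<epsilon>) powi (- k j - 1)))}"

definition slicing_parameters ::
  "(real ^ 'n::finite \<Rightarrow> real) \<Rightarrow> (real ^ 'n) set \<Rightarrow> 'n row list \<times> nat \<Rightarrow> bool" where
  "slicing_parameters s C prm \<longleftrightarrow> (case prm of (cs, \<zeta>) \<Rightarrow>
     \<zeta> \<ge> 1 \<and>
     (\<forall>\<epsilon> > 0. \<forall>k. \<forall>x \<in> C \<inter> slice cs k (\<epsilon> / real \<zeta>) \<inter> int_points.
                 \<forall>y \<in> C \<inter> slice cs k (\<epsilon> / real \<zeta>) \<inter> int_points.
        s x \<le> (1 + \<epsilon>) * s y))"

definition sliceable :: "(real ^ 'n::finite \<Rightarrow> real) \<Rightarrow> (real ^ 'n) set \<Rightarrow> bool" where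
  "sliceable s C \<longleftrightarrow> (\<forall>x \<in> C. s x \<ge> 0) \<and> (\<exists>prm. slicing_parameters s C prm)"

definition sliceable_functions ::
  "(real ^ 'n::finite) set set \<Rightarrow> (real ^ 'n \<Rightarrow> real) set" where
  "sliceable_functions \<P> = {s. \<forall>P \<in> \<P>. sliceable s P}"

text \<open>Binary for the forms, unary for \<open>\<zeta>\<close>.\<close>

definition enc_slicing :: "'n::finite row list \<times> nat \<Rightarrow> val" where
  "enc_slicing prm = VList [enc_rows (fst prm), VList (replicate (snd prm) (VList []))]"


section \<open>Sums of products of basic and sliceable functions\<close>

text \<open>A summand \<open>g\<^sub>j s\<^sub>j\<close> is given by an encoding of \<open>g\<^sub>j\<close>, the function \<open>s\<^sub>j\<close>
  and slicing parameters of \<open>s\<^sub>j\<close>.\<close>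

type_synonym 'n summand = "val \<times> (real ^ 'n \<Rightarrow> real) \<times> ('n row list \<times> nat)"

definition sum_of_products ::
  "(val \<Rightarrow> (real ^ 'n::finite \<Rightarrow> real) option) \<Rightarrow> 'n summand list \<Rightarrow> real ^ 'n \<Rightarrow> real" where
  "sum_of_products dec ts x = (\<Sum>(u, s, prm) \<leftarrow> ts. the (dec u) x * s x)"

definition enc_instance :: "'n::finite summand list \<Rightarrow> 'n row list \<Rightarrow> val" where
  "enc_instance ts rs =
     VList [VList (map (\<lambda>(u, s, prm). VList [u, enc_slicing prm]) ts), enc_rows rs]"

text \<open>\<open>orc\<close> answers queries with tag \<open>i\<close> by the values of \<open>h\<close> at the integer points of \<open>D\<close>.\<close>

definition evaluation_oracle ::
  "real set \<Rightarrow> oracle_fun \<Rightarrow> int \<Rightarrow> (real ^ 'n::finite) set \<Rightarrow> (real ^ 'n \<Rightarrow> real) \<Rightarrow> bool" where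
  "evaluation_oracle K orc i D h \<longleftrightarrow>
     (\<forall>z. real_vec z \<in> D \<longrightarrow>
        h (real_vec z) \<in> K \<and>
        orc (VList [VInt i, enc_vec z]) = Some (VNum (h (real_vec z))))"

text \<open>The usual convention for oracle algorithms: oracle answers have size polynomial in the size of
  the query and of the input. It holds trivially if \<open>\<sigma>\<close> is bounded.\<close>

definition answers_bounded ::
  "(real \<Rightarrow> nat) \<Rightarrow> nat \<Rightarrow> val \<Rightarrow> (real ^ 'n::finite) set \<Rightarrow> (real ^ 'n \<Rightarrow> real) \<Rightarrow> bool" where
  "answers_bounded \<sigma> b v P h \<longleftrightarrow>
     (\<forall>z. real_vec z \<in> P \<longrightarrow>
        \<sigma> (h (real_vec z)) \<le> b * (vsize \<sigma> v + vsize \<sigma> (enc_vec z)) ^ b)"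

text \<open>Queries with tag 0 evaluate \<open>f\<close>, queries with tag \<open>j \<ge> 1\<close> evaluate the \<open>j\<close>-th sliceable
  function.\<close>

definition product_problems ::
  "(real \<Rightarrow> nat) \<Rightarrow> real set \<Rightarrow> nat \<Rightarrow> (real ^ 'n::finite) set set \<Rightarrow>
   (val \<Rightarrow> (real ^ 'n \<Rightarrow> real) option) \<Rightarrow> 'n problem set" where
  "product_problems \<sigma> K b \<P> dec =
     {\<lparr>input = enc_instance ts rs, orac = orc, objective = sum_of_products dec ts,
       region = polyhedron_of rs\<rparr>
      | ts rs orc.
        polyhedron_of rs \<in> \<P> \<and> ts \<noteq> [] \<and>
        (\<forall>(u, s, prm) \<in> set ts.
           u \<in> dom dec \<and> s \<in> sliceable_functions \<P> \<and>
           slicing_parameters s (polyhedron_of rs) prm \<and>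
           answers_bounded \<sigma> b (enc_instance ts rs) (polyhedron_of rs) s) \<and>
        (\<forall>j < length ts.
           evaluation_oracle K orc (int j + 1) (\<Union>\<P>) (fst (snd (ts ! j)))) \<and>
        evaluation_oracle K orc 0 (\<Union>\<P>) (sum_of_products dec ts) \<and>
        answers_bounded \<sigma> b (enc_instance ts rs) (polyhedron_of rs) (sum_of_products dec ts)}"

end

theory Submission
  imports Defs
begin

text \<open>
  Choose \<open>\<epsilon>'\<close> with \<open>(1 + \<epsilon>')\<^sup>3 \<le> 1 + \<epsilon>\<close> and cut the range of every slicing form at the integer
  parts of the powers of a common \<open>1 + \<delta>\<close>. On each resulting cell all \<open>s\<^sub>j\<close> are constant up to the
  factor \<open>1 + \<epsilon>'\<close>, so for an integer point \<open>y\<close> of the cell \<open>f\<close> may be replaced by the basic function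
  \<open>\<Sum>\<^sub>j s\<^sub>j(y) g\<^sub>j\<close>; sign compatibility ensures that the errors of the summands do not cancel. The
  given approximation scheme for basic functions minimizes this function over the cell and also
  decides whether a cell contains an integer point. The forms are processed one after
  the other, keeping only cells with integer points. A linear dependency between the normals bounds
  the dual VC dimension of half-spaces by \<open>n\<close>, so by the Sauer-Shelah lemma there are never more than
  polynomially many such cells. Cramer's rule for the vertices bounds the values of the forms on \<open>P\<close>,
  which makes the number of cuts polynomial.
\<close>


section \<open>Running a program as a subroutine\<close>

text \<open>The ends of a slice are fractional, but only polytopes with integer data may be handed
  to the scheme for basic functions, and programs cannot round numbers to integers. Integer forms
  take integer values at integer points, so cutting at the integer parts of the powers loses
  nothing, and these are quotients of integer powers. It also makes cells disjoint at integer
  points, whereas neighbouring closed slices share an end; the count of the cells relies on this.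
  Basic functions may be scaled by positive factors only, so the sum is taken over those
  \<open>j\<close> with \<open>s_j(y) > 0\<close>. If there are none, all \<open>s_j\<close> and
  hence \<open>f\<close> vanish at the integer points of the cell, and \<open>y\<close> itself is a
  candidate.

  The bound on the running time concerns one concrete program. To avoid writing it out,
  polynomial-time computability is a property of families of values over an arbitrary index set,
  closed under composition, branching and loops. An index may carry what no program can read, such
  as the functions \<open>s_j\<close>, and the counter of a loop is just one more component of the
  index.\<close>

primrec ebound :: "expr \<Rightarrow> nat" where
  "ebound (EVar x) = Suc x"
| "ebound (EInt i) = 0"
| "ebound ENil = 0"
| "ebound (ECons e1 e2) = max (ebound e1) (ebound e2)"
| "ebound (EHd e) = ebound e"
| "ebound (ETl e) = ebound e"
| "ebound (EKind e) = ebound e"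
| "ebound (EToNum e) = ebound e"
| "ebound (EBin op e1 e2) = max (ebound e1) (ebound e2)"

text \<open>All registers that a program mentions lie strictly below this number. A caller can
  therefore keep its own data in the registers from \<open>cbound c\<close> on.\<close>

primrec cbound :: "com \<Rightarrow> nat" where
  "cbound Skip = 0"
| "cbound (Assign x e) = max (Suc x) (ebound e)"
| "cbound (Query x e) = max (Suc x) (ebound e)"
| "cbound (Seq c1 c2) = max (cbound c1) (cbound c2)"
| "cbound (IfC e c1 c2) = max (ebound e) (max (cbound c1) (cbound c2))"
| "cbound (WhileC e c) = max (ebound e) (cbound c)"

lemma eval_expr_cong:
  "(\<And>x. x < ebound e \<Longrightarrow> s x = s' x) \<Longrightarrow> eval_expr e s = eval_expr e s'"
  by (induction e) auto

lemma ebound_subexprs: "e' \<in> set (subexprs e) \<Longrightarrow> ebound e' \<le> ebound e"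
  by (induction e) auto

lemma expr_cost_cong:
  assumes "\<And>x. x < ebound e \<Longrightarrow> s x = s' x"
  shows "expr_cost \<sigma> e s = expr_cost \<sigma> e s'"
  unfolding expr_cost_def
  by (intro arg_cong[where f = sum_list] map_cong refl arg_cong[where f = "vsize \<sigma>"] eval_expr_cong)
     (use assms ebound_subexprs in \<open>meson less_le_trans\<close>)

lemma vsize_pos: "vsize \<sigma> v \<ge> 1"
  by (cases v) auto

lemma vsize_le_expr_cost: "vsize \<sigma> (eval_expr e s) \<le> expr_cost \<sigma> e s"
  unfolding expr_cost_def by (cases e) auto

text \<open>Control flow, costs and results of \<open>c\<close> depend only on registers below
  \<open>m\<close>. So a run can be transplanted into a larger store, whose contents
  \<open>r\<close> from \<open>m\<close> on survive; this is what makes subroutine calls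
  possible.\<close>

lemma exec_frame:
  assumes "exec \<sigma> orc c s t s'" and "cbound c \<le> m"
  shows "exec \<sigma> orc c (\<lambda>x. if x < m then s x else r x) t (\<lambda>x. if x < m then s' x else r x)"
  using assms
proof (induction rule: exec.induct)
  case (exec_Skip s)
  show ?case by (rule exec.exec_Skip)
next
  case (exec_Assign x e s)
  let ?s = "\<lambda>x. if x < m then s x else r x"
  have 1: "eval_expr e ?s = eval_expr e s" "expr_cost \<sigma> e ?s = expr_cost \<sigma> e s"
    using exec_Assign.prems by (auto intro!: eval_expr_cong expr_cost_cong)
  have 2: "(\<lambda>y. if y < m then (s(x := eval_expr e s)) y else r y) = ?s(x := eval_expr e ?s)"
    using exec_Assign 1 by auto
  show ?case unfolding 2 using exec.exec_Assign[of \<sigma> orc x e ?s] 1 by simp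
next
  case (exec_Query e s v x)
  let ?s = "\<lambda>x. if x < m then s x else r x"
  have 1: "eval_expr e ?s = eval_expr e s" "expr_cost \<sigma> e ?s = expr_cost \<sigma> e s"
    using exec_Query.prems by (auto intro!: eval_expr_cong expr_cost_cong)
  have 2: "(\<lambda>y. if y < m then (s(x := v)) y else r y) = ?s(x := v)"
    using exec_Query 1 by auto
  show ?case unfolding 2 using exec.exec_Query[of orc e ?s v \<sigma> x] exec_Query 1 by simp
next
  case (exec_Seq c1 s t1 s1 c2 t2 s2)
  then show ?case by (auto intro: exec.exec_Seq)
next
  case (exec_IfTrue e s c1 t s' c2)
  let ?s = "\<lambda>x. if x < m then s x else r x"
  have 1: "eval_expr e ?s = eval_expr e s" "expr_cost \<sigma> e ?s = expr_cost \<sigma> e s"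
    using exec_IfTrue.prems by (auto intro!: eval_expr_cong expr_cost_cong)
  show ?case unfolding 1(2)[symmetric]
    by (rule exec.exec_IfTrue) (use exec_IfTrue 1 in auto)
next
  case (exec_IfFalse e s c2 t s' c1)
  let ?s = "\<lambda>x. if x < m then s x else r x"
  have 1: "eval_expr e ?s = eval_expr e s" "expr_cost \<sigma> e ?s = expr_cost \<sigma> e s"
    using exec_IfFalse.prems by (auto intro!: eval_expr_cong expr_cost_cong)
  show ?case unfolding 1(2)[symmetric]
    by (rule exec.exec_IfFalse[OF trans[OF 1(1)]]) (use exec_IfFalse in auto)
next
  case (exec_WhileFalse e s c)
  let ?s = "\<lambda>x. if x < m then s x else r x"
  have 1: "eval_expr e ?s = eval_expr e s" "expr_cost \<sigma> e ?s = expr_cost \<sigma> e s"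
    using exec_WhileFalse.prems by (auto intro!: eval_expr_cong expr_cost_cong)
  show ?case unfolding 1(2)[symmetric]
    by (rule exec.exec_WhileFalse[OF trans[OF 1(1)]]) (use exec_WhileFalse in auto)
next
  case (exec_WhileTrue e s c t1 s1 t2 s2)
  let ?s = "\<lambda>x. if x < m then s x else r x"
  have 1: "eval_expr e ?s = eval_expr e s" "expr_cost \<sigma> e ?s = expr_cost \<sigma> e s"
    using exec_WhileTrue.prems by (auto intro!: eval_expr_cong expr_cost_cong)
  show ?case unfolding 1(2)[symmetric]
    by (rule exec.exec_WhileTrue) (use exec_WhileTrue 1 in auto)
qed

text \<open>A terminating run has met only answered queries, so a larger oracle leaves it unchanged.
  The programs for basic functions run without oracle and are called from a program that has
  one.\<close>

lemma exec_oracle_mono: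
  assumes "exec \<sigma> orc c s t s'" and "\<And>q v. orc q = Some v \<Longrightarrow> orc' q = Some v"
  shows "exec \<sigma> orc' c s t s'"
  using assms by (induction rule: exec.induct) (blast intro: exec.intros)+

lemma computes_no_oracle:
  "computes \<sigma> no_oracle c v t w \<Longrightarrow> computes \<sigma> orc c v t w"
  unfolding computes_def using exec_oracle_mono[of \<sigma> no_oracle c _ t _ orc]
  by (force simp: no_oracle_def)

text \<open>Every write is charged at least the size of the value written. Hence a time bound also
  bounds the size of the output, which is what lets polynomial bounds compose.\<close>

lemma exec_vsize: "exec \<sigma> orc c s t s' \<Longrightarrow> vsize \<sigma> (s' x) \<le> vsize \<sigma> (s x) + t"
proof (induction rule: exec.induct)
  case (exec_Assign y e s)
  then show ?case using vsize_le_expr_cost[of \<sigma> e s] by auto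
qed auto

lemma computes_vsize: "computes \<sigma> orc c v t w \<Longrightarrow> vsize \<sigma> w \<le> vsize \<sigma> v + t"
  unfolding computes_def by (auto dest: exec_vsize[where x = 0])

text \<open>\<open>computes\<close> starts from a store that is empty except for register 0, so
  scratch registers must be emptied before a call. Register 0 already holds the argument and is
  skipped.\<close>

fun clear :: "nat \<Rightarrow> com" where
  "clear 0 = Skip"
| "clear (Suc k) = Seq (clear k) (if k = 0 then Skip else Assign k ENil)"

lemma exec_clear:
  "\<exists>t \<le> 2 * m + 1. exec \<sigma> orc (clear m) s t (\<lambda>x. if 0 < x \<and> x < m then VList [] else s x)"
proof (induction m)
  case 0
  then show ?case using exec_Skip by (auto intro!: exI[of _ 1])
next
  case (Suc m)
  let ?s = "\<lambda>x. if 0 < x \<and> x < m then VList [] else s x"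
  let ?s' = "\<lambda>x. if 0 < x \<and> x < Suc m then VList [] else s x"
  obtain t where t: "t \<le> 2 * m + 1" "exec \<sigma> orc (clear m) s t ?s" using Suc by blast
  show ?case
  proof (cases "m = 0")
    case True
    have "?s = ?s'" using True by auto
    then have "exec \<sigma> orc Skip ?s 1 ?s'" using exec_Skip[of \<sigma> orc ?s] by simp
    from exec.exec_Seq[OF t(2) this] have "exec \<sigma> orc (clear (Suc m)) s (t + 1) ?s'"
      using True by simp
    then show ?thesis using t(1) by (intro exI[of _ "t + 1"]) simp
  next
    case False
    have "?s' = ?s(m := VList [])" using False by auto
    then have "exec \<sigma> orc (Assign m ENil) ?s 1 ?s'"
      using exec_Assign[of \<sigma> orc m ENil ?s] by (simp add: expr_cost_def)
    from exec.exec_Seq[OF t(2) this] have "exec \<sigma> orc (clear (Suc m)) s (t + 1) ?s'"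
      using False by simp
    then show ?thesis using t(1) by (intro exI[of _ "t + 1"]) simp
  qed
qed

definition call :: "nat \<Rightarrow> expr \<Rightarrow> com \<Rightarrow> com" where
  "call m e c = Seq (Assign 0 e) (Seq (clear m) c)"

lemma exec_call:
  assumes "computes \<sigma> orc c (eval_expr e s) t w" and "cbound c \<le> m" and "m > 0"
  shows "\<exists>t' s'. exec \<sigma> orc (call m e c) s t' s' \<and> s' 0 = w \<and> (\<forall>x\<ge>m. s' x = s x) \<and>
    t' \<le> expr_cost \<sigma> e s + 2 * m + 1 + t"
proof -
  let ?i = "(\<lambda>_. VList [])(0 := eval_expr e s)"
  let ?s1 = "s(0 := eval_expr e s)"
  let ?s2 = "\<lambda>x. if 0 < x \<and> x < m then VList [] else ?s1 x"
  obtain s' where s': "exec \<sigma> orc c ?i t s'" "s' 0 = w"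
    using assms unfolding computes_def by auto
  \<comment> \<open>After clearing, the store is the initial store of \<open>c\<close> below
    \<open>m\<close> and the store of the caller above, as \<open>exec_frame\<close>
    requires.\<close>
  have "(\<lambda>x. if x < m then ?i x else s x) = ?s2" using assms by (auto simp: fun_eq_iff)
  with exec_frame[OF s'(1) assms(2), of s]
  have 3: "exec \<sigma> orc c ?s2 t (\<lambda>x. if x < m then s' x else s x)" by simp
  obtain t2 where t2: "t2 \<le> 2 * m + 1" "exec \<sigma> orc (clear m) ?s1 t2 ?s2"
    using exec_clear by blast
  have "exec \<sigma> orc (call m e c) s (expr_cost \<sigma> e s + (t2 + t)) (\<lambda>x. if x < m then s' x else s x)"
    unfolding call_def by (rule exec_Seq[OF exec_Assign exec_Seq[OF t2(2) 3]])
  moreover have "expr_cost \<sigma> e s + (t2 + t) \<le> expr_cost \<sigma> e s + 2 * m + 1 + t"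
    using t2(1) by simp
  ultimately show ?thesis
    by (intro exI[of _ "expr_cost \<sigma> e s + (t2 + t)"] exI[of _ "\<lambda>x. if x < m then s' x else s x"])
       (use s'(2) assms(3) in simp)
qed


section \<open>Polynomially bounded families\<close>

text \<open>With a base of at least 2, constants and constant factors are absorbed by the exponent,
  so a single number \<open>d\<close> describes the bound.\<close>

definition poly_bdd :: "'i set \<Rightarrow> ('i \<Rightarrow> nat) \<Rightarrow> ('i \<Rightarrow> nat) \<Rightarrow> bool" where
  "poly_bdd I S h \<longleftrightarrow> (\<exists>d. \<forall>i\<in>I. h i \<le> (2 + S i) ^ d)"

lemma poly_bddI: "(\<And>i. i \<in> I \<Longrightarrow> h i \<le> (2 + S i) ^ d) \<Longrightarrow> poly_bdd I S h"
  unfolding poly_bdd_def by blast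

lemma poly_bdd_mono:
  assumes "poly_bdd I S h" and "\<And>i. i \<in> I \<Longrightarrow> g i \<le> h i"
  shows "poly_bdd I S g"
  using assms unfolding poly_bdd_def by (meson order_trans)

lemma poly_bdd_size: "poly_bdd I S S"
  by (rule poly_bddI[where d = 1]) simp

lemma poly_bdd_const [simp]: "poly_bdd I S (\<lambda>_. k)"
proof (rule poly_bddI[where d = k])
  fix i
  have "k \<le> 2 ^ k" by (rule less_imp_le) simp
  also have "\<dots> \<le> (2 + S i) ^ k" by (rule power_mono) auto
  finally show "k \<le> (2 + S i) ^ k" .
qed

lemma poly_bdd_mult:
  assumes "poly_bdd I S g" and "poly_bdd I S h"
  shows "poly_bdd I S (\<lambda>i. g i * h i)"
proof -
  obtain a b where "\<forall>i\<in>I. g i \<le> (2 + S i) ^ a" "\<forall>i\<in>I. h i \<le> (2 + S i) ^ b"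
    using assms unfolding poly_bdd_def by blast
  then show ?thesis
    by (intro poly_bddI[where d = "a + b"]) (auto simp: power_add intro!: mult_mono)
qed

lemma poly_bdd_add:
  assumes "poly_bdd I S g" and "poly_bdd I S h"
  shows "poly_bdd I S (\<lambda>i. g i + h i)"
proof -
  obtain a b where ab: "\<forall>i\<in>I. g i \<le> (2 + S i) ^ a" "\<forall>i\<in>I. h i \<le> (2 + S i) ^ b"
    using assms unfolding poly_bdd_def by blast
  show ?thesis
  proof (rule poly_bddI[where d = "Suc (max a b)"])
    fix i assume i: "i \<in> I"
    have "g i + h i \<le> (2 + S i) ^ a + (2 + S i) ^ b" using ab i by (simp add: add_mono)
    also have "\<dots> \<le> (2 + S i) ^ max a b + (2 + S i) ^ max a b"
      by (intro add_mono power_increasing) auto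
    also have "\<dots> \<le> (2 + S i) ^ Suc (max a b)" by simp
    finally show "g i + h i \<le> (2 + S i) ^ Suc (max a b)" .
  qed
qed

lemma poly_bdd_power: "poly_bdd I S h \<Longrightarrow> poly_bdd I S (\<lambda>i. h i ^ k)"
  by (induction k) (auto intro: poly_bdd_mult)

lemma poly_bdd_reindex:
  assumes "poly_bdd I S h" and "\<And>j. j \<in> J \<Longrightarrow> \<pi> j \<in> I \<and> S' j = S (\<pi> j)"
  shows "poly_bdd J S' (\<lambda>j. h (\<pi> j))"
  using assms unfolding poly_bdd_def by (metis (no_types, lifting))

lemma poly_bdd_subset: "poly_bdd I S h \<Longrightarrow> J \<subseteq> I \<Longrightarrow> poly_bdd J S h"
  unfolding poly_bdd_def by blast

lemma poly_bdd_fst: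
  assumes "poly_bdd I S h" and "\<And>j. j \<in> J \<Longrightarrow> fst j \<in> I"
  shows "poly_bdd J (\<lambda>j. S (fst j)) (\<lambda>j. h (fst j))"
  by (rule poly_bdd_reindex[OF assms(1)]) (use assms(2) in auto)

text \<open>The size of a pair is the size of its first component, so one bound holds for all
  \<open>k\<close>. This turns the cost of a round of a loop into a bound that can be multiplied by
  the number of rounds.\<close>

lemma poly_bdd_uniform:
  assumes "poly_bdd J (\<lambda>j. S (fst j)) h"
  obtains T where "poly_bdd I S T" and "\<And>i k. (i, k) \<in> J \<Longrightarrow> h (i, k) \<le> T i"
proof -
  obtain d where d: "\<forall>j\<in>J. h j \<le> (2 + S (fst j)) ^ d"
    using assms unfolding poly_bdd_def by blast
  show ?thesis
    by (rule that[of "\<lambda>i. (2 + S i) ^ d"]) (use d in \<open>auto intro: poly_bddI\<close>)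
qed

lemma length_le_vsize: "length vs \<le> vsize \<sigma> (VList vs)"
proof -
  have "length vs \<le> sum_list (map (vsize \<sigma>) vs)"
    using sum_list_mono[of vs "\<lambda>_. 1" "vsize \<sigma>"] vsize_pos[of \<sigma>] by (simp add: sum_list_triv)
  then show ?thesis by simp
qed

lemma vsize_nth_le: "v \<in> set vs \<Longrightarrow> vsize \<sigma> v \<le> vsize \<sigma> (VList vs)"
  by (simp add: member_le_sum_list trans_le_add2 le_SucI)

section \<open>Families of values computable in polynomial time\<close>

text \<open>The input of a program is a list \<open>E i\<close> of values, the environment. The bound on its size is a
  premise inside the definition, so that the rules for composition do not have to carry it along.\<close>

definition poly_env :: "(real \<Rightarrow> nat) \<Rightarrow> 'i set \<Rightarrow> ('i \<Rightarrow> nat) \<Rightarrow> ('i \<Rightarrow> val list) \<Rightarrow> bool" where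
  "poly_env \<sigma> I S E \<longleftrightarrow> poly_bdd I S (\<lambda>i. vsize \<sigma> (VList (E i)))"

definition poly_comp :: "(real \<Rightarrow> nat) \<Rightarrow> 'i set \<Rightarrow> ('i \<Rightarrow> oracle_fun) \<Rightarrow> ('i \<Rightarrow> nat) \<Rightarrow>
    ('i \<Rightarrow> val list) \<Rightarrow> ('i \<Rightarrow> val) \<Rightarrow> bool" where
  "poly_comp \<sigma> I orc S E f \<longleftrightarrow> (poly_env \<sigma> I S E \<longrightarrow>
     (\<exists>c T. poly_bdd I S T \<and>
        (\<forall>i\<in>I. \<exists>t \<le> T i. computes \<sigma> (orc i) c (VList (E i)) t (f i))))"

lemma poly_env_Cons:
  assumes "poly_env \<sigma> I S E" and "poly_bdd I S (\<lambda>i. vsize \<sigma> (x i))"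
  shows "poly_env \<sigma> I S (\<lambda>i. x i # E i)"
  using poly_bdd_add[OF assms(2) assms(1)[unfolded poly_env_def]]
  unfolding poly_env_def by simp

lemma poly_env_ConsD:
  assumes "poly_env \<sigma> I S (\<lambda>i. x i # E i)"
  shows "poly_env \<sigma> I S E" and "poly_bdd I S (\<lambda>i. vsize \<sigma> (x i))"
  using assms unfolding poly_env_def by (auto elim!: poly_bdd_mono)

lemma poly_env_reindex:
  assumes "poly_env \<sigma> I S E" and "\<And>j. j \<in> J \<Longrightarrow> \<pi> j \<in> I \<and> S' j = S (\<pi> j)"
  shows "poly_env \<sigma> J S' (\<lambda>j. E (\<pi> j))"
  unfolding poly_env_def
  by (rule poly_bdd_reindex[OF assms(1)[unfolded poly_env_def]]) (rule assms(2))

lemma poly_env_fst: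
  assumes "poly_env \<sigma> I S E" and "\<And>j. j \<in> J \<Longrightarrow> fst j \<in> I"
  shows "poly_env \<sigma> J (\<lambda>j. S (fst j)) (\<lambda>j. E (fst j))"
  by (rule poly_env_reindex[OF assms(1)]) (use assms(2) in auto)

lemma poly_comp_vsize:
  assumes "poly_comp \<sigma> I orc S E f" and "poly_env \<sigma> I S E"
  shows "poly_bdd I S (\<lambda>i. vsize \<sigma> (f i))"
proof -
  obtain c T where T: "poly_bdd I S T"
    "\<forall>i\<in>I. \<exists>t \<le> T i. computes \<sigma> (orc i) c (VList (E i)) t (f i)"
    using assms unfolding poly_comp_def by blast
  have "vsize \<sigma> (f i) \<le> vsize \<sigma> (VList (E i)) + T i" if i: "i \<in> I" for i
  proof -
    obtain t where "t \<le> T i" "computes \<sigma> (orc i) c (VList (E i)) t (f i)" using T(2) i by blast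
    then show ?thesis using computes_vsize by fastforce
  qed
  then show ?thesis
    by (rule poly_bdd_mono[OF poly_bdd_add[OF assms(2)[unfolded poly_env_def] T(1)]])
qed

lemma poly_comp_cong:
  assumes "poly_comp \<sigma> I orc S E f"
    and "\<And>i. i \<in> I \<Longrightarrow> E i = E' i" and "\<And>i. i \<in> I \<Longrightarrow> f i = f' i"
  shows "poly_comp \<sigma> I orc S E' f'"
  using assms unfolding poly_comp_def poly_env_def poly_bdd_def by simp

text \<open>The same program serves the new index set. This carries facts about instances over to
  pairs of an instance and a loop variable.\<close>

lemma poly_comp_reindex:
  assumes "poly_comp \<sigma> I orc S E f" and "poly_env \<sigma> I S E"
    and "\<And>j. j \<in> J \<Longrightarrow> \<pi> j \<in> I \<and> S' j = S (\<pi> j) \<and> orc' j = orc (\<pi> j)"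
  shows "poly_comp \<sigma> J orc' S' (\<lambda>j. E (\<pi> j)) (\<lambda>j. f (\<pi> j))"
proof -
  obtain c T where T: "poly_bdd I S T"
    "\<forall>i\<in>I. \<exists>t \<le> T i. computes \<sigma> (orc i) c (VList (E i)) t (f i)"
    using assms unfolding poly_comp_def by blast
  have "poly_bdd J S' (\<lambda>j. T (\<pi> j))" by (rule poly_bdd_reindex[OF T(1)]) (use assms(3) in auto)
  moreover have "\<forall>j\<in>J. \<exists>t \<le> T (\<pi> j). computes \<sigma> (orc' j) c (VList (E (\<pi> j))) t (f (\<pi> j))"
    using T(2) assms(3) by metis
  ultimately show ?thesis unfolding poly_comp_def by blast
qed

section \<open>Composition, subroutine calls, branching and loops\<close>

lemma computesI:
  assumes "exec \<sigma> orc c ((\<lambda>_. VList [])(0 := v)) t s'" and "s' 0 = w"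
  shows "computes \<sigma> orc c v t w"
  using assms unfolding computes_def by blast

lemma poly_comp_expr:
  assumes "\<And>i. i \<in> I \<Longrightarrow> eval_expr e ((\<lambda>_. VList [])(0 := VList (E i))) = f i"
    and "poly_env \<sigma> I S E \<Longrightarrow>
      poly_bdd I S (\<lambda>i. expr_cost \<sigma> e ((\<lambda>_. VList [])(0 := VList (E i))))"
  shows "poly_comp \<sigma> I orc S E f"
  unfolding poly_comp_def
proof
  let ?s = "\<lambda>i. (\<lambda>_. VList [])(0 := VList (E i))"
  assume "poly_env \<sigma> I S E"
  then have "poly_bdd I S (\<lambda>i. expr_cost \<sigma> e (?s i))" using assms by blast
  moreover have "computes \<sigma> (orc i) (Assign 0 e) (VList (E i)) (expr_cost \<sigma> e (?s i)) (f i)"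
    if "i \<in> I" for i
    by (rule computesI[OF exec.exec_Assign]) (use assms that in simp)
  ultimately show "\<exists>c T. poly_bdd I S T \<and>
        (\<forall>i\<in>I. \<exists>t \<le> T i. computes \<sigma> (orc i) c (VList (E i)) t (f i))"
    by (intro exI[of _ "Assign 0 e"] exI[of _ "\<lambda>i. expr_cost \<sigma> e (?s i)"]) blast
qed

lemma expr_cost_simps:
  "expr_cost \<sigma> (EVar x) s = vsize \<sigma> (s x)"
  "expr_cost \<sigma> (EInt i) s = vsize \<sigma> (VInt i)"
  "expr_cost \<sigma> ENil s = 1"
  "expr_cost \<sigma> (ECons e1 e2) s =
     vsize \<sigma> (eval_expr (ECons e1 e2) s) + expr_cost \<sigma> e1 s + expr_cost \<sigma> e2 s"
  "expr_cost \<sigma> (EHd e) s = vsize \<sigma> (eval_expr (EHd e) s) + expr_cost \<sigma> e s"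
  "expr_cost \<sigma> (ETl e) s = vsize \<sigma> (eval_expr (ETl e) s) + expr_cost \<sigma> e s"
  "expr_cost \<sigma> (EKind e) s = vsize \<sigma> (eval_expr (EKind e) s) + expr_cost \<sigma> e s"
  "expr_cost \<sigma> (EToNum e) s = vsize \<sigma> (eval_expr (EToNum e) s) + expr_cost \<sigma> e s"
  "expr_cost \<sigma> (EBin op e1 e2) s =
     vsize \<sigma> (eval_expr (EBin op e1 e2) s) + expr_cost \<sigma> e1 s + expr_cost \<sigma> e2 s"
  by (simp_all add: expr_cost_def)

lemma poly_comp_weaken:
  assumes "poly_comp \<sigma> I orc S E f"
  shows "poly_comp \<sigma> I orc S (\<lambda>i. x i # E i) f"
  unfolding poly_comp_def
proof
  assume env: "poly_env \<sigma> I S (\<lambda>i. x i # E i)"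
  then obtain c T where T: "poly_bdd I S T"
    "\<forall>i\<in>I. \<exists>t \<le> T i. computes \<sigma> (orc i) c (VList (E i)) t (f i)"
    using assms poly_env_ConsD(1) unfolding poly_comp_def by blast
  define m where "m = Suc (cbound c)"
  have mb: "cbound c \<le> m" "m > 0" by (auto simp: m_def)
  let ?e = "ETl (EVar 0)"
  let ?T = "\<lambda>i. 2 * vsize \<sigma> (VList (x i # E i)) + (2 * m + 1) + T i"
  have "poly_bdd I S ?T"
    by (intro poly_bdd_add poly_bdd_mult T(1) env[unfolded poly_env_def] poly_bdd_const)
  moreover have "\<exists>t \<le> ?T i. computes \<sigma> (orc i) (call m ?e c) (VList (x i # E i)) t (f i)"
    if i: "i \<in> I" for i
  proof -
    let ?s = "(\<lambda>_. VList [])(0 := VList (x i # E i))"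
    obtain t where t: "t \<le> T i" "computes \<sigma> (orc i) c (VList (E i)) t (f i)" using T(2) i by blast
    have "eval_expr ?e ?s = VList (E i)" by simp
    then obtain t' s' where "exec \<sigma> (orc i) (call m ?e c) ?s t' s'" "s' 0 = f i"
      "t' \<le> expr_cost \<sigma> ?e ?s + 2 * m + 1 + t"
      using exec_call[of \<sigma> "orc i" c ?e ?s t "f i" m] t(2) mb by auto
    then show ?thesis
      using t(1) by (intro exI[of _ t']) (auto intro!: computesI simp: expr_cost_simps)
  qed
  ultimately show "\<exists>c T. poly_bdd I S T \<and>
        (\<forall>i\<in>I. \<exists>t \<le> T i. computes \<sigma> (orc i) c (VList (x i # E i)) t (f i))"
    by (intro exI[of _ "call m ?e c"] exI[of _ ?T]) blast
qed

text \<open>The composition rule. A result is pushed onto the environment, much as in de Bruijn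
  contexts; the environment stays polynomial because a result is no larger than input and running
  time together (\<open>poly_comp_vsize\<close>).\<close>

lemma poly_comp_let:
  assumes f: "poly_comp \<sigma> I orc S E f" and g: "poly_comp \<sigma> I orc S (\<lambda>i. f i # E i) g"
  shows "poly_comp \<sigma> I orc S E g"
  unfolding poly_comp_def
proof
  assume env: "poly_env \<sigma> I S E"
  then obtain c T where T: "poly_bdd I S T"
    "\<forall>i\<in>I. \<exists>t \<le> T i. computes \<sigma> (orc i) c (VList (E i)) t (f i)"
    using f unfolding poly_comp_def by blast
  have env': "poly_env \<sigma> I S (\<lambda>i. f i # E i)"
    using poly_env_Cons[OF env poly_comp_vsize[OF f env]] .
  then obtain c' T' where T': "poly_bdd I S T'"
    "\<forall>i\<in>I. \<exists>t \<le> T' i. computes \<sigma> (orc i) c' (VList (f i # E i)) t (g i)"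
    using g unfolding poly_comp_def by blast
  define m where "m = Suc (max (cbound c) (cbound c'))"
  have mb: "cbound c \<le> m" "cbound c' \<le> m" "m > 0" by (auto simp: m_def)
  \<comment> \<open>Register \<open>m\<close> keeps the environment while the first program
    runs.\<close>
  let ?P = "Seq (Assign m (EVar 0)) (Seq (call m (EVar m) c) (call m (ECons (EVar 0) (EVar m)) c'))"
  let ?T = "\<lambda>i. 5 * vsize \<sigma> (VList (f i # E i)) + (4 * m + 2) + T i + T' i"
  have "poly_bdd I S ?T"
    by (intro poly_bdd_add poly_bdd_mult T(1) T'(1) env'[unfolded poly_env_def] poly_bdd_const)
  moreover have "\<exists>t \<le> ?T i. computes \<sigma> (orc i) ?P (VList (E i)) t (g i)"
    if i: "i \<in> I" for i
  proof -
    let ?s = "(\<lambda>_. VList [])(0 := VList (E i))"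
    let ?s1 = "?s(m := VList (E i))"
    obtain t where t: "t \<le> T i" "computes \<sigma> (orc i) c (VList (E i)) t (f i)" using T(2) i by blast
    obtain t' where t': "t' \<le> T' i" "computes \<sigma> (orc i) c' (VList (f i # E i)) t' (g i)"
      using T'(2) i by blast
    have 1: "exec \<sigma> (orc i) (Assign m (EVar 0)) ?s (vsize \<sigma> (VList (E i))) ?s1"
      using exec_Assign[of \<sigma> "orc i" m "EVar 0" ?s] by (simp add: expr_cost_simps)
    obtain u s2 where 2: "exec \<sigma> (orc i) (call m (EVar m) c) ?s1 u s2" "s2 0 = f i"
      "\<And>x. x \<ge> m \<Longrightarrow> s2 x = ?s1 x" "u \<le> expr_cost \<sigma> (EVar m) ?s1 + 2 * m + 1 + t"
      using exec_call[of \<sigma> "orc i" c "EVar m" ?s1 t "f i" m] t(2) mb by auto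
    have m: "s2 m = VList (E i)" using 2(3)[of m] by simp
    then have "computes \<sigma> (orc i) c' (eval_expr (ECons (EVar 0) (EVar m)) s2) t' (g i)"
      using 2(2) t'(2) by simp
    then obtain u' s3 where 3: "exec \<sigma> (orc i) (call m (ECons (EVar 0) (EVar m)) c') s2 u' s3"
      "s3 0 = g i" "u' \<le> expr_cost \<sigma> (ECons (EVar 0) (EVar m)) s2 + 2 * m + 1 + t'"
      using exec_call[of \<sigma> "orc i" c' "ECons (EVar 0) (EVar m)" s2 t' "g i" m] mb by auto
    have "computes \<sigma> (orc i) ?P (VList (E i)) (vsize \<sigma> (VList (E i)) + (u + u')) (g i)"
      by (rule computesI[OF exec_Seq[OF 1 exec_Seq[OF 2(1) 3(1)]] 3(2)])
    moreover have "vsize \<sigma> (VList (E i)) + (u + u') \<le> ?T i"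
      using 2(2,4) 3(3) t(1) t'(1) m by (simp add: expr_cost_simps)
    ultimately show ?thesis by blast
  qed
  ultimately show "\<exists>c T. poly_bdd I S T \<and>
        (\<forall>i\<in>I. \<exists>t \<le> T i. computes \<sigma> (orc i) c (VList (E i)) t (g i))"
    by (intro exI[of _ ?P] exI[of _ ?T]) blast
qed

text \<open>For programs supplied from outside, whose input is the single value \<open>f i\<close>
  and not an environment.\<close>

lemma poly_comp_call:
  assumes f: "poly_comp \<sigma> I orc S E f"
    and g: "\<And>i. i \<in> I \<Longrightarrow> \<exists>t \<le> T i. computes \<sigma> (orc i) c (f i) t (g i)" and T: "poly_env \<sigma> I S E \<Longrightarrow> poly_bdd I S T"
  shows "poly_comp \<sigma> I orc S E g"
proof (rule poly_comp_let[OF f], unfold poly_comp_def, rule)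
  assume env: "poly_env \<sigma> I S (\<lambda>i. f i # E i)"
  define m where "m = Suc (cbound c)"
  have mb: "cbound c \<le> m" "m > 0" by (auto simp: m_def)
  let ?e = "EHd (EVar 0)"
  let ?T = "\<lambda>i. 2 * vsize \<sigma> (VList (f i # E i)) + (2 * m + 1) + T i"
  have "poly_bdd I S ?T"
    by (intro poly_bdd_add poly_bdd_mult T env[unfolded poly_env_def] poly_bdd_const poly_env_ConsD(1)[OF env])
  moreover have "\<exists>t \<le> ?T i. computes \<sigma> (orc i) (call m ?e c) (VList (f i # E i)) t (g i)"
    if i: "i \<in> I" for i
  proof -
    let ?s = "(\<lambda>_. VList [])(0 := VList (f i # E i))"
    obtain t where t: "t \<le> T i" "computes \<sigma> (orc i) c (f i) t (g i)" using g i by blast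
    have "eval_expr ?e ?s = f i" by simp
    then obtain t' s' where "exec \<sigma> (orc i) (call m ?e c) ?s t' s'" "s' 0 = g i"
      "t' \<le> expr_cost \<sigma> ?e ?s + 2 * m + 1 + t"
      using exec_call[of \<sigma> "orc i" c ?e ?s t "g i" m] t(2) mb by auto
    then show ?thesis
      using t(1) by (intro exI[of _ t']) (auto intro!: computesI simp: expr_cost_simps)
  qed
  ultimately show "\<exists>c T. poly_bdd I S T \<and>
        (\<forall>i\<in>I. \<exists>t \<le> T i. computes \<sigma> (orc i) c (VList (f i # E i)) t (g i))"
    by (intro exI[of _ "call m ?e c"] exI[of _ ?T]) blast
qed

lemma poly_comp_query:
  assumes f: "poly_comp \<sigma> I orc S E f"
    and g: "\<And>i. i \<in> I \<Longrightarrow> orc i (f i) = Some (g i)" and size: "poly_bdd I S (\<lambda>i. vsize \<sigma> (g i))"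
  shows "poly_comp \<sigma> I orc S E g"
proof (rule poly_comp_let[OF f], unfold poly_comp_def, rule)
  assume env: "poly_env \<sigma> I S (\<lambda>i. f i # E i)"
  let ?e = "EHd (EVar 0)"
  let ?T = "\<lambda>i. 2 * vsize \<sigma> (VList (f i # E i)) + vsize \<sigma> (g i)"
  have "poly_bdd I S ?T"
    by (intro poly_bdd_add poly_bdd_mult size env[unfolded poly_env_def] poly_bdd_const)
  moreover have "\<exists>t \<le> ?T i. computes \<sigma> (orc i) (Query 0 ?e) (VList (f i # E i)) t (g i)"
    if i: "i \<in> I" for i
  proof -
    let ?s = "(\<lambda>_. VList [])(0 := VList (f i # E i))"
    have "exec \<sigma> (orc i) (Query 0 ?e) ?s (expr_cost \<sigma> ?e ?s + vsize \<sigma> (g i)) (?s(0 := g i))"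
      by (rule exec.exec_Query) (use g i in simp)
    then show ?thesis
      by (intro exI[of _ "expr_cost \<sigma> ?e ?s + vsize \<sigma> (g i)"]) (auto intro!: computesI simp: expr_cost_simps)
  qed
  ultimately show "\<exists>c T. poly_bdd I S T \<and>
        (\<forall>i\<in>I. \<exists>t \<le> T i. computes \<sigma> (orc i) c (VList (f i # E i)) t (g i))"
    by (intro exI[of _ "Query 0 ?e"] exI[of _ ?T]) blast
qed

lemma poly_comp_if:
  assumes c: "poly_comp \<sigma> I orc S E c" and b: "\<And>i. i \<in> I \<Longrightarrow> c i \<noteq> VInt 0 \<longleftrightarrow> b i"
    and f: "poly_comp \<sigma> {i\<in>I. b i} orc S E f" and g: "poly_comp \<sigma> {i\<in>I. \<not> b i} orc S E g"
  shows "poly_comp \<sigma> I orc S E (\<lambda>i. if b i then f i else g i)"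
proof (rule poly_comp_let[OF c], unfold poly_comp_def, rule)
  assume env: "poly_env \<sigma> I S (\<lambda>i. c i # E i)"
  have env': "poly_env \<sigma> {i\<in>I. b i} S (\<lambda>i. c i # E i)" "poly_env \<sigma> {i\<in>I. \<not> b i} S (\<lambda>i. c i # E i)"
    using env unfolding poly_env_def by (auto elim: poly_bdd_subset)
  obtain cf Tf where Tf: "poly_bdd {i\<in>I. b i} S Tf"
    "\<forall>i\<in>{i\<in>I. b i}. \<exists>t \<le> Tf i. computes \<sigma> (orc i) cf (VList (c i # E i)) t (f i)"
    using poly_comp_weaken[OF f, of c] env' unfolding poly_comp_def by blast
  obtain cg Tg where Tg: "poly_bdd {i\<in>I. \<not> b i} S Tg"
    "\<forall>i\<in>{i\<in>I. \<not> b i}. \<exists>t \<le> Tg i. computes \<sigma> (orc i) cg (VList (c i # E i)) t (g i)"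
    using poly_comp_weaken[OF g, of c] env' unfolding poly_comp_def by blast
  \<comment> \<open>Outside their own case \<open>Tf\<close> and \<open>Tg\<close> are arbitrary;
    the two explicit polynomials bound the time on all of \<open>I\<close>.\<close>
  obtain df dg where d: "\<forall>i\<in>{i\<in>I. b i}. Tf i \<le> (2 + S i) ^ df" "\<forall>i\<in>{i\<in>I. \<not> b i}. Tg i \<le> (2 + S i) ^ dg"
    using Tf(1) Tg(1) unfolding poly_bdd_def by blast
  let ?e = "EHd (EVar 0)"
  let ?P = "IfC ?e cf cg"
  let ?T = "\<lambda>i. 2 * vsize \<sigma> (VList (c i # E i)) + (2 + S i) ^ df + (2 + S i) ^ dg"
  have "poly_bdd I S ?T"
    by (intro poly_bdd_add poly_bdd_mult env[unfolded poly_env_def] poly_bdd_const poly_bdd_power poly_bdd_size)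
  moreover have "\<exists>t \<le> ?T i. computes \<sigma> (orc i) ?P (VList (c i # E i)) t (if b i then f i else g i)"
    if i: "i \<in> I" for i
  proof (cases "b i")
    case True
    let ?s = "(\<lambda>_. VList [])(0 := VList (c i # E i))"
    obtain t where t: "t \<le> Tf i" "computes \<sigma> (orc i) cf (VList (c i # E i)) t (f i)"
      using Tf(2) i True by auto
    then obtain s' where s': "exec \<sigma> (orc i) cf ?s t s'" "s' 0 = f i" unfolding computes_def by blast
    have "exec \<sigma> (orc i) ?P ?s (expr_cost \<sigma> ?e ?s + t) s'"
      by (rule exec.exec_IfTrue) (use s' b i True in auto)
    then have "computes \<sigma> (orc i) ?P (VList (c i # E i)) (expr_cost \<sigma> ?e ?s + t) (f i)"
      using s'(2) by (rule computesI)
    moreover have "t \<le> (2 + S i) ^ df" using t(1) d(1) i True by force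
    ultimately show ?thesis
      using True by (intro exI[of _ "expr_cost \<sigma> ?e ?s + t"]) (auto simp: expr_cost_simps)
  next
    case False
    let ?s = "(\<lambda>_. VList [])(0 := VList (c i # E i))"
    obtain t where t: "t \<le> Tg i" "computes \<sigma> (orc i) cg (VList (c i # E i)) t (g i)"
      using Tg(2) i False by auto
    then obtain s' where s': "exec \<sigma> (orc i) cg ?s t s'" "s' 0 = g i" unfolding computes_def by blast
    have "exec \<sigma> (orc i) ?P ?s (expr_cost \<sigma> ?e ?s + t) s'"
      by (rule exec.exec_IfFalse) (use s' b i False in auto)
    then have "computes \<sigma> (orc i) ?P (VList (c i # E i)) (expr_cost \<sigma> ?e ?s + t) (g i)"
      using s'(2) by (rule computesI)
    moreover have "t \<le> (2 + S i) ^ dg" using t(1) d(2) i False by force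
    ultimately show ?thesis
      using False by (intro exI[of _ "expr_cost \<sigma> ?e ?s + t"]) (auto simp: expr_cost_simps)
  qed
  ultimately show "\<exists>c' T. poly_bdd I S T \<and>
        (\<forall>i\<in>I. \<exists>t \<le> T i. computes \<sigma> (orc i) c' (VList (c i # E i)) t (if b i then f i else g i))"
    by (intro exI[of _ ?P] exI[of _ ?T]) blast
qed

text \<open>\<open>st i k\<close> is the state after \<open>k\<close> rounds. Test and body are
  families over pairs \<open>(i, k)\<close> whose size is that of \<open>i\<close>, so one
  polynomial bounds every round. The size of the states is a premise of its own, since repeating a
  polynomial-time step may let values grow exponentially.\<close>

lemma poly_comp_while:
  fixes st cnd :: "'i \<Rightarrow> nat \<Rightarrow> val"
  assumes init: "poly_comp \<sigma> I orc S E (\<lambda>i. st i 0)"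
    and cnd: "poly_comp \<sigma> {(i, k). i \<in> I \<and> k \<le> n i} (\<lambda>j. orc (fst j)) (\<lambda>j. S (fst j))
      (\<lambda>(i, k). st i k # E i) (\<lambda>(i, k). cnd i k)"
    and body: "poly_comp \<sigma> {(i, k). i \<in> I \<and> k < n i} (\<lambda>j. orc (fst j)) (\<lambda>j. S (fst j))
      (\<lambda>(i, k). st i k # E i) (\<lambda>(i, k). st i (Suc k))"
    and test: "\<And>i k. i \<in> I \<Longrightarrow> k < n i \<Longrightarrow> cnd i k \<noteq> VInt 0" "\<And>i. i \<in> I \<Longrightarrow> cnd i (n i) = VInt 0"
    and n: "poly_bdd I S n"
    and st: "poly_bdd {(i, k). i \<in> I \<and> k \<le> n i} (\<lambda>j. S (fst j)) (\<lambda>(i, k). vsize \<sigma> (st i k))"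
  shows "poly_comp \<sigma> I orc S E (\<lambda>i. st i (n i))"
  unfolding poly_comp_def
proof
  assume env: "poly_env \<sigma> I S E"
  let ?J = "{(i, k). i \<in> I \<and> k \<le> n i}" and ?J' = "{(i, k). i \<in> I \<and> k < n i}"
  let ?S = "\<lambda>j :: 'i \<times> nat. S (fst j)"
  have env': "poly_env \<sigma> ?J ?S (\<lambda>(i, k). st i k # E i)"
  proof -
    have "poly_env \<sigma> ?J ?S (\<lambda>j. E (fst j))" by (rule poly_env_fst[OF env]) auto
    moreover have "poly_bdd ?J ?S (\<lambda>j. vsize \<sigma> (st (fst j) (snd j)))"
      using st by (simp add: case_prod_beta')
    ultimately show ?thesis unfolding case_prod_beta' by (rule poly_env_Cons)
  qed
  have env'': "poly_env \<sigma> ?J' ?S (\<lambda>(i, k). st i k # E i)"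
    using env' unfolding poly_env_def by (rule poly_bdd_subset) auto
  obtain c1 T1 where 1: "poly_bdd I S T1"
    "\<forall>i\<in>I. \<exists>t \<le> T1 i. computes \<sigma> (orc i) c1 (VList (E i)) t (st i 0)"
    using init env unfolding poly_comp_def by blast
  obtain c2 T2' where 2: "poly_bdd ?J ?S T2'"
    "\<forall>j\<in>?J. \<exists>t \<le> T2' j. computes \<sigma> (orc (fst j)) c2 (VList (case j of (i, k) \<Rightarrow> st i k # E i)) t
        (case j of (i, k) \<Rightarrow> cnd i k)"
    using cnd env' unfolding poly_comp_def by blast
  obtain T2 where T2: "poly_bdd I S T2" "\<And>i k. (i, k) \<in> ?J \<Longrightarrow> T2' (i, k) \<le> T2 i"
    using poly_bdd_uniform[OF 2(1)] by blast
  obtain c3 T3' where 3: "poly_bdd ?J' ?S T3'"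
    "\<forall>j\<in>?J'. \<exists>t \<le> T3' j. computes \<sigma> (orc (fst j)) c3 (VList (case j of (i, k) \<Rightarrow> st i k # E i)) t
        (case j of (i, k) \<Rightarrow> st i (Suc k))"
    using body env'' unfolding poly_comp_def by blast
  obtain T3 where T3: "poly_bdd I S T3" "\<And>i k. (i, k) \<in> ?J' \<Longrightarrow> T3' (i, k) \<le> T3 i"
    using poly_bdd_uniform[OF 3(1)] by blast
  obtain V where V: "poly_bdd I S V" "\<And>i k. (i, k) \<in> ?J \<Longrightarrow> vsize \<sigma> (st i k) \<le> V i"
    using poly_bdd_uniform[OF st] by (metis (no_types, lifting) case_prod_conv)
  define W where "W i = vsize \<sigma> (VList (E i)) + V i" for i
  have W: "poly_bdd I S W" unfolding W_def
    by (intro poly_bdd_add V(1) env[unfolded poly_env_def])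
  have W': "vsize \<sigma> (VList (E i)) \<le> W i" "k \<le> n i \<Longrightarrow> vsize \<sigma> (st i k) \<le> W i"
     "k \<le> n i \<Longrightarrow> vsize \<sigma> (st i k) + vsize \<sigma> (VList (E i)) \<le> W i" if "i \<in> I" for i k
    using V(2)[of i k] that unfolding W_def by auto
  define m where "m = Suc (max (cbound c1) (max (cbound c2) (cbound c3)))"
  have mb: "cbound c1 \<le> m" "cbound c2 \<le> m" "cbound c3 \<le> m" "m > 0" by (auto simp: m_def)
  \<comment> \<open>Register \<open>m\<close> keeps the environment and \<open>Suc m\<close> the
    state. The value of the test sits in register 0 and is recomputed at the end of each round,
    since a condition of the language is a single expression.\<close>
  define e where "e = ECons (EVar (Suc m)) (EVar m)"
  define B where "B = Seq (call m e c3) (Seq (Assign (Suc m) (EVar 0)) (call m e c2))"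
  define L where "L = WhileC (EVar 0) B"
  define P where "P = Seq (Assign m (EVar 0)) (Seq (call m (EVar m) c1)
    (Seq (Assign (Suc m) (EVar 0)) (Seq (call m e c2) (Seq L (Assign 0 (EVar (Suc m)))))))"
  have cost_e: "expr_cost \<sigma> e s \<le> 2 * W i" if "s (Suc m) = st i k" "s m = VList (E i)" "i \<in> I" "k \<le> n i" for s i k
    using that W'(3)[of i k] by (simp add: e_def expr_cost_simps)
  have cond: "\<exists>t s'. exec \<sigma> (orc i) (call m e c2) s t s' \<and> s' 0 = cnd i k \<and> s' m = VList (E i) \<and>
      s' (Suc m) = st i k \<and> t \<le> 2 * W i + 2 * m + 1 + T2 i"
    if s: "s (Suc m) = st i k" "s m = VList (E i)" and i: "i \<in> I" "k \<le> n i" for s i k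
  proof -
    obtain t where t: "t \<le> T2' (i, k)" "computes \<sigma> (orc i) c2 (VList (st i k # E i)) t (cnd i k)"
      using 2(2)[rule_format, of "(i, k)"] i by auto
    have "computes \<sigma> (orc i) c2 (eval_expr e s) t (cnd i k)" using t(2) s by (simp add: e_def)
    then obtain t' s' where "exec \<sigma> (orc i) (call m e c2) s t' s'" "s' 0 = cnd i k"
      "\<And>x. x \<ge> m \<Longrightarrow> s' x = s x" "t' \<le> expr_cost \<sigma> e s + 2 * m + 1 + t"
      using exec_call[of \<sigma> "orc i" c2 e s t "cnd i k" m] mb by auto
    then show ?thesis using s t(1) cost_e[OF s i] T2(2)[of i k] i
      by (intro exI[of _ t'] exI[of _ s']) auto
  qed
  define Q where "Q i = 5 * W i + 4 * m + 2 + T2 i + T3 i + 1" for i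
  have step: "\<exists>t s'. exec \<sigma> (orc i) B s t s' \<and> s' 0 = cnd i (Suc k) \<and> s' m = VList (E i) \<and>
      s' (Suc m) = st i (Suc k) \<and> t \<le> Q i"
    if s: "s (Suc m) = st i k" "s m = VList (E i)" and i: "i \<in> I" "k < n i" for s i k
  proof -
    obtain t where t: "t \<le> T3' (i, k)" "computes \<sigma> (orc i) c3 (VList (st i k # E i)) t (st i (Suc k))"
      using 3(2)[rule_format, of "(i, k)"] i by auto
    have "computes \<sigma> (orc i) c3 (eval_expr e s) t (st i (Suc k))" using t(2) s by (simp add: e_def)
    then obtain t1 s1 where s1: "exec \<sigma> (orc i) (call m e c3) s t1 s1" "s1 0 = st i (Suc k)"
      "\<And>x. x \<ge> m \<Longrightarrow> s1 x = s x" "t1 \<le> expr_cost \<sigma> e s + 2 * m + 1 + t"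
      using exec_call[of \<sigma> "orc i" c3 e s t "st i (Suc k)" m] mb by auto
    let ?s2 = "s1(Suc m := st i (Suc k))"
    have s2: "exec \<sigma> (orc i) (Assign (Suc m) (EVar 0)) s1 (vsize \<sigma> (st i (Suc k))) ?s2"
      using exec_Assign[of \<sigma> "orc i" "Suc m" "EVar 0" s1] s1(2) by (simp add: expr_cost_simps)
    obtain t3 s3 where s3: "exec \<sigma> (orc i) (call m e c2) ?s2 t3 s3" "s3 0 = cnd i (Suc k)"
      "s3 m = VList (E i)" "s3 (Suc m) = st i (Suc k)" "t3 \<le> 2 * W i + 2 * m + 1 + T2 i"
      using cond[of ?s2 i "Suc k"] s1(3)[of m] s(2) i by auto
    have "exec \<sigma> (orc i) B s (t1 + (vsize \<sigma> (st i (Suc k)) + t3)) s3"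
      unfolding B_def by (rule exec_Seq[OF s1(1) exec_Seq[OF s2 s3(1)]])
    moreover have "t1 + (vsize \<sigma> (st i (Suc k)) + t3) \<le> Q i"
      using s1(4) s3(5) W'(2)[OF i(1), of "Suc k"] cost_e[OF s i(1)] t(1) T3(2)[of i k] i
      unfolding Q_def by auto
    ultimately show ?thesis using s3 by blast
  qed
  define R where "R i = Q i + W i + T2 i + 2 * m + 1" for i
  have cnd_size: "vsize \<sigma> (cnd i k) \<le> 1 + W i + T2 i" if i: "i \<in> I" "k \<le> n i" for i k
  proof -
    obtain t where t: "t \<le> T2' (i, k)" "computes \<sigma> (orc i) c2 (VList (st i k # E i)) t (cnd i k)"
      using 2(2)[rule_format, of "(i, k)"] i by auto
    show ?thesis using computes_vsize[OF t(2)] W'(3)[of i k] t(1) T2(2)[of i k] i by auto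
  qed
  \<comment> \<open>Induction on the remaining rounds; the additional 1 pays for the last, failing
    test.\<close>
  have loop: "\<exists>t s'. exec \<sigma> (orc i) L s t s' \<and> s' (Suc m) = st i (n i) \<and> t \<le> (n i - k + 1) * R i"
    if "s (Suc m) = st i k" "s m = VList (E i)" "s 0 = cnd i k" "i \<in> I" "k \<le> n i" for s i k
    using that
  proof (induction "n i - k" arbitrary: s k)
    case 0
    then have k: "k = n i" by simp
    have "exec \<sigma> (orc i) L s (expr_cost \<sigma> (EVar 0) s) s"
      unfolding L_def by (rule exec_WhileFalse) (use test 0 k in simp)
    moreover have "expr_cost \<sigma> (EVar 0) s \<le> R i"
      using cnd_size[of i k] 0 by (simp add: expr_cost_simps R_def)
    ultimately show ?case using 0(2) k by (intro exI[of _ "expr_cost \<sigma> (EVar 0) s"] exI[of _ s]) auto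
  next
    case (Suc l)
    then have k: "k < n i" by simp
    obtain t1 s1 where s1: "exec \<sigma> (orc i) B s t1 s1" "s1 0 = cnd i (Suc k)" "s1 m = VList (E i)"
      "s1 (Suc m) = st i (Suc k)" "t1 \<le> Q i"
      using step[OF Suc(3,4,6) k] by blast
    have "l = n i - Suc k" using Suc(2) by linarith
    then obtain t2 s2 where s2: "exec \<sigma> (orc i) L s1 t2 s2" "s2 (Suc m) = st i (n i)" "t2 \<le> (n i - Suc k + 1) * R i"
      using Suc(1)[OF _ s1(4,3,2) Suc.prems(4)] k by auto
    have "exec \<sigma> (orc i) L s (expr_cost \<sigma> (EVar 0) s + t1 + t2) s2"
      unfolding L_def by (rule exec_WhileTrue[OF _ s1(1) s2(1)[unfolded L_def]])
        (use test Suc k in simp)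
    moreover have "expr_cost \<sigma> (EVar 0) s + t1 \<le> R i"
      using cnd_size[of i k] Suc.prems s1(5) by (simp add: expr_cost_simps R_def)
    moreover have "n i - k + 1 = Suc (n i - Suc k + 1)" using k by simp
    ultimately show ?case using s2 by (intro exI[of _ "expr_cost \<sigma> (EVar 0) s + t1 + t2"] exI[of _ s2]) auto
  qed
  let ?T = "\<lambda>i. 2 * W i + (2 * m + 1) + T1 i + W i + 2 * W i + (2 * m + 1) + T2 i + (n i + 1) * R i + W i"
  have "poly_bdd I S ?T" unfolding R_def Q_def
    by (intro poly_bdd_add poly_bdd_mult 1(1) T2(1) T3(1) W n poly_bdd_const)
  moreover have "\<exists>t \<le> ?T i. computes \<sigma> (orc i) P (VList (E i)) t (st i (n i))"
    if i: "i \<in> I" for i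
  proof -
    let ?s = "(\<lambda>_. VList [])(0 := VList (E i))"
    let ?s1 = "?s(m := VList (E i))"
    obtain t where t: "t \<le> T1 i" "computes \<sigma> (orc i) c1 (VList (E i)) t (st i 0)" using 1(2) i by blast
    have p1: "exec \<sigma> (orc i) (Assign m (EVar 0)) ?s (vsize \<sigma> (VList (E i))) ?s1"
      using exec_Assign[of \<sigma> "orc i" m "EVar 0" ?s] by (simp add: expr_cost_simps)
    obtain t2 s2 where p2: "exec \<sigma> (orc i) (call m (EVar m) c1) ?s1 t2 s2" "s2 0 = st i 0"
      "\<And>x. x \<ge> m \<Longrightarrow> s2 x = ?s1 x" "t2 \<le> expr_cost \<sigma> (EVar m) ?s1 + 2 * m + 1 + t"
      using exec_call[of \<sigma> "orc i" c1 "EVar m" ?s1 t "st i 0" m] t(2) mb by auto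
    let ?s3 = "s2(Suc m := st i 0)"
    have p3: "exec \<sigma> (orc i) (Assign (Suc m) (EVar 0)) s2 (vsize \<sigma> (st i 0)) ?s3"
      using exec_Assign[of \<sigma> "orc i" "Suc m" "EVar 0" s2] p2(2) by (simp add: expr_cost_simps)
    obtain t4 s4 where p4: "exec \<sigma> (orc i) (call m e c2) ?s3 t4 s4" "s4 0 = cnd i 0"
      "s4 m = VList (E i)" "s4 (Suc m) = st i 0" "t4 \<le> 2 * W i + 2 * m + 1 + T2 i"
      using cond[of ?s3 i 0] p2(3)[of m] i by auto
    obtain t5 s5 where p5: "exec \<sigma> (orc i) L s4 t5 s5" "s5 (Suc m) = st i (n i)" "t5 \<le> (n i + 1) * R i"
      using loop[of s4 i 0] p4 i by auto
    have p6: "exec \<sigma> (orc i) (Assign 0 (EVar (Suc m))) s5 (vsize \<sigma> (st i (n i))) (s5(0 := st i (n i)))"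
      using exec_Assign[of \<sigma> "orc i" 0 "EVar (Suc m)" s5] p5(2) by (simp add: expr_cost_simps)
    let ?t = "vsize \<sigma> (VList (E i)) + (t2 + (vsize \<sigma> (st i 0) + (t4 + (t5 + vsize \<sigma> (st i (n i))))))"
    have "exec \<sigma> (orc i) P ?s ?t (s5(0 := st i (n i)))"
      unfolding P_def
      by (rule exec_Seq[OF p1 exec_Seq[OF p2(1) exec_Seq[OF p3 exec_Seq[OF p4(1) exec_Seq[OF p5(1) p6]]]]])
    then have "computes \<sigma> (orc i) P (VList (E i)) ?t (st i (n i))"
      by (rule computesI) simp
    moreover have "?t \<le> ?T i"
    proof -
      have "t2 \<le> W i + 2 * m + 1 + T1 i"
        using p2(4) t(1) W'(1)[OF i] by (simp add: expr_cost_simps)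
      then show ?thesis
        using W'(1)[OF i] W'(2)[OF i, of 0] W'(2)[OF i, of "n i"] p4(5) p5(3) by linarith
    qed
    ultimately show ?thesis by blast
  qed
  ultimately show "\<exists>c T. poly_bdd I S T \<and>
        (\<forall>i\<in>I. \<exists>t \<le> T i. computes \<sigma> (orc i) c (VList (E i)) t (st i (n i)))"
    by (intro exI[of _ P] exI[of _ ?T]) blast
qed


section \<open>Access to the environment and the operations of the language\<close>

lemma poly_compI:
  "(poly_env \<sigma> I S E \<Longrightarrow> poly_comp \<sigma> I orc S E f) \<Longrightarrow> poly_comp \<sigma> I orc S E f"
  unfolding poly_comp_def by blast

lemma poly_comp_head: "poly_comp \<sigma> I orc S (\<lambda>i. x i # E i) x"
proof (rule poly_comp_expr)
  assume "poly_env \<sigma> I S (\<lambda>i. x i # E i)"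
  then have "poly_bdd I S (\<lambda>i. 2 * vsize \<sigma> (VList (x i # E i)))"
    unfolding poly_env_def by (intro poly_bdd_mult poly_bdd_const)
  then show "poly_bdd I S (\<lambda>i. expr_cost \<sigma> (EHd (EVar 0)) ((\<lambda>_. VList [])(0 := VList (x i # E i))))"
    by (rule poly_bdd_mono) (simp add: expr_cost_simps)
qed simp

lemma poly_comp_second: "poly_comp \<sigma> I orc S (\<lambda>i. x i # y i # E i) y"
  by (rule poly_comp_weaken, rule poly_comp_head)

lemma poly_comp_third: "poly_comp \<sigma> I orc S (\<lambda>i. x i # y i # z i # E i) z"
  by (rule poly_comp_weaken, rule poly_comp_second)

lemma poly_comp_whole_env: "poly_comp \<sigma> I orc S E (\<lambda>i. VList (E i))"
  by (rule poly_comp_expr[where e = "EVar 0"]) (simp_all add: expr_cost_simps poly_env_def)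

text \<open>A substitution rule: a fact proved for one environment is used in another from which the
  first can be assembled. Loop bodies are brought into the required form this way.\<close>

lemma poly_comp_change_env:
  assumes f: "poly_comp \<sigma> I orc S E' f" and E': "poly_comp \<sigma> I orc S E (\<lambda>i. VList (E' i))"
  shows "poly_comp \<sigma> I orc S E f"
proof (rule poly_compI)
  assume "poly_env \<sigma> I S E"
  then have "poly_env \<sigma> I S E'" using poly_comp_vsize[OF E'] unfolding poly_env_def by blast
  then obtain c T where T: "poly_bdd I S T"
    "\<forall>i\<in>I. \<exists>t \<le> T i. computes \<sigma> (orc i) c (VList (E' i)) t (f i)"
    using f unfolding poly_comp_def by blast
  show ?thesis by (rule poly_comp_call[OF E']) (use T in auto)
qed

text \<open>\<open>F\<close> is a constructor of expressions and \<open>h\<close> its meaning. The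
  result exceeds the operand by at most a constant, which makes the cost linear in the size of the
  environment.\<close>

lemma poly_comp_op1:
  assumes f: "poly_comp \<sigma> I orc S E f"
    and F: "\<And>e s. eval_expr (F e) s = h (eval_expr e s)"
      "\<And>e s. expr_cost \<sigma> (F e) s = vsize \<sigma> (h (eval_expr e s)) + expr_cost \<sigma> e s"
    and h: "\<And>i. i \<in> I \<Longrightarrow> vsize \<sigma> (h (f i)) \<le> k + vsize \<sigma> (f i)"
  shows "poly_comp \<sigma> I orc S E (\<lambda>i. h (f i))"
proof (rule poly_comp_let[OF f], rule poly_comp_expr)
  let ?s = "\<lambda>i. (\<lambda>_. VList [])(0 := VList (f i # E i))"
  let ?e = "F (EHd (EVar 0))"
  show "\<And>i. eval_expr ?e (?s i) = h (f i)" by (simp add: F)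
  assume "poly_env \<sigma> I S (\<lambda>i. f i # E i)"
  then have "poly_bdd I S (\<lambda>i. k + 3 * vsize \<sigma> (VList (f i # E i)))"
    unfolding poly_env_def by (intro poly_bdd_mult poly_bdd_add poly_bdd_const)
  then show "poly_bdd I S (\<lambda>i. expr_cost \<sigma> ?e (?s i))"
    by (rule poly_bdd_mono) (use h in \<open>fastforce simp: F expr_cost_simps\<close>)
qed

lemma poly_comp_op2:
  assumes f: "poly_comp \<sigma> I orc S E f" and g: "poly_comp \<sigma> I orc S E g"
    and F: "\<And>e e' s. eval_expr (F e e') s = h (eval_expr e s) (eval_expr e' s)"
      "\<And>e e' s. expr_cost \<sigma> (F e e') s =
         vsize \<sigma> (h (eval_expr e s) (eval_expr e' s)) + expr_cost \<sigma> e s + expr_cost \<sigma> e' s"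
    and h: "\<And>i. i \<in> I \<Longrightarrow> vsize \<sigma> (h (f i) (g i)) \<le> k + vsize \<sigma> (f i) + vsize \<sigma> (g i)"
  shows "poly_comp \<sigma> I orc S E (\<lambda>i. h (f i) (g i))"
proof (rule poly_comp_let[OF f], rule poly_comp_let[OF poly_comp_weaken[OF g]], rule poly_comp_expr)
  let ?s = "\<lambda>i. (\<lambda>_. VList [])(0 := VList (g i # f i # E i))"
  let ?e = "F (EHd (ETl (EVar 0))) (EHd (EVar 0))"
  show "\<And>i. eval_expr ?e (?s i) = h (f i) (g i)" by (simp add: F)
  assume "poly_env \<sigma> I S (\<lambda>i. g i # f i # E i)"
  then have "poly_bdd I S (\<lambda>i. k + 6 * vsize \<sigma> (VList (g i # f i # E i)))"
    unfolding poly_env_def by (intro poly_bdd_mult poly_bdd_add poly_bdd_const)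
  then show "poly_bdd I S (\<lambda>i. expr_cost \<sigma> ?e (?s i))"
    by (rule poly_bdd_mono) (use h in \<open>fastforce simp: F expr_cost_simps\<close>)
qed

lemma poly_comp_Cons:
  assumes "poly_comp \<sigma> I orc S E f" and "poly_comp \<sigma> I orc S E (\<lambda>i. VList (xs i))"
  shows "poly_comp \<sigma> I orc S E (\<lambda>i. VList (f i # xs i))"
  using poly_comp_op2[OF assms, where h = cons_val and F = ECons and k = 0]
  by (simp add: expr_cost_simps)

lemma poly_comp_Nil: "poly_comp \<sigma> I orc S E (\<lambda>i. VList [])"
  by (rule poly_comp_expr[where e = ENil]) (simp_all add: expr_cost_simps)

lemma poly_comp_int: "poly_comp \<sigma> I orc S E (\<lambda>i. VInt k)"
  by (rule poly_comp_expr[where e = "EInt k"]) (simp_all add: expr_cost_simps)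

lemma poly_comp_hd:
  assumes "poly_comp \<sigma> I orc S E (\<lambda>i. VList (x i # xs i))"
  shows "poly_comp \<sigma> I orc S E x"
  using poly_comp_op1[OF assms, where h = hd_val and F = EHd and k = 0]
  by (simp add: expr_cost_simps)

lemma poly_comp_tl:
  assumes "poly_comp \<sigma> I orc S E (\<lambda>i. VList (x i # xs i))"
  shows "poly_comp \<sigma> I orc S E (\<lambda>i. VList (xs i))"
  using poly_comp_op1[OF assms, where h = tl_val and F = ETl and k = 0]
  by (simp add: expr_cost_simps)

lemma vsize_kind_val: "vsize \<sigma> (kind_val v) \<le> 3"
  by (induction v rule: kind_val.induct) (auto simp: floorlog_le_iff)

lemma poly_comp_kind:
  assumes "poly_comp \<sigma> I orc S E f"
  shows "poly_comp \<sigma> I orc S E (\<lambda>i. kind_val (f i))"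
  using poly_comp_op1[OF assms, where h = kind_val and F = EKind and k = 3] vsize_kind_val[of \<sigma>]
  by (simp add: expr_cost_simps trans_le_add1)

lemma kind_val_VList [simp]: "kind_val (VList xs) = VInt (of_bool (xs \<noteq> []))"
  by (cases xs) auto

section \<open>Binary length and integer arithmetic\<close>

lemma vsize_VInt_le: "\<bar>a\<bar> < 2 ^ k \<Longrightarrow> vsize \<sigma> (VInt a) \<le> 1 + k"
  by (simp add: floorlog_le_iff nat_less_iff)

lemma abs_less_vsize: "\<bar>a\<bar> < 2 ^ (vsize \<sigma> (VInt a) - 1)"
  using floorlog_leD[of 2 "nat \<bar>a\<bar>" "floorlog 2 (nat \<bar>a\<bar>)"] by (simp add: nat_less_iff)

text \<open>The unit charged for each value on top of its binary length pays for the carry bit of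
  the sum.\<close>

lemma vsize_VInt_add: "vsize \<sigma> (VInt (a + b)) \<le> vsize \<sigma> (VInt a) + vsize \<sigma> (VInt b)"
proof -
  let ?x = "floorlog 2 (nat \<bar>a\<bar>)" and ?y = "floorlog 2 (nat \<bar>b\<bar>)"
  have "\<bar>a\<bar> < 2 ^ ?x" "\<bar>b\<bar> < 2 ^ ?y" using abs_less_vsize[of a \<sigma>] abs_less_vsize[of b \<sigma>] by auto
  moreover have "(2::int) ^ ?x \<le> 2 ^ (?x + ?y)" "(2::int) ^ ?y \<le> 2 ^ (?x + ?y)"
    by (auto intro: power_increasing)
  ultimately have "\<bar>a + b\<bar> < 2 * 2 ^ (?x + ?y)" by linarith
  then have "\<bar>a + b\<bar> < 2 ^ (?x + ?y + 1)" by simp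
  then show ?thesis using vsize_VInt_le by fastforce
qed

lemma vsize_VInt_uminus [simp]: "vsize \<sigma> (VInt (- a)) = vsize \<sigma> (VInt a)"
  by simp

lemma vsize_VInt_diff: "vsize \<sigma> (VInt (a - b)) \<le> vsize \<sigma> (VInt a) + vsize \<sigma> (VInt b)"
  using vsize_VInt_add[of \<sigma> a "- b"] by simp

lemma vsize_VInt_mult: "vsize \<sigma> (VInt (a * b)) \<le> vsize \<sigma> (VInt a) + vsize \<sigma> (VInt b)"
proof -
  let ?x = "floorlog 2 (nat \<bar>a\<bar>)" and ?y = "floorlog 2 (nat \<bar>b\<bar>)"
  have "\<bar>a\<bar> < 2 ^ ?x" "\<bar>b\<bar> < 2 ^ ?y" using abs_less_vsize[of a \<sigma>] abs_less_vsize[of b \<sigma>] by auto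
  then have "\<bar>a\<bar> * \<bar>b\<bar> < 2 ^ ?x * 2 ^ ?y" by (intro mult_strict_mono') auto
  then have "\<bar>a * b\<bar> < 2 ^ (?x + ?y)" by (simp add: abs_mult power_add)
  then show ?thesis using vsize_VInt_le by fastforce
qed

lemma vsize_VInt_mono: "\<bar>a\<bar> \<le> \<bar>b\<bar> \<Longrightarrow> vsize \<sigma> (VInt a) \<le> vsize \<sigma> (VInt b)"
  by (simp add: floorlog_mono nat_mono)

text \<open>Division rounds downwards, so a negative quotient may gain in absolute value by
  rounding; it still does not pass the dividend. Changing both signs reduces negative divisors to
  positive ones.\<close>

lemma abs_div_le: "\<bar>a div b\<bar> \<le> \<bar>a\<bar>" for a b :: int
proof (cases "b = 0")
  case False
  have "\<bar>a div b\<bar> \<le> \<bar>a\<bar>" if "b > 0" for a b :: int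
  proof (cases "a \<ge> 0")
    case True
    then show ?thesis using that zdiv_mono2[of a 1 b] by (simp add: pos_imp_zdiv_nonneg_iff)
  next
    case False
    then have "a div b < 0" using that by (simp add: neg_imp_zdiv_neg_iff pos_imp_zdiv_neg_iff)
    moreover have "a \<le> a div b"
    proof -
      have "a * b \<le> a" using False that by (simp add: mult_le_cancel_left1)
      then have "a * b div b \<le> a div b" using that zdiv_mono1 by blast
      then show ?thesis using that by simp
    qed
    ultimately show ?thesis using False by simp
  qed
  from this[of b a] this[of "- b" "- a"] show ?thesis using False by (cases "b > 0") auto
qed simp

lemma vsize_VInt_div: "vsize \<sigma> (VInt (a div b)) \<le> vsize \<sigma> (VInt a)"
  by (rule vsize_VInt_mono[OF abs_div_le])

text \<open>The slack \<open>k\<close> stands for the operand sizes in the premise of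
  \<open>poly_comp_op2\<close>.\<close>

lemma vsize_VInt_of_bool: "vsize \<sigma> (VInt (of_bool b)) \<le> Suc (Suc k)"
  by (rule order_trans[OF vsize_VInt_le[of _ 1]]) (cases b; simp)+

lemma poly_comp_add:
  assumes "poly_comp \<sigma> I orc S E (\<lambda>i. VInt (f i))" and "poly_comp \<sigma> I orc S E (\<lambda>i. VInt (g i))"
  shows "poly_comp \<sigma> I orc S E (\<lambda>i. VInt (f i + g i))"
  using poly_comp_op2[OF assms, where h = "bin_val AddOp" and F = "EBin AddOp" and k = 0]
    vsize_VInt_add[of \<sigma>]
  by (simp add: expr_cost_simps del: vsize.simps)

lemma poly_comp_diff:
  assumes "poly_comp \<sigma> I orc S E (\<lambda>i. VInt (f i))" and "poly_comp \<sigma> I orc S E (\<lambda>i. VInt (g i))"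
  shows "poly_comp \<sigma> I orc S E (\<lambda>i. VInt (f i - g i))"
  using poly_comp_op2[OF assms, where h = "bin_val SubOp" and F = "EBin SubOp" and k = 0]
    vsize_VInt_diff[of \<sigma>]
  by (simp add: expr_cost_simps del: vsize.simps)

lemma poly_comp_mult:
  assumes "poly_comp \<sigma> I orc S E (\<lambda>i. VInt (f i))" and "poly_comp \<sigma> I orc S E (\<lambda>i. VInt (g i))"
  shows "poly_comp \<sigma> I orc S E (\<lambda>i. VInt (f i * g i))"
  using poly_comp_op2[OF assms, where h = "bin_val MulOp" and F = "EBin MulOp" and k = 0]
    vsize_VInt_mult[of \<sigma>]
  by (simp add: expr_cost_simps del: vsize.simps)

lemma poly_comp_div:
  assumes "poly_comp \<sigma> I orc S E (\<lambda>i. VInt (f i))" and "poly_comp \<sigma> I orc S E (\<lambda>i. VInt (g i))"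
  shows "poly_comp \<sigma> I orc S E (\<lambda>i. VInt (f i div g i))"
  using poly_comp_op2[OF assms, where h = "bin_val DivOp" and F = "EBin DivOp" and k = 0]
    vsize_VInt_div[of \<sigma>]
  by (simp add: expr_cost_simps trans_le_add1 del: vsize.simps)

lemma poly_comp_less:
  assumes "poly_comp \<sigma> I orc S E (\<lambda>i. VInt (f i))" and "poly_comp \<sigma> I orc S E (\<lambda>i. VInt (g i))"
  shows "poly_comp \<sigma> I orc S E (\<lambda>i. VInt (of_bool (f i < g i)))"
  using poly_comp_op2[OF assms, where h = "bin_val LessOp" and F = "EBin LessOp" and k = 2]
    vsize_VInt_of_bool[of \<sigma>]
  by (simp add: expr_cost_simps trans_le_add1 del: vsize.simps)

lemma poly_comp_num_less:
  assumes "poly_comp \<sigma> I orc S E (\<lambda>i. VNum (f i))" and "poly_comp \<sigma> I orc S E (\<lambda>i. VNum (g i))"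
  shows "poly_comp \<sigma> I orc S E (\<lambda>i. VInt (of_bool (f i < g i)))"
  using poly_comp_op2[OF assms, where h = "bin_val LessOp" and F = "EBin LessOp" and k = 2]
    vsize_VInt_of_bool[of \<sigma>]
  by (simp add: expr_cost_simps trans_le_add1 del: vsize.simps)

lemma poly_comp_num_const: "poly_comp \<sigma> I orc S E (\<lambda>i. VNum (of_int k))"
  by (rule poly_comp_expr[where e = "EToNum (EInt k)"]) (simp_all add: expr_cost_simps)

lemma poly_comp_uminus:
  assumes "poly_comp \<sigma> I orc S E (\<lambda>i. VInt (f i))"
  shows "poly_comp \<sigma> I orc S E (\<lambda>i. VInt (- f i))"
  using poly_comp_diff[OF poly_comp_int[of \<sigma> I orc S E 0] assms] by simp

lemma poly_comp_power:
  assumes "poly_comp \<sigma> I orc S E (\<lambda>i. VInt (f i))"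
  shows "poly_comp \<sigma> I orc S E (\<lambda>i. VInt (f i ^ k))"
  by (induction k) (auto intro: poly_comp_int poly_comp_mult assms)

lemma poly_comp_If:
  assumes "poly_comp \<sigma> I orc S E (\<lambda>i. VInt (of_bool (b i)))"
    and "poly_comp \<sigma> {i\<in>I. b i} orc S E f" and "poly_comp \<sigma> {i\<in>I. \<not> b i} orc S E g"
  shows "poly_comp \<sigma> I orc S E (\<lambda>i. if b i then f i else g i)"
  by (rule poly_comp_if[OF assms(1) _ assms(2,3)]) simp


subsection \<open>List operations in polynomial time\<close>

lemma drop_Suc_conv: "k < length xs \<Longrightarrow> drop k xs = xs ! k # drop (Suc k) xs"
  by (rule Cons_nth_drop_Suc[symmetric])

lemma vsize_sublist:
  "vsize \<sigma> (VList (drop k xs)) \<le> vsize \<sigma> (VList xs)" "vsize \<sigma> (VList (take k xs)) \<le> vsize \<sigma> (VList xs)"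
proof -
  have "vsize \<sigma> (VList xs) = vsize \<sigma> (VList (take k xs @ drop k xs))" by simp
  then show "vsize \<sigma> (VList (drop k xs)) \<le> vsize \<sigma> (VList xs)"
    "vsize \<sigma> (VList (take k xs)) \<le> vsize \<sigma> (VList xs)"
    unfolding vsize.simps map_append sum_list_append by linarith+
qed

text \<open>The accumulator is a family indexed by the number of entries read, so that it may depend
  on the abstract data behind the encodings. As for loops in general, its size has to be bounded
  beforehand.\<close>

lemma poly_comp_fold:
  assumes xs: "poly_comp \<sigma> I orc S E (\<lambda>i. VList (xs i))"
    and init: "poly_comp \<sigma> I orc S E (\<lambda>i. acc i 0)"
    and body: "poly_comp \<sigma> {j. fst j \<in> I \<and> snd j < length (xs (fst j))} (\<lambda>j. orc (fst j)) (\<lambda>j. S (fst j))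
      (\<lambda>j. acc (fst j) (snd j) # xs (fst j) ! snd j # E (fst j)) (\<lambda>j. acc (fst j) (Suc (snd j)))"
    and size: "poly_env \<sigma> I S E \<Longrightarrow> poly_bdd {j. fst j \<in> I \<and> snd j \<le> length (xs (fst j))}
      (\<lambda>j. S (fst j)) (\<lambda>j. vsize \<sigma> (acc (fst j) (snd j)))"
  shows "poly_comp \<sigma> I orc S E (\<lambda>i. acc i (length (xs i)))"
proof (rule poly_compI)
  assume env: "poly_env \<sigma> I S E"
  \<comment> \<open>The unread rest of the list is part of the state, and the loop runs while it is
    nonempty.\<close>
  define st where "st i k = VList [VList (drop k (xs i)), acc i k]" for i k
  define cnd where "cnd i k = VInt (of_bool (drop k (xs i) \<noteq> []))" for i k
  let ?S = "\<lambda>j::'a \<times> nat. S (fst j)" and ?orc = "\<lambda>j::'a \<times> nat. orc (fst j)"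
  let ?J = "{j. fst j \<in> I \<and> snd j \<le> length (xs (fst j))}"
  let ?J' = "{j. fst j \<in> I \<and> snd j < length (xs (fst j))}"
  have J: "{(i, k). i \<in> I \<and> k \<le> length (xs i)} = ?J" "{(i, k). i \<in> I \<and> k < length (xs i)} = ?J'" by auto
  have xs_size: "poly_bdd I S (\<lambda>i. vsize \<sigma> (VList (xs i)))" by (rule poly_comp_vsize[OF xs env])
  have "poly_comp \<sigma> I orc S E (\<lambda>i. st i (length (xs i)))"
  proof (rule poly_comp_while[where cnd = cnd])
    show "poly_comp \<sigma> I orc S E (\<lambda>i. st i 0)"
      unfolding st_def by (simp, intro poly_comp_Cons xs init poly_comp_Nil)
    have *: "poly_comp \<sigma> ?J ?orc ?S (\<lambda>j. st (fst j) (snd j) # E (fst j)) (\<lambda>j. VList (drop (snd j) (xs (fst j))))"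
      unfolding st_def by (rule poly_comp_hd, rule poly_comp_head)
    show "poly_comp \<sigma> {(i, k). i \<in> I \<and> k \<le> length (xs i)} ?orc ?S (\<lambda>(i, k). st i k # E i) (\<lambda>(i, k). cnd i k)"
      unfolding J case_prod_beta' cnd_def using poly_comp_kind[OF *] by (simp add: case_prod_beta')
    let ?E = "\<lambda>j. st (fst j) (snd j) # E (fst j)"
    have l: "poly_comp \<sigma> ?J' ?orc ?S ?E (\<lambda>j. VList (xs (fst j) ! snd j # drop (Suc (snd j)) (xs (fst j))))"
    proof (rule poly_comp_cong)
      show "poly_comp \<sigma> ?J' ?orc ?S ?E (\<lambda>j. VList (drop (snd j) (xs (fst j))))"
        unfolding st_def by (rule poly_comp_hd, rule poly_comp_head)
    qed (auto simp: drop_Suc_conv)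
    have a: "poly_comp \<sigma> ?J' ?orc ?S ?E (\<lambda>j. acc (fst j) (snd j))"
      unfolding st_def by (rule poly_comp_hd, rule poly_comp_tl, rule poly_comp_head)
    have e: "poly_comp \<sigma> ?J' ?orc ?S ?E (\<lambda>j. VList (acc (fst j) (snd j) # xs (fst j) ! snd j # E (fst j)))"
      by (intro poly_comp_Cons a poly_comp_hd[OF l] poly_comp_weaken poly_comp_whole_env)
    show "poly_comp \<sigma> {(i, k). i \<in> I \<and> k < length (xs i)} ?orc ?S (\<lambda>(i, k). st i k # E i)
        (\<lambda>(i, k). st i (Suc k))"
      unfolding J case_prod_beta' unfolding st_def
      by (intro poly_comp_Cons poly_comp_Nil poly_comp_tl[OF l[unfolded st_def]]
            poly_comp_change_env[OF body e[unfolded st_def]])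
    show "poly_bdd I S (\<lambda>i. length (xs i))"
      by (rule poly_bdd_mono[OF xs_size length_le_vsize])
    have "poly_bdd ?J ?S (\<lambda>j. 2 + (vsize \<sigma> (VList (xs (fst j))) + vsize \<sigma> (acc (fst j) (snd j))))"
      by (intro poly_bdd_add size[OF env] poly_bdd_const poly_bdd_fst[OF xs_size]) auto
    then show "poly_bdd {(i, k). i \<in> I \<and> k \<le> length (xs i)} ?S (\<lambda>(i, k). vsize \<sigma> (st i k))"
      unfolding J case_prod_beta'
    proof (rule poly_bdd_mono)
      fix j
      show "vsize \<sigma> (st (fst j) (snd j)) \<le> 2 + (vsize \<sigma> (VList (xs (fst j))) + vsize \<sigma> (acc (fst j) (snd j)))"
        unfolding st_def using vsize_sublist(1)[of \<sigma> "snd j" "xs (fst j)"] by simp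
    qed
  qed (auto simp: cnd_def)
  then show "poly_comp \<sigma> I orc S E (\<lambda>i. acc i (length (xs i)))"
    unfolding st_def by (rule poly_comp_hd[OF poly_comp_tl])
qed

lemma vsize_VList_append: "vsize \<sigma> (VList (xs @ ys)) + 1 = vsize \<sigma> (VList xs) + vsize \<sigma> (VList ys)"
  by simp

lemma vsize_VList_rev [simp]: "vsize \<sigma> (VList (rev xs)) = vsize \<sigma> (VList xs)"
  by (simp add: rev_map[symmetric])

text \<open>Lists can be read and extended only at the front, so moving entries across reverses
  them. Reversal and concatenation are both obtained from this.\<close>

lemma poly_comp_rev_append:
  assumes xs: "poly_comp \<sigma> I orc S E (\<lambda>i. VList (xs i))" and ys: "poly_comp \<sigma> I orc S E (\<lambda>i. VList (ys i))"
  shows "poly_comp \<sigma> I orc S E (\<lambda>i. VList (rev (xs i) @ ys i))"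
proof -
  define acc where "acc i k = VList (rev (take k (xs i)) @ ys i)" for i k
  have "poly_comp \<sigma> I orc S E (\<lambda>i. acc i (length (xs i)))"
  proof (rule poly_comp_fold[OF xs])
    show "poly_comp \<sigma> I orc S E (\<lambda>i. acc i 0)" unfolding acc_def by (simp add: ys)
    let ?J = "{j. fst j \<in> I \<and> snd j < length (xs (fst j))}"
    have "poly_comp \<sigma> ?J (\<lambda>j. orc (fst j)) (\<lambda>j. S (fst j))
      (\<lambda>j. acc (fst j) (snd j) # xs (fst j) ! snd j # E (fst j))
      (\<lambda>j. VList (xs (fst j) ! snd j # rev (take (snd j) (xs (fst j))) @ ys (fst j)))"
      unfolding acc_def by (intro poly_comp_Cons poly_comp_head poly_comp_second)
    then show "poly_comp \<sigma> ?J (\<lambda>j. orc (fst j)) (\<lambda>j. S (fst j))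
      (\<lambda>j. acc (fst j) (snd j) # xs (fst j) ! snd j # E (fst j)) (\<lambda>j. acc (fst j) (Suc (snd j)))"
      by (rule poly_comp_cong) (auto simp: acc_def take_Suc_conv_app_nth)
    assume env: "poly_env \<sigma> I S E"
    let ?J' = "{j. fst j \<in> I \<and> snd j \<le> length (xs (fst j))}"
    have "poly_bdd ?J' (\<lambda>j. S (fst j)) (\<lambda>j. vsize \<sigma> (VList (xs (fst j))) + vsize \<sigma> (VList (ys (fst j))))"
      by (intro poly_bdd_add poly_bdd_fst[OF poly_comp_vsize[OF xs env]] poly_bdd_fst[OF poly_comp_vsize[OF ys env]])
         auto
    then show "poly_bdd ?J' (\<lambda>j. S (fst j)) (\<lambda>j. vsize \<sigma> (acc (fst j) (snd j)))"
    proof (rule poly_bdd_mono)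
      fix j
      show "vsize \<sigma> (acc (fst j) (snd j)) \<le> vsize \<sigma> (VList (xs (fst j))) + vsize \<sigma> (VList (ys (fst j)))"
        unfolding acc_def
        using vsize_VList_append[of \<sigma> "rev (take (snd j) (xs (fst j)))" "ys (fst j)"]
          vsize_sublist(2)[of \<sigma> "snd j" "xs (fst j)"] vsize_VList_rev[of \<sigma> "take (snd j) (xs (fst j))"] by linarith
    qed
  qed
  then show ?thesis unfolding acc_def by simp
qed

lemma poly_comp_rev:
  assumes "poly_comp \<sigma> I orc S E (\<lambda>i. VList (xs i))"
  shows "poly_comp \<sigma> I orc S E (\<lambda>i. VList (rev (xs i)))"
  using poly_comp_rev_append[OF assms poly_comp_Nil] by simp

lemma poly_comp_append:
  assumes "poly_comp \<sigma> I orc S E (\<lambda>i. VList (xs i))" and "poly_comp \<sigma> I orc S E (\<lambda>i. VList (ys i))"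
  shows "poly_comp \<sigma> I orc S E (\<lambda>i. VList (xs i @ ys i))"
  using poly_comp_rev_append[OF poly_comp_rev[OF assms(1)] assms(2)] by simp

lemma vsize_VList_le:
  assumes "\<And>x. x \<in> set xs \<Longrightarrow> vsize \<sigma> x \<le> m"
  shows "vsize \<sigma> (VList xs) \<le> 1 + length xs * m"
proof -
  have "sum_list (map (vsize \<sigma>) xs) \<le> (\<Sum>x\<leftarrow>xs. m)" using assms by (intro sum_list_mono) auto
  then show ?thesis by (simp add: sum_list_triv)
qed

lemma vsize_concat_le: "vsize \<sigma> (VList (concat xss)) \<le> vsize \<sigma> (VList (map VList xss))"
  by (induction xss) auto

lemma poly_comp_concat:
  assumes xs: "poly_comp \<sigma> I orc S E (\<lambda>i. VList (map VList (xss i)))"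
  shows "poly_comp \<sigma> I orc S E (\<lambda>i. VList (concat (xss i)))"
proof -
  define acc where "acc i k = VList (concat (take k (xss i)))" for i k
  have "poly_comp \<sigma> I orc S E (\<lambda>i. acc i (length (map VList (xss i))))"
  proof (rule poly_comp_fold[OF xs])
    show "poly_comp \<sigma> I orc S E (\<lambda>i. acc i 0)" unfolding acc_def by (simp add: poly_comp_Nil)
    let ?J = "{j. fst j \<in> I \<and> snd j < length (map VList (xss (fst j)))}"
    let ?E = "\<lambda>j. acc (fst j) (snd j) # map VList (xss (fst j)) ! snd j # E (fst j)"
    have *: "poly_comp \<sigma> ?J (\<lambda>j. orc (fst j)) (\<lambda>j. S (fst j)) ?E (\<lambda>j. VList (xss (fst j) ! snd j))"
      by (rule poly_comp_cong[OF poly_comp_second]) auto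
    have "poly_comp \<sigma> ?J (\<lambda>j. orc (fst j)) (\<lambda>j. S (fst j)) ?E
      (\<lambda>j. VList (concat (take (snd j) (xss (fst j))) @ xss (fst j) ! snd j))"
      by (rule poly_comp_append[OF _ *]) (unfold acc_def, rule poly_comp_head)
    then show "poly_comp \<sigma> ?J (\<lambda>j. orc (fst j)) (\<lambda>j. S (fst j)) ?E (\<lambda>j. acc (fst j) (Suc (snd j)))"
      by (rule poly_comp_cong) (auto simp: acc_def take_Suc_conv_app_nth)
    assume env: "poly_env \<sigma> I S E"
    let ?J' = "{j. fst j \<in> I \<and> snd j \<le> length (map VList (xss (fst j)))}"
    have "poly_bdd ?J' (\<lambda>j. S (fst j)) (\<lambda>j. vsize \<sigma> (VList (map VList (xss (fst j)))))"
      by (intro poly_bdd_fst[OF poly_comp_vsize[OF xs env]]) auto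
    then show "poly_bdd ?J' (\<lambda>j. S (fst j)) (\<lambda>j. vsize \<sigma> (acc (fst j) (snd j)))"
    proof (rule poly_bdd_mono)
      fix j
      show "vsize \<sigma> (acc (fst j) (snd j)) \<le> vsize \<sigma> (VList (map VList (xss (fst j))))"
        unfolding acc_def
        using vsize_concat_le[of \<sigma> "take (snd j) (xss (fst j))"]
          vsize_sublist(2)[of \<sigma> "snd j" "map VList (xss (fst j))"] by (simp add: take_map)
    qed
  qed
  then show ?thesis unfolding acc_def by simp
qed

text \<open>The entries are computed independently of one another, so the size of the result follows
  from that of a single entry. The body also receives the position, which later becomes the tag of
  an oracle query.\<close>

lemma poly_comp_map_idx:
  assumes ys: "poly_comp \<sigma> I orc S E (\<lambda>i. VList (map (ey i) (ys i)))"
    and body: "poly_comp \<sigma> {j. fst j \<in> I \<and> snd j < length (ys (fst j))} (\<lambda>j. orc (fst j)) (\<lambda>j. S (fst j))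
      (\<lambda>j. VInt (int (snd j)) # ey (fst j) (ys (fst j) ! snd j) # E (fst j)) (\<lambda>j. g (fst j) (snd j))"
  shows "poly_comp \<sigma> I orc S E (\<lambda>i. VList (map (g i) [0..<length (ys i)]))"
proof (rule poly_compI)
  assume env: "poly_env \<sigma> I S E"
  define xs where "xs i = map (ey i) (ys i)" for i
  define acc where "acc i k = VList [VInt (int k), VList (rev (map (g i) [0..<k]))]" for i k
  let ?J = "{j. fst j \<in> I \<and> snd j < length (xs (fst j))}"
  have J: "{j. fst j \<in> I \<and> snd j < length (ys (fst j))} = ?J" by (simp add: xs_def)
  let ?S = "\<lambda>j::'a \<times> nat. S (fst j)" and ?orc = "\<lambda>j::'a \<times> nat. orc (fst j)"
  have xs: "poly_comp \<sigma> I orc S E (\<lambda>i. VList (xs i))" using ys unfolding xs_def .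
  have xs_size: "poly_bdd I S (\<lambda>i. vsize \<sigma> (VList (xs i)))" by (rule poly_comp_vsize[OF xs env])
  have len: "poly_bdd I S (\<lambda>i. length (xs i))"
    by (rule poly_bdd_mono[OF xs_size length_le_vsize])
  let ?E' = "\<lambda>j. VInt (int (snd j)) # xs (fst j) ! snd j # E (fst j)"
  have body': "poly_comp \<sigma> ?J ?orc ?S ?E' (\<lambda>j. g (fst j) (snd j))"
    by (rule poly_comp_cong[OF body[unfolded J]]) (auto simp: xs_def)
  have int_size: "vsize \<sigma> (VInt (int k)) \<le> 1 + k" for k
    by (rule vsize_VInt_le) (simp add: of_nat_less_two_power)
  have "poly_bdd ?J ?S (\<lambda>j. 1 + length (xs (fst j)))"
    by (intro poly_bdd_add poly_bdd_const poly_bdd_fst[OF len]) auto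
  then have "poly_bdd ?J ?S (\<lambda>j. vsize \<sigma> (VInt (int (snd j))))"
    by (rule poly_bdd_mono) (use int_size in \<open>fastforce simp del: vsize.simps intro: order_trans\<close>)
  moreover have "poly_bdd ?J ?S (\<lambda>j. vsize \<sigma> (VList (xs (fst j))))"
    by (rule poly_bdd_fst[OF xs_size]) auto
  then have "poly_bdd ?J ?S (\<lambda>j. vsize \<sigma> (xs (fst j) ! snd j))"
    by (rule poly_bdd_mono) (auto intro: vsize_nth_le simp del: vsize.simps)
  ultimately have env': "poly_env \<sigma> ?J ?S ?E'"
    by (intro poly_env_Cons poly_env_fst[OF env]) auto
  \<comment> \<open>One bound \<open>G i\<close> for all entries, derived from the running time of
    the body.\<close>
  obtain G where G: "poly_bdd I S G"
      "\<And>i k. (i, k) \<in> ?J \<Longrightarrow> vsize \<sigma> (g (fst (i, k)) (snd (i, k))) \<le> G i"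
    by (rule poly_bdd_uniform[OF poly_comp_vsize[OF body' env'], where I = I]) (rule that)
  have "poly_comp \<sigma> I orc S E (\<lambda>i. acc i (length (xs i)))"
  proof (rule poly_comp_fold[OF xs])
    show "poly_comp \<sigma> I orc S E (\<lambda>i. acc i 0)"
      unfolding acc_def by (simp, intro poly_comp_Cons poly_comp_int poly_comp_Nil)
    let ?E = "\<lambda>j. acc (fst j) (snd j) # xs (fst j) ! snd j # E (fst j)"
    have k: "poly_comp \<sigma> ?J ?orc ?S ?E (\<lambda>j. VInt (int (snd j)))"
      unfolding acc_def by (rule poly_comp_hd, rule poly_comp_head)
    have l: "poly_comp \<sigma> ?J ?orc ?S ?E (\<lambda>j. VList (rev (map (g (fst j)) [0..<snd j])))"
      unfolding acc_def by (rule poly_comp_hd, rule poly_comp_tl, rule poly_comp_head)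
    have v: "poly_comp \<sigma> ?J ?orc ?S ?E (\<lambda>j. g (fst j) (snd j))"
      by (rule poly_comp_change_env[OF body'])
         (intro poly_comp_Cons k poly_comp_second poly_comp_weaken poly_comp_whole_env)
    have "poly_comp \<sigma> ?J ?orc ?S ?E (\<lambda>j. VList [VInt (int (snd j) + 1),
        VList (g (fst j) (snd j) # rev (map (g (fst j)) [0..<snd j]))])"
      by (intro poly_comp_Cons poly_comp_Nil poly_comp_add k l v poly_comp_int)
    then show "poly_comp \<sigma> ?J ?orc ?S ?E (\<lambda>j. acc (fst j) (Suc (snd j)))"
      by (rule poly_comp_cong) (auto simp: acc_def)
    let ?J' = "{j. fst j \<in> I \<and> snd j \<le> length (xs (fst j))}"
    have "poly_bdd ?J' ?S (\<lambda>j. 3 + length (xs (fst j)) + length (xs (fst j)) * G (fst j))"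
      by (intro poly_bdd_add poly_bdd_mult poly_bdd_const poly_bdd_fst[OF len] poly_bdd_fst[OF G(1)]) auto
    then show "poly_bdd ?J' ?S (\<lambda>j. vsize \<sigma> (acc (fst j) (snd j)))"
    proof (rule poly_bdd_mono)
      fix j assume j: "j \<in> ?J'"
      have "vsize \<sigma> (VList (rev (map (g (fst j)) [0..<snd j]))) \<le>
          1 + length (rev (map (g (fst j)) [0..<snd j])) * G (fst j)"
        by (rule vsize_VList_le) (use j G(2) in auto)
      also have "\<dots> \<le> 1 + length (xs (fst j)) * G (fst j)" using j by simp
      finally show "vsize \<sigma> (acc (fst j) (snd j)) \<le> 3 + length (xs (fst j)) + length (xs (fst j)) * G (fst j)"
        unfolding acc_def using int_size[of "snd j"] j by simp
    qed
  qed
  then have "poly_comp \<sigma> I orc S E (\<lambda>i. VList (rev (map (g i) [0..<length (xs i)])))"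
    unfolding acc_def by (rule poly_comp_hd[OF poly_comp_tl])
  from poly_comp_rev[OF this] show "poly_comp \<sigma> I orc S E (\<lambda>i. VList (map (g i) [0..<length (ys i)]))"
    by (simp add: xs_def)
qed

text \<open>The body is indexed by the abstract entry instead of its position, which suits nested
  maps and tests.\<close>

lemma poly_comp_map:
  assumes ys: "poly_comp \<sigma> I orc S E (\<lambda>i. VList (map (ey i) (ys i)))"
    and body: "poly_comp \<sigma> {j. fst j \<in> I \<and> snd j \<in> set (ys (fst j))} (\<lambda>j. orc (fst j)) (\<lambda>j. S (fst j))
      (\<lambda>j. ey (fst j) (snd j) # E (fst j)) (\<lambda>j. g (fst j) (snd j))"
  shows "poly_comp \<sigma> I orc S E (\<lambda>i. VList (map (g i) (ys i)))"
proof (rule poly_compI)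
  assume env: "poly_env \<sigma> I S E"
  let ?J = "{j. fst j \<in> I \<and> snd j \<in> set (ys (fst j))}"
  let ?J' = "{j. fst j \<in> I \<and> snd j < length (ys (fst j))}"
  have "poly_bdd ?J (\<lambda>j. S (fst j)) (\<lambda>j. vsize \<sigma> (VList (map (ey (fst j)) (ys (fst j)))))"
    by (rule poly_bdd_fst[OF poly_comp_vsize[OF ys env]]) auto
  then have "poly_bdd ?J (\<lambda>j. S (fst j)) (\<lambda>j. vsize \<sigma> (ey (fst j) (snd j)))"
    by (rule poly_bdd_mono) (auto intro: vsize_nth_le simp del: vsize.simps)
  then have env': "poly_env \<sigma> ?J (\<lambda>j. S (fst j)) (\<lambda>j. ey (fst j) (snd j) # E (fst j))"
    by (intro poly_env_Cons poly_env_fst[OF env]) auto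
  have "poly_comp \<sigma> I orc S E (\<lambda>i. VList (map (\<lambda>k. g i (ys i ! k)) [0..<length (ys i)]))"
  proof (rule poly_comp_map_idx[OF ys], rule poly_comp_weaken)
    show "poly_comp \<sigma> ?J' (\<lambda>j. orc (fst j)) (\<lambda>j. S (fst j))
      (\<lambda>j. ey (fst j) (ys (fst j) ! snd j) # E (fst j)) (\<lambda>j. g (fst j) (ys (fst j) ! snd j))"
      using poly_comp_reindex[OF body env', where \<pi> = "\<lambda>j. (fst j, ys (fst j) ! snd j)" and J = ?J'
         and S' = "\<lambda>j. S (fst j)" and orc' = "\<lambda>j. orc (fst j)"] by simp
  qed
  moreover have "map (\<lambda>k. g i (ys i ! k)) [0..<length (ys i)] = map (g i) (ys i)" for i
    by (rule nth_equalityI) auto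
  ultimately show "poly_comp \<sigma> I orc S E (\<lambda>i. VList (map (g i) (ys i)))" by simp
qed

lemma poly_comp_concat_map:
  assumes ys: "poly_comp \<sigma> I orc S E (\<lambda>i. VList (map (ey i) (ys i)))"
    and body: "poly_comp \<sigma> {j. fst j \<in> I \<and> snd j \<in> set (ys (fst j))} (\<lambda>j. orc (fst j)) (\<lambda>j. S (fst j))
      (\<lambda>j. ey (fst j) (snd j) # E (fst j)) (\<lambda>j. VList (g (fst j) (snd j)))"
  shows "poly_comp \<sigma> I orc S E (\<lambda>i. VList (concat (map (g i) (ys i))))"
  using poly_comp_concat[of \<sigma> I orc S E "\<lambda>i. map (g i) (ys i)"] poly_comp_map[OF ys body]
  by (simp add: o_def)

lemma poly_comp_filter:
  assumes ys: "poly_comp \<sigma> I orc S E (\<lambda>i. VList (map (ey i) (ys i)))"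
    and body: "poly_comp \<sigma> {j. fst j \<in> I \<and> snd j \<in> set (ys (fst j))} (\<lambda>j. orc (fst j)) (\<lambda>j. S (fst j))
      (\<lambda>j. ey (fst j) (snd j) # E (fst j)) (\<lambda>j. VInt (of_bool (P (fst j) (snd j))))"
  shows "poly_comp \<sigma> I orc S E (\<lambda>i. VList (map (ey i) (filter (P i) (ys i))))"
proof -
  have "poly_comp \<sigma> I orc S E (\<lambda>i. VList (concat (map (\<lambda>y. if P i y then [ey i y] else []) (ys i))))"
  proof (rule poly_comp_concat_map[OF ys])
    have "poly_comp \<sigma> {j. fst j \<in> I \<and> snd j \<in> set (ys (fst j))} (\<lambda>j. orc (fst j)) (\<lambda>j. S (fst j))
      (\<lambda>j. ey (fst j) (snd j) # E (fst j))
      (\<lambda>j. if P (fst j) (snd j) then VList [ey (fst j) (snd j)] else VList [])"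
      by (intro poly_comp_If body poly_comp_Cons poly_comp_head poly_comp_Nil)
    then show "poly_comp \<sigma> {j. fst j \<in> I \<and> snd j \<in> set (ys (fst j))} (\<lambda>j. orc (fst j)) (\<lambda>j. S (fst j))
      (\<lambda>j. ey (fst j) (snd j) # E (fst j))
      (\<lambda>j. VList (if P (fst j) (snd j) then [ey (fst j) (snd j)] else []))"
      by (simp only: if_distrib[of VList])
  qed
  moreover have "concat (map (\<lambda>y. if P i y then [ey i y] else []) ys) = map (ey i) (filter (P i) ys)" for i ys
    by (induction ys) auto
  ultimately show ?thesis by simp
qed

lemma poly_comp_length:
  assumes xs: "poly_comp \<sigma> I orc S E (\<lambda>i. VList (xs i))"
  shows "poly_comp \<sigma> I orc S E (\<lambda>i. VInt (int (length (xs i))))"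
proof (rule poly_comp_fold[OF xs, where acc = "\<lambda>i k. VInt (int k)"])
  show "poly_comp \<sigma> I orc S E (\<lambda>i. VInt (int 0))" using poly_comp_int[of \<sigma> I orc S E 0] by simp
  let ?J = "{j. fst j \<in> I \<and> snd j < length (xs (fst j))}"
  have "poly_comp \<sigma> ?J (\<lambda>j. orc (fst j)) (\<lambda>j. S (fst j))
     (\<lambda>j. VInt (int (snd j)) # xs (fst j) ! snd j # E (fst j)) (\<lambda>j. VInt (int (snd j) + 1))"
    by (intro poly_comp_add poly_comp_head poly_comp_int)
  then show "poly_comp \<sigma> ?J (\<lambda>j. orc (fst j)) (\<lambda>j. S (fst j))
     (\<lambda>j. VInt (int (snd j)) # xs (fst j) ! snd j # E (fst j)) (\<lambda>j. VInt (int (Suc (snd j))))"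
    by (simp add: add.commute)
  let ?J' = "{j. fst j \<in> I \<and> snd j \<le> length (xs (fst j))}"
  assume env: "poly_env \<sigma> I S E"
  have "poly_bdd ?J' (\<lambda>j. S (fst j)) (\<lambda>j. 1 + vsize \<sigma> (VList (xs (fst j))))"
    by (intro poly_bdd_add poly_bdd_const poly_bdd_fst[OF poly_comp_vsize[OF xs env]]) auto
  then show "poly_bdd ?J' (\<lambda>j. S (fst j)) (\<lambda>j. vsize \<sigma> (VInt (int (snd j))))"
  proof (rule poly_bdd_mono)
    fix j assume j: "j \<in> ?J'"
    have "vsize \<sigma> (VInt (int (snd j))) \<le> 1 + snd j"
      by (rule vsize_VInt_le) (simp add: of_nat_less_two_power)
    then show "vsize \<sigma> (VInt (int (snd j))) \<le> 1 + vsize \<sigma> (VList (xs (fst j)))"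
      using j length_le_vsize[of "xs (fst j)" \<sigma>] by auto
  qed
qed

lemma vsize_VInt_sum_list: "vsize \<sigma> (VInt (sum_list xs)) \<le> vsize \<sigma> (VList (map VInt xs))"
proof (induction xs)
  case (Cons x xs)
  then show ?case using vsize_VInt_add[of \<sigma> x "sum_list xs"] by simp
qed (simp add: floorlog_def)

lemma poly_comp_sum_list:
  assumes xs: "poly_comp \<sigma> I orc S E (\<lambda>i. VList (map VInt (xs i)))"
  shows "poly_comp \<sigma> I orc S E (\<lambda>i. VInt (sum_list (xs i)))"
proof -
  define acc where "acc i k = VInt (sum_list (take k (xs i)))" for i k
  have "poly_comp \<sigma> I orc S E (\<lambda>i. acc i (length (map VInt (xs i))))"
  proof (rule poly_comp_fold[OF xs])
    show "poly_comp \<sigma> I orc S E (\<lambda>i. acc i 0)"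
      unfolding acc_def using poly_comp_int[of \<sigma> I orc S E 0] by simp
    let ?J = "{j. fst j \<in> I \<and> snd j < length (map VInt (xs (fst j)))}"
    let ?E = "\<lambda>j. acc (fst j) (snd j) # map VInt (xs (fst j)) ! snd j # E (fst j)"
    have *: "poly_comp \<sigma> ?J (\<lambda>j. orc (fst j)) (\<lambda>j. S (fst j)) ?E (\<lambda>j. VInt (xs (fst j) ! snd j))"
      by (rule poly_comp_cong[OF poly_comp_second]) auto
    have "poly_comp \<sigma> ?J (\<lambda>j. orc (fst j)) (\<lambda>j. S (fst j)) ?E
      (\<lambda>j. VInt (sum_list (take (snd j) (xs (fst j))) + xs (fst j) ! snd j))"
      by (rule poly_comp_add[OF _ *]) (unfold acc_def, rule poly_comp_head)
    then show "poly_comp \<sigma> ?J (\<lambda>j. orc (fst j)) (\<lambda>j. S (fst j)) ?E (\<lambda>j. acc (fst j) (Suc (snd j)))"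
      by (rule poly_comp_cong) (auto simp: acc_def take_Suc_conv_app_nth)
    assume env: "poly_env \<sigma> I S E"
    let ?J' = "{j. fst j \<in> I \<and> snd j \<le> length (map VInt (xs (fst j)))}"
    have "poly_bdd ?J' (\<lambda>j. S (fst j)) (\<lambda>j. vsize \<sigma> (VList (map VInt (xs (fst j)))))"
      by (intro poly_bdd_fst[OF poly_comp_vsize[OF xs env]]) auto
    then show "poly_bdd ?J' (\<lambda>j. S (fst j)) (\<lambda>j. vsize \<sigma> (acc (fst j) (snd j)))"
    proof (rule poly_bdd_mono)
      fix j
      show "vsize \<sigma> (acc (fst j) (snd j)) \<le> vsize \<sigma> (VList (map VInt (xs (fst j))))"
        unfolding acc_def
        using vsize_VInt_sum_list[of \<sigma> "take (snd j) (xs (fst j))"]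
          vsize_sublist(2)[of \<sigma> "snd j" "map VInt (xs (fst j))"] by (simp add: take_map)
    qed
  qed
  then show ?thesis unfolding acc_def by simp
qed


section \<open>Counting cells\<close>

definition shatters :: "'a set set \<Rightarrow> 'a set \<Rightarrow> bool" where
  "shatters \<F> A \<longleftrightarrow> (\<forall>B\<subseteq>A. \<exists>F\<in>\<F>. F \<inter> A = B)"

text \<open>Pajor's form of the Sauer-Shelah lemma. Split the family at a point \<open>x\<close>
  into the members without \<open>x\<close> and those with \<open>x\<close>, the latter with
  \<open>x\<close> removed. Sets shattered by one part are shattered by \<open>\<F>\<close>; a set
  \<open>A\<close> shattered by both counts twice, and pays with the further shattered set
  \<open>insert x A\<close>.\<close>

lemma card_le_card_shattered:
  assumes "finite X" and "\<F> \<subseteq> Pow X"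
  shows "card \<F> \<le> card {A. A \<subseteq> X \<and> shatters \<F> A}"
  using assms
proof (induction X arbitrary: \<F> rule: finite_induct)
  case empty
  show ?case
  proof (cases "\<F> = {}")
    case False
    then have "\<F> = {{}}" using empty by auto
    moreover have "{A. A \<subseteq> {} \<and> shatters \<F> A} = {{}}" using calculation by (auto simp: shatters_def)
    ultimately show ?thesis by simp
  qed simp
next
  case (insert x X)
  define F0 where "F0 = {F\<in>\<F>. x \<notin> F}"
  define F1 where "F1 = {F\<in>\<F>. x \<in> F}"
  define F1' where "F1' = (\<lambda>F. F - {x}) ` F1"
  define S where "S \<G> = {A. A \<subseteq> X \<and> shatters \<G> A}" for \<G>
  have fin: "finite \<F>" using insert by (meson finite_Pow_iff finite_insert finite_subset)
  have finS: "finite (S \<G>)" for \<G> unfolding S_def using insert by auto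
  have "F0 \<inter> F1 = {}" "\<F> = F0 \<union> F1" by (auto simp: F0_def F1_def)
  then have "card \<F> = card F0 + card F1" using fin by (metis card_Un_disjoint finite_Un)
  also have "card F1 = card F1'"
    unfolding F1'_def by (rule card_image[symmetric]) (auto simp: F1_def inj_on_def)
  also have "card F0 \<le> card (S F0)" unfolding S_def by (rule insert.IH) (use insert in \<open>auto simp: F0_def\<close>)
  also have "card F1' \<le> card (S F1')"
    unfolding S_def by (rule insert.IH) (use insert in \<open>auto simp: F1'_def F1_def\<close>)
  \<comment> \<open>The sets in the intersection are counted a second time; adding \<open>x\<close>
    to them makes these copies disjoint from the union.\<close>
  also have "card (S F0) + card (S F1') = card (S F0 \<union> S F1') + card (S F0 \<inter> S F1')"
    by (rule card_Un_Int[OF finS finS])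
  also have "card (S F0 \<inter> S F1') = card (insert x ` (S F0 \<inter> S F1'))"
    by (rule card_image[symmetric], rule inj_onI)
       (metis (no_types, lifting) Int_iff S_def insert.hyps(2) insert_ident mem_Collect_eq subsetD)
  also have "card (S F0 \<union> S F1') + card (insert x ` (S F0 \<inter> S F1')) =
      card ((S F0 \<union> S F1') \<union> insert x ` (S F0 \<inter> S F1'))"
    by (rule card_Un_disjoint[symmetric]) (use finS insert in \<open>auto simp: S_def\<close>)
  also have "\<dots> \<le> card {A. A \<subseteq> insert x X \<and> shatters \<F> A}"
  proof (rule card_mono)
    show "finite {A. A \<subseteq> insert x X \<and> shatters \<F> A}" using insert by simp
    have 0: "shatters \<F> A" if "A \<in> S F0" for A
      using that unfolding S_def shatters_def F0_def by blast
    have 1: "shatters \<F> A" if "A \<in> S F1'" for A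
      unfolding shatters_def
    proof (intro allI impI)
      fix B assume "B \<subseteq> A"
      then obtain F where "F \<in> F1" "(F - {x}) \<inter> A = B"
        using \<open>A \<in> S F1'\<close> unfolding S_def shatters_def F1'_def by blast
      moreover have "x \<notin> A" using that insert unfolding S_def by auto
      ultimately show "\<exists>F\<in>\<F>. F \<inter> A = B" unfolding F1_def by blast
    qed
    have 2: "shatters \<F> (insert x A)" if A: "A \<in> S F0" "A \<in> S F1'" for A
      unfolding shatters_def
    proof (intro allI impI)
      fix B assume B: "B \<subseteq> insert x A"
      have x: "x \<notin> A" using that insert unfolding S_def by auto
      show "\<exists>F\<in>\<F>. F \<inter> insert x A = B"
      proof (cases "x \<in> B")
        case True
        have "B - {x} \<subseteq> A" using B by auto
        then obtain F where "F \<in> F1" "(F - {x}) \<inter> A = B - {x}"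
          using A(2) unfolding S_def shatters_def F1'_def by blast
        then show ?thesis using True x unfolding F1_def by blast
      next
        case False
        then have "B \<subseteq> A" using B by auto
        then obtain F where "F \<in> F0" "F \<inter> A = B" using A(1) unfolding S_def shatters_def by blast
        then show ?thesis using False unfolding F0_def by blast
      qed
    qed
    show "(S F0 \<union> S F1') \<union> insert x ` (S F0 \<inter> S F1') \<subseteq> {A. A \<subseteq> insert x X \<and> shatters \<F> A}"
      using 0 1 2 unfolding S_def by auto
  qed
  finally show ?case by simp
qed

text \<open>A set of at most \<open>n\<close> elements is the content of a word of length
  \<open>n\<close> over \<open>X\<close> and a blank \<open>None\<close>, which fills up the words
  of smaller sets.\<close>

lemma card_subsets_card_le:
  assumes "finite X"
  shows "card {A. A \<subseteq> X \<and> card A \<le> n} \<le> (card X + 1) ^ n"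
proof -
  let ?L = "{xs. set xs \<subseteq> insert None (Some ` X) \<and> length xs = n}"
  have "{A. A \<subseteq> X \<and> card A \<le> n} \<subseteq> (\<lambda>xs. {x. Some x \<in> set xs}) ` ?L"
  proof
    fix A assume A: "A \<in> {A. A \<subseteq> X \<and> card A \<le> n}"
    then obtain ys where ys: "set ys = A" "length ys = card A"
      using assms finite_subset finite_distinct_list distinct_card by (metis (no_types, lifting) mem_Collect_eq)
    let ?xs = "map Some ys @ replicate (n - card A) None"
    have "?xs \<in> ?L" using A ys by auto
    moreover have "{x. Some x \<in> set ?xs} = A" using ys by auto
    ultimately show "A \<in> (\<lambda>xs. {x. Some x \<in> set xs}) ` ?L" by blast
  qed
  moreover have fin: "finite ?L" using assms by (intro finite_lists_length_eq) auto
  ultimately have "card {A. A \<subseteq> X \<and> card A \<le> n} \<le> card ?L"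
    by (meson card_image_le card_mono finite_imageI order_trans)
  also have "\<dots> = card (insert None (Some ` X)) ^ n" using assms by (intro card_lists_length_eq) auto
  also have "card (insert None (Some ` X)) = card X + 1"
    using assms by (subst card_insert_disjoint) (auto simp: card_image)
  finally show ?thesis .
qed

text \<open>Stated for a family, since different rows may share a normal; such a repetition is
  itself a dependency, with coefficients 1 and -1.\<close>

lemma dependent_family:
  fixes v :: "'b \<Rightarrow> 'a::euclidean_space"
  assumes "finite A" and "card A > DIM('a)"
  obtains c where "(\<Sum>r\<in>A. c r *\<^sub>R v r) = 0" and "\<exists>r\<in>A. c r \<noteq> 0"
proof (cases "inj_on v A")
  case True
  then have "card (v ` A) > DIM('a)" using assms by (simp add: card_image)
  then have "dependent (v ` A)" using dependent_biggerset assms by blast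
  then obtain u where u: "\<exists>w\<in>v ` A. u w \<noteq> 0" "(\<Sum>w\<in>v ` A. u w *\<^sub>R w) = 0"
    using dependent_finite[of "v ` A"] assms by auto
  show ?thesis
    by (rule that[of "u \<circ> v"]) (use u True in \<open>auto simp: sum.reindex\<close>)
next
  case False
  then obtain p q where pq: "p \<in> A" "q \<in> A" "p \<noteq> q" "v p = v q" by (auto simp: inj_on_def)
  let ?c = "\<lambda>r. if r = p then 1 else if r = q then -1 else (0::real)"
  have "(\<Sum>r\<in>A. ?c r *\<^sub>R v r) = (\<Sum>r\<in>{p, q}. ?c r *\<^sub>R v r)"
    by (rule sum.mono_neutral_right) (use assms pq in auto)
  also have "\<dots> = 0" using pq by simp
  finally show ?thesis by (rule that) (use pq in auto)
qed

section \<open>Sign patterns of affine forms\<close>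

definition sign_pattern :: "'n::finite row set \<Rightarrow> real ^ 'n \<Rightarrow> 'n row set" where
  "sign_pattern X x = {r\<in>X. affine_form r x \<ge> 0}"

text \<open>A linear dependency between the normals of more than \<open>n\<close> half-spaces excludes two opposite
  sign patterns, so half-spaces have dual VC dimension at most \<open>n\<close>.\<close>

lemma shattered_card_le:
  fixes X :: "'n::finite row set"
  assumes "finite X" and "A \<subseteq> X" and "shatters (sign_pattern X ` Q) A"
  shows "card A \<le> CARD('n)"
proof (rule ccontr)
  assume "\<not> card A \<le> CARD('n)"
  then have card: "card A > DIM(real ^ 'n)" by simp
  have fin: "finite A" using assms finite_subset by blast
  obtain c where c: "(\<Sum>r\<in>A. c r *\<^sub>R (real_vec (fst r) :: real ^ 'n)) = 0" "\<exists>r\<in>A. c r \<noteq> 0"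
    by (rule dependent_family[OF fin card, of "\<lambda>r. real_vec (fst r)"])
  \<comment> \<open>The normals cancel in the combination, so it has the same value at all
    points.\<close>
  have const: "(\<Sum>r\<in>A. c r * affine_form r x) = (\<Sum>r\<in>A. c r * real_of_int (snd r))" for x :: "real ^ 'n"
  proof -
    have "(\<Sum>r\<in>A. c r * affine_form r x) =
        (\<Sum>r\<in>A. c r *\<^sub>R real_vec (fst r)) \<bullet> x + (\<Sum>r\<in>A. c r * real_of_int (snd r))"
      by (simp add: affine_form_def inner_sum_left distrib_left sum.distrib)
    then show ?thesis using c(1) by simp
  qed
  have real: "\<exists>x. \<forall>r\<in>A. affine_form r x \<ge> 0 \<longleftrightarrow> r \<in> B" if B: "B \<subseteq> A" for B
  proof -
    obtain x where "sign_pattern X x \<inter> A = B" using assms(3) B unfolding shatters_def by blast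
    then show ?thesis using assms(2) unfolding sign_pattern_def by (intro exI[of _ x]) auto
  qed
  \<comment> \<open>\<open>x\<close> realizes the pattern of the positive coefficients and
    \<open>y\<close> the opposite one, so all terms are nonnegative at \<open>x\<close> and
    nonpositive at \<open>y\<close>.\<close>
  obtain x where x: "\<forall>r\<in>A. affine_form r x \<ge> 0 \<longleftrightarrow> r \<in> {r\<in>A. c r > 0}" using real[OF Collect_restrict] by (rule exE)
  obtain y where y: "\<forall>r\<in>A. affine_form r y \<ge> 0 \<longleftrightarrow> r \<in> {r\<in>A. c r \<le> 0}" using real[OF Collect_restrict] by (rule exE)
  let ?C = "\<Sum>r\<in>A. c r * real_of_int (snd r)"
  have x': "c r * affine_form r x \<ge> 0" if "r \<in> A" for r
  proof (cases "c r > 0")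
    case True
    then have "affine_form r x \<ge> 0" using x that by blast
    then show ?thesis using True by simp
  next
    case False
    then have "\<not> affine_form r x \<ge> 0" using x that by blast
    then show ?thesis using False by (intro mult_nonpos_nonpos) simp_all
  qed
  have y': "c r * affine_form r y \<le> 0" if "r \<in> A" for r
  proof (cases "c r > 0")
    case True
    then have "\<not> affine_form r y \<ge> 0" using y that by force
    then show ?thesis using True by (intro mult_nonneg_nonpos) simp_all
  next
    case False
    then have "affine_form r y \<ge> 0" using y that by force
    then show ?thesis using False by (intro mult_nonpos_nonneg) simp_all
  qed
  have ge: "?C \<ge> 0" unfolding const[of x, symmetric] using x' by (rule sum_nonneg)
  have le: "?C \<le> 0" unfolding const[of y, symmetric] using y' by (rule sum_nonpos)
  \<comment> \<open>The common value is 0, hence all terms vanish. Only the side of a half-space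
    where the form is negative gives a strict sign, so a positive coefficient is refuted at
    \<open>y\<close> and a negative one at \<open>x\<close>.\<close>
  show False
  proof (cases "\<exists>r\<in>A. c r > 0")
    case True
    then obtain r where r: "r \<in> A" "c r > 0" by blast
    then have "\<not> affine_form r y \<ge> 0" using y by force
    then have "c r * affine_form r y < 0" using r by (intro mult_pos_neg) simp_all
    moreover have "c r * affine_form r y = 0"
    proof -
      have "(\<Sum>r\<in>A. - (c r * affine_form r y)) = 0" unfolding sum_negf const using ge le by simp
      then have "\<forall>r\<in>A. - (c r * affine_form r y) = 0"
        by (subst (asm) sum_nonneg_eq_0_iff[OF fin]) (use y' in auto)
      then have "- (c r * affine_form r y) = 0" using r(1) by (rule bspec)
      then show ?thesis by linarith
    qed
    ultimately show False by simp
  next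
    case False
    then obtain r where r: "r \<in> A" "c r < 0" using c(2) by (meson not_less_iff_gr_or_eq)
    then have "\<not> affine_form r x \<ge> 0" using x by force
    then have "c r * affine_form r x > 0" using r by (intro mult_neg_neg) simp_all
    moreover have "c r * affine_form r x = 0"
    proof -
      have "(\<Sum>r\<in>A. c r * affine_form r x) = 0" unfolding const using ge le by simp
      then have "\<forall>r\<in>A. c r * affine_form r x = 0"
        by (subst (asm) sum_nonneg_eq_0_iff[OF fin]) (use x' in auto)
      then have "c r * affine_form r x = 0" using r(1) by (rule bspec)
      then show ?thesis by linarith
    qed
    ultimately show False by simp
  qed
qed

lemma card_sign_patterns:
  fixes X :: "'n::finite row set"
  assumes "finite X"
  shows "card (sign_pattern X ` Q) \<le> (card X + 1) ^ CARD('n)"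
proof -
  have "card (sign_pattern X ` Q) \<le> card {A. A \<subseteq> X \<and> shatters (sign_pattern X ` Q) A}"
    by (rule card_le_card_shattered[OF assms]) (auto simp: sign_pattern_def)
  also have "\<dots> \<le> card {A. A \<subseteq> X \<and> card A \<le> CARD('n)}"
    by (rule card_mono) (use assms shattered_card_le in auto)
  also have "\<dots> \<le> (card X + 1) ^ CARD('n)" by (rule card_subsets_card_le[OF assms])
  finally show ?thesis .
qed


section \<open>The size of the points of a polytope\<close>

lemma polyhedron_of_closed_convex:
  "closed (polyhedron_of rs)" "convex (polyhedron_of rs)"
proof -
  have "polyhedron_of rs = (\<Inter>r\<in>set rs. {x. real_vec (fst r) \<bullet> x \<le> real_of_int (snd r)})"
    by (simp add: polyhedron_of_def case_prod_beta' set_eq_iff)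
  then show "closed (polyhedron_of rs)" "convex (polyhedron_of rs)"
    by (auto intro!: closed_INT convex_INT closed_halfspace_le convex_halfspace_le)
qed

text \<open>Otherwise some \<open>d \<noteq> 0\<close> is orthogonal to all tight normals. Tight
  rows do not change along \<open>d\<close> and the others have slack, so a short step along
  \<open>d\<close> in either direction stays in the polyhedron, and \<open>x\<close> is the midpoint
  of a segment in it.\<close>

lemma extreme_point_tight_span:
  assumes "x extreme_point_of (polyhedron_of rs)"
  shows "span {real_vec a | a b. (a, b) \<in> set rs \<and> real_vec a \<bullet> x = real_of_int b} = (UNIV :: (real ^ 'n::finite) set)"
proof (rule ccontr)
  let ?T = "{real_vec a | a b. (a, b) \<in> set rs \<and> real_vec a \<bullet> x = real_of_int b}"
  assume "span ?T \<noteq> UNIV"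
  then obtain d where d: "d \<noteq> 0" "\<And>v. v \<in> span ?T \<Longrightarrow> d \<bullet> v = 0"
    using span_not_UNIV_orthogonal by blast
  have xP: "x \<in> polyhedron_of rs" using assms by (simp add: extreme_point_of_def)
  have "\<forall>r\<in>set rs. \<exists>e>0. \<forall>t. \<bar>t\<bar> \<le> e \<longrightarrow> real_vec (fst r) \<bullet> (x + t *\<^sub>R d) \<le> real_of_int (snd r)"
  proof
    fix r assume r: "r \<in> set rs"
    obtain a b where ab: "r = (a, b)" by (cases r)
    show "\<exists>e>0. \<forall>t. \<bar>t\<bar> \<le> e \<longrightarrow> real_vec (fst r) \<bullet> (x + t *\<^sub>R d) \<le> real_of_int (snd r)"
    proof (cases "real_vec a \<bullet> x = real_of_int b")
      case True
      then have "real_vec a \<in> ?T" using r ab by blast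
      from d(2)[OF span_base[OF this]] have "real_vec a \<bullet> d = 0" by (simp add: inner_commute)
      then show ?thesis using True ab by (intro exI[of _ 1]) (simp add: inner_add_right)
    next
      case False
      then have lt: "real_vec a \<bullet> x < real_of_int b" using xP r ab by (fastforce simp: polyhedron_of_def)
      \<comment> \<open>The slack is divided by the rate of change along \<open>d\<close>, enlarged
        by 1 to keep the divisor positive.\<close>
      define m where "m = 1 + \<bar>real_vec a \<bullet> d\<bar>"
      define e where "e = (real_of_int b - real_vec a \<bullet> x) / m"
      have m: "m > 0" by (simp add: m_def add_pos_nonneg)
      have "real_vec a \<bullet> (x + t *\<^sub>R d) \<le> real_of_int b" if t: "\<bar>t\<bar> \<le> e" for t
      proof -
        have "t * (real_vec a \<bullet> d) \<le> \<bar>t\<bar> * \<bar>real_vec a \<bullet> d\<bar>" by (metis abs_ge_self abs_mult)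
        also have "\<dots> \<le> e * m" using t lt m by (intro mult_mono) (auto simp: m_def e_def)
        also have "\<dots> = real_of_int b - real_vec a \<bullet> x" using m by (simp add: e_def)
        finally show ?thesis by (simp add: inner_add_right)
      qed
      moreover have "e > 0" using lt m by (simp add: e_def)
      ultimately show ?thesis using ab by auto
    qed
  qed
  then obtain e where e: "\<forall>r\<in>set rs. e r > 0 \<and>
      (\<forall>t. \<bar>t\<bar> \<le> e r \<longrightarrow> real_vec (fst r) \<bullet> (x + t *\<^sub>R d) \<le> real_of_int (snd r))"
    by metis
  \<comment> \<open>The element 1 keeps the minimum defined when there are no rows.\<close>
  define t where "t = Min (insert 1 (e ` set rs))"
  have t: "t > 0" "\<forall>r\<in>set rs. t \<le> e r" using e by (auto simp: t_def)
  have "x + t *\<^sub>R d \<in> polyhedron_of rs" "x - t *\<^sub>R d \<in> polyhedron_of rs"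
  proof -
    have "real_vec (fst r) \<bullet> (x + u *\<^sub>R d) \<le> real_of_int (snd r)" if "r \<in> set rs" "\<bar>u\<bar> \<le> t" for r u
      using e t that by (meson order_trans)
    from this[of _ t] this[of _ "- t"] show "x + t *\<^sub>R d \<in> polyhedron_of rs" "x - t *\<^sub>R d \<in> polyhedron_of rs"
      using t(1) by (force simp: polyhedron_of_def)+
  qed
  moreover have "x \<in> open_segment (x - t *\<^sub>R d) (x + t *\<^sub>R d)"
  proof -
    have "x - t *\<^sub>R d \<noteq> x + t *\<^sub>R d"
    proof
      assume "x - t *\<^sub>R d = x + t *\<^sub>R d"
      then have "(2 * t) *\<^sub>R d = 0" by (simp add: algebra_simps scaleR_2[symmetric])
      then show False using t(1) d(1) by simp
    qed
    moreover have "midpoint (x - t *\<^sub>R d) (x + t *\<^sub>R d) = x"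
      by (simp add: midpoint_def scaleR_2[symmetric] del: scaleR_add_left)
    ultimately show ?thesis using midpoint_in_open_segment[of "x - t *\<^sub>R d" "x + t *\<^sub>R d"] by simp
  qed
  ultimately show False using assms unfolding extreme_point_of_def by blast
qed

lemma det_Ints:
  fixes A :: "real ^ 'n::finite ^ 'n"
  assumes "\<And>i j. A $ i $ j \<in> \<int>"
  shows "det A \<in> \<int>"
  unfolding det_def by (intro Ints_sum Ints_mult Ints_prod assms) (auto simp: sign_def)

lemma det_abs_le:
  fixes A :: "real ^ 'n::finite ^ 'n"
  assumes "\<And>i j. \<bar>A $ i $ j\<bar> \<le> H"
  shows "\<bar>det A\<bar> \<le> fact CARD('n) * H ^ CARD('n)"
proof -
  let ?P = "{p. p permutes (UNIV :: 'n set)}"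
  have "\<bar>det A\<bar> \<le> (\<Sum>p\<in>?P. \<bar>of_int (sign p) * (\<Prod>i\<in>UNIV. A $ i $ p i)\<bar>)"
    unfolding det_def by (rule sum_abs)
  also have "\<dots> \<le> (\<Sum>p\<in>?P. H ^ CARD('n))"
  proof (rule sum_mono)
    fix p
    have "\<bar>of_int (sign p) * (\<Prod>i\<in>UNIV. A $ i $ p i)\<bar> = (\<Prod>i\<in>UNIV. \<bar>A $ i $ p i\<bar>)"
      by (simp add: abs_mult sign_def abs_prod)
    also have "\<dots> \<le> (\<Prod>i\<in>(UNIV::'n set). H)" by (rule prod_mono) (use assms in auto)
    finally show "\<bar>of_int (sign p) * (\<Prod>i\<in>UNIV. A $ i $ p i)\<bar> \<le> H ^ CARD('n)" by simp
  qed
  also have "\<dots> = fact CARD('n) * H ^ CARD('n)" by (simp add: card_permutations)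
  finally show ?thesis .
qed

text \<open>By \<open>extreme_point_tight_span\<close>, \<open>x\<close> solves a regular system of
  \<open>n\<close> tight rows. In Cramer's rule the denominator is a nonzero integer, so at least 1
  in absolute value, and the numerator is a sum of \<open>n!\<close> terms, each at most
  \<open>H ^ n\<close> in absolute value.\<close>

lemma extreme_point_bound:
  fixes x :: "real ^ 'n::finite"
  assumes "x extreme_point_of (polyhedron_of rs)"
    and H: "\<And>a b i. (a, b) \<in> set rs \<Longrightarrow> \<bar>a $ i\<bar> \<le> H \<and> \<bar>b\<bar> \<le> H"
  shows "\<bar>x $ i\<bar> \<le> fact CARD('n) * real_of_int H ^ CARD('n)"
proof -
  let ?T = "{real_vec a | a b. (a, b) \<in> set rs \<and> real_vec a \<bullet> x = real_of_int b}"
  obtain B where B: "B \<subseteq> ?T" "independent B" "?T \<subseteq> span B" by (rule maximal_independent_subset)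
  have spanB: "span B = UNIV"
    using span_minimal[OF B(3) subspace_span] unfolding extreme_point_tight_span[OF assms(1)] by blast
  have "card B = CARD('n)"
    using dim_span[of B] spanB dim_eq_card_independent[OF B(2)] by simp
  moreover have "finite B" using B(2) independent_bound by blast
  ultimately obtain f where f: "bij_betw f (UNIV :: 'n set) B"
    using finite_same_card_bij[of "UNIV :: 'n set" B] by auto
  then have fB: "f k \<in> ?T" for k using B(1) bij_betwE[OF f] by blast
  \<comment> \<open>\<open>f\<close> yields only normals. For each of them \<open>g\<close> selects
    a row that is tight at \<open>x\<close>, to supply the right-hand sides.\<close>
  define g where "g k = (SOME r. r \<in> set rs \<and> f k = real_vec (fst r) \<and> real_vec (fst r) \<bullet> x = real_of_int (snd r))" for k
  have g: "g k \<in> set rs" "f k = real_vec (fst (g k))" "real_vec (fst (g k)) \<bullet> x = real_of_int (snd (g k))" for k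
  proof -
    have "\<exists>r. r \<in> set rs \<and> f k = real_vec (fst r) \<and> real_vec (fst r) \<bullet> x = real_of_int (snd r)"
      using fB[of k] by force
    from someI_ex[OF this] show "g k \<in> set rs" "f k = real_vec (fst (g k))"
      "real_vec (fst (g k)) \<bullet> x = real_of_int (snd (g k))" unfolding g_def by auto
  qed
  define A :: "real ^ 'n ^ 'n" where "A = (\<chi> k. f k)"
  define c :: "real ^ 'n" where "c = (\<chi> k. real_of_int (snd (g k)))"
  have "rows A = B" using f by (auto simp: rows_def row_def A_def bij_betw_def)
  then have "\<exists>C. C ** A = mat 1" using spanB by (simp add: matrix_left_invertible_span_rows)
  then have det: "det A \<noteq> 0" using invertible_left_inverse invertible_det_nz by blast
  have "A *v x = c" using g by (simp add: matrix_vector_mult_def A_def c_def vec_eq_iff inner_vec_def)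
  then have "x = (\<chi> k. det (\<chi> i j. if j = k then c $ i else A $ i $ j) / det A)"
    using cramer[OF det] by blast
  then have xi: "x $ i = det (\<chi> i' j. if j = i then c $ i' else A $ i' $ j) / det A" by (simp add: vec_eq_iff)
  have ints: "A $ k $ j \<in> \<int>" for k j using g(2)[of k] by (simp add: A_def real_vec_def)
  have "1 \<le> \<bar>det A\<bar>" using det_Ints[OF ints] det by (rule Ints_nonzero_abs_ge1)
  moreover have "\<bar>det (\<chi> i' j. if j = i then c $ i' else A $ i' $ j)\<bar> \<le> fact CARD('n) * real_of_int H ^ CARD('n)"
  proof (rule det_abs_le)
    fix k j
    have "\<bar>fst (g k) $ j\<bar> \<le> H \<and> \<bar>snd (g k)\<bar> \<le> H" using H[of "fst (g k)" "snd (g k)" j] g(1)[of k] by simp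
    then have "real_of_int \<bar>fst (g k) $ j\<bar> \<le> real_of_int H" "real_of_int \<bar>snd (g k)\<bar> \<le> real_of_int H"
      by (simp_all only: of_int_le_iff)
    then show "\<bar>(\<chi> i' j. if j = i then c $ i' else A $ i' $ j) $ k $ j\<bar> \<le> real_of_int H"
      using g(2)[of k] by (simp add: A_def c_def real_vec_def)
  qed
  ultimately have "\<bar>det (\<chi> i' j. if j = i then c $ i' else A $ i' $ j)\<bar> / \<bar>det A\<bar> \<le> fact CARD('n) * real_of_int H ^ CARD('n) / 1"
    by (intro frac_le) simp_all
  then show ?thesis unfolding xi abs_divide by simp
qed

text \<open>A compact convex set is the convex hull of its extreme points, so the bound for the
  vertices extends to all points: the slab between two parallel hyperplanes is convex.\<close>

lemma polytope_bound:
  fixes x :: "real ^ 'n::finite"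
  assumes "bounded (polyhedron_of rs)" and "x \<in> polyhedron_of rs"
    and "\<And>a b i. (a, b) \<in> set rs \<Longrightarrow> \<bar>a $ i\<bar> \<le> H \<and> \<bar>b\<bar> \<le> H"
  shows "\<bar>x $ i\<bar> \<le> fact CARD('n) * real_of_int H ^ CARD('n)"
proof -
  let ?M = "fact CARD('n) * real_of_int H ^ CARD('n)"
  let ?S = "{y :: real ^ 'n. axis i 1 \<bullet> y \<le> ?M} \<inter> {y. axis i 1 \<bullet> y \<ge> - ?M}"
  have "polyhedron_of rs = convex hull {y. y extreme_point_of (polyhedron_of rs)}"
    by (rule Krein_Milman_Minkowski)
       (use assms(1) polyhedron_of_closed_convex in \<open>auto simp: compact_eq_bounded_closed\<close>)
  also have "\<dots> \<subseteq> ?S"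
  proof (rule hull_minimal)
    show "{y. y extreme_point_of (polyhedron_of rs)} \<subseteq> ?S"
    proof
      fix y assume "y \<in> {y. y extreme_point_of (polyhedron_of rs)}"
      then have "\<bar>y $ i\<bar> \<le> ?M" using extreme_point_bound[of y rs H i] assms(3) by blast
      then show "y \<in> ?S" by (simp add: inner_axis' abs_le_iff)
    qed
    show "convex ?S" by (intro convex_Int convex_halfspace_le convex_halfspace_ge)
  qed
  finally show ?thesis using assms(2) by (auto simp: inner_axis' abs_le_iff)
qed

text \<open>Each of the \<open>n\<close> products of an entry and a coordinate is at most
  \<open>H * (n! * H ^ n)\<close>, and the constant term is at most
  \<open>H \<le> H ^ (n + 1)\<close>.\<close>

lemma affine_form_bound:
  fixes x :: "real ^ 'n::finite"
  assumes "bounded (polyhedron_of rs)" and "x \<in> polyhedron_of rs" and "H \<ge> 1"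
    and "\<And>a b i. (a, b) \<in> set rs \<Longrightarrow> \<bar>a $ i\<bar> \<le> H \<and> \<bar>b\<bar> \<le> H"
    and "\<And>i. \<bar>fst r $ i\<bar> \<le> H" "\<bar>snd r\<bar> \<le> H"
  shows "\<bar>affine_form r x\<bar> \<le> real_of_int ((int CARD('n) * fact CARD('n) + 1) * H ^ (CARD('n) + 1))"
proof -
  let ?n = "CARD('n)"
  have "\<bar>real_vec (fst r) \<bullet> x\<bar> \<le> (\<Sum>i\<in>UNIV. \<bar>real_of_int (fst r $ i) * x $ i\<bar>)"
    unfolding inner_vec_def real_vec_def by (simp add: sum_abs)
  also have "\<dots> \<le> (\<Sum>i\<in>(UNIV::'n set). real_of_int H * (fact ?n * real_of_int H ^ ?n))"
  proof (rule sum_mono)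
    fix i
    have "real_of_int \<bar>fst r $ i\<bar> \<le> real_of_int H" using assms(5) by (simp only: of_int_le_iff)
    moreover have "\<bar>x $ i\<bar> \<le> fact ?n * real_of_int H ^ ?n" by (rule polytope_bound[OF assms(1,2,4)])
    ultimately show "\<bar>real_of_int (fst r $ i) * x $ i\<bar> \<le> real_of_int H * (fact ?n * real_of_int H ^ ?n)"
      unfolding abs_mult by (intro mult_mono) (use assms(3) in auto)
  qed
  finally have 1: "\<bar>real_vec (fst r) \<bullet> x\<bar> \<le> real ?n * fact ?n * real_of_int H ^ (?n + 1)"
    by (simp add: algebra_simps)
  have "\<bar>real_of_int (snd r)\<bar> \<le> real_of_int H"
    using assms(6) by (metis of_int_abs of_int_le_iff)
  also have "\<dots> \<le> real_of_int H ^ (?n + 1)" using assms(3) by (intro self_le_power) auto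
  finally have "\<bar>affine_form r x\<bar> \<le> real ?n * fact ?n * real_of_int H ^ (?n + 1) + real_of_int H ^ (?n + 1)"
    unfolding affine_form_def using 1 by linarith
  then show ?thesis by (simp add: algebra_simps)
qed

lemma finite_int_points:
  assumes "bounded (P :: (real ^ 'n::finite) set)"
  shows "finite (P \<inter> int_points)"
proof -
  obtain M where M: "\<And>x. x \<in> P \<Longrightarrow> norm x \<le> M" using assms by (auto simp: bounded_iff)
  let ?Z = "(\<lambda>h. real_vec (vec_lambda h)) ` (UNIV \<rightarrow>\<^sub>E {-\<lceil>M\<rceil>..\<lceil>M\<rceil>}) :: (real ^ 'n) set"
  have "P \<inter> int_points \<subseteq> ?Z"
  proof
    fix x assume x: "x \<in> P \<inter> int_points"
    then obtain z where z: "x = real_vec z" by (auto simp: int_points_def)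
    have "z $ i \<in> {-\<lceil>M\<rceil>..\<lceil>M\<rceil>}" for i
    proof -
      have "\<bar>x $ i\<bar> \<le> M" using M x component_le_norm_cart[of x i] by fastforce
      then have "\<bar>real_of_int (z $ i)\<bar> \<le> M" using z by (simp add: real_vec_def)
      then show ?thesis by (auto simp: abs_le_iff le_ceiling_iff) linarith+
    qed
    then have "vec_nth z \<in> UNIV \<rightarrow>\<^sub>E {-\<lceil>M\<rceil>..\<lceil>M\<rceil>}" by auto
    then show "x \<in> ?Z" using z by (intro image_eqI[of _ _ "vec_nth z"]) auto
  qed
  moreover have "finite ?Z" by (intro finite_imageI finite_PiE) auto
  ultimately show ?thesis by (rule finite_subset)
qed


section \<open>Slices and cells\<close>

definition in_slice :: "real \<Rightarrow> int \<Rightarrow> real \<Rightarrow> bool" where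
  "in_slice \<delta> k v \<longleftrightarrow>
     (k \<ge> 1 \<longrightarrow> (1 + \<delta>) powi (k - 1) \<le> v \<and> v \<le> (1 + \<delta>) powi k) \<and>
     (k = 0 \<longrightarrow> v = 0) \<and>
     (k \<le> -1 \<longrightarrow> - ((1 + \<delta>) powi (- k)) \<le> v \<and> v \<le> - ((1 + \<delta>) powi (- k - 1)))"

lemma mem_slice_iff:
  "x \<in> slice cs k \<delta> \<longleftrightarrow> (\<forall>j < length cs. in_slice \<delta> (k j) (affine_form (cs ! j) x))"
  by (simp add: slice_def in_slice_def)

fun in_interval :: "int \<times> int \<Rightarrow> real \<Rightarrow> bool" where
  "in_interval (lo, hi) v \<longleftrightarrow> real_of_int lo \<le> v \<and> v \<le> real_of_int hi"

definition disjoint_intervals :: "int \<times> int \<Rightarrow> int \<times> int \<Rightarrow> bool" where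
  "disjoint_intervals I J \<longleftrightarrow> (\<forall>v :: int. \<not> (in_interval I (of_int v) \<and> in_interval J (of_int v)))"

text \<open>The integers up to \<open>\<lfloor>(A / B) ^ k\<rfloor>\<close> in absolute value, cut at the integer parts of the
  powers of \<open>A / B = 1 + \<delta>\<close>.\<close>

fun slabs :: "int \<Rightarrow> int \<Rightarrow> nat \<Rightarrow> (int \<times> int) list" where
  "slabs A B 0 = [(0, 0), (1, 1), (-1, -1)]"
| "slabs A B (Suc k) = (A ^ k div B ^ k + 1, A ^ Suc k div B ^ Suc k) #
     (- (A ^ Suc k div B ^ Suc k), - (A ^ k div B ^ k) - 1) # slabs A B k"

lemma div_power_mono:
  assumes "0 < B" and "B \<le> (A::int)"
  shows "A ^ k div B ^ k \<le> A ^ Suc k div B ^ Suc k"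
proof -
  have "A ^ k div B ^ k = (B * A ^ k) div (B * B ^ k)" using assms by simp
  also have "\<dots> \<le> (A * A ^ k) div (B * B ^ k)"
    by (rule zdiv_mono1) (use assms in \<open>auto intro: mult_right_mono\<close>)
  finally show ?thesis by simp
qed

lemma div_power_ge_1:
  assumes "0 < B" and "B \<le> (A::int)"
  shows "1 \<le> A ^ k div B ^ k"
proof (induction k)
  case (Suc k)
  then show ?case using div_power_mono[OF assms, of k] by linarith
qed simp

lemma length_slabs: "length (slabs A B k) = 2 * k + 3"
  by (induction k) auto

lemma slabs_cover:
  assumes "\<bar>v\<bar> \<le> A ^ k div B ^ k"
  shows "\<exists>I\<in>set (slabs A B k). in_interval I (of_int v)"
  using assms
proof (induction k)
  case 0
  then have "v = 0 \<or> v = 1 \<or> v = -1" by auto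
  then show ?case by auto
next
  case (Suc k)
  show ?case
  proof (cases "\<bar>v\<bar> \<le> A ^ k div B ^ k")
    case True
    then show ?thesis using Suc.IH by auto
  next
    case False
    let ?lo = "A ^ k div B ^ k" and ?hi = "A ^ Suc k div B ^ Suc k"
    have "?lo + 1 \<le> v \<and> v \<le> ?hi \<or> - ?hi \<le> v \<and> v \<le> - ?lo - 1" using False Suc.prems by linarith
    then have "in_interval (?lo + 1, ?hi) (of_int v) \<or> in_interval (- ?hi, - ?lo - 1) (of_int v)"
      unfolding in_interval.simps of_int_le_iff .
    then show ?thesis by (auto simp del: in_interval.simps power_Suc)
  qed
qed

lemma slabs_bound:
  assumes "0 < B" and "B \<le> A" and "I \<in> set (slabs A B k)" and "in_interval I (of_int v)"
  shows "\<bar>v\<bar> \<le> A ^ k div B ^ k"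
  using assms(3)
proof (induction k)
  case 0
  then show ?case using assms(4) by auto
next
  case (Suc k)
  let ?lo = "A ^ k div B ^ k" and ?hi = "A ^ Suc k div B ^ Suc k"
  have m: "?lo \<le> ?hi" "1 \<le> ?lo" using div_power_mono[OF assms(1,2)] div_power_ge_1[OF assms(1,2)] by blast+
  consider "I = (?lo + 1, ?hi)" | "I = (- ?hi, - ?lo - 1)" | "I \<in> set (slabs A B k)"
    using Suc.prems by (auto simp del: power_Suc)
  then show ?case
  proof cases
    case 1
    then have "?lo + 1 \<le> v \<and> v \<le> ?hi" using assms(4) unfolding in_interval.simps of_int_le_iff by simp
    then show ?thesis using m by linarith
  next
    case 2
    then have "- ?hi \<le> v \<and> v \<le> - ?lo - 1" using assms(4) unfolding in_interval.simps of_int_le_iff by simp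
    then show ?thesis using m by linarith
  next
    case 3
    then show ?thesis using Suc.IH m by linarith
  qed
qed

text \<open>Earlier intervals stay within the integer part of the \<open>k\<close>-th power
  (\<open>slabs_bound\<close>), the two new ones lie beyond it on opposite sides. When consecutive
  integer parts agree, the new intervals are empty.\<close>

lemma slabs_disjoint:
  assumes "0 < B" and "B \<le> A"
  shows "sorted_wrt disjoint_intervals (slabs A B k)"
proof (induction k)
  case 0
  then show ?case by (auto simp: disjoint_intervals_def)
next
  case (Suc k)
  let ?lo = "A ^ k div B ^ k" and ?hi = "A ^ Suc k div B ^ Suc k"
  have m: "1 \<le> ?lo" using div_power_ge_1[OF assms] by blast
  have 1: "disjoint_intervals (?lo + 1, ?hi) I" "disjoint_intervals (- ?hi, - ?lo - 1) I"
    if "I \<in> set (slabs A B k)" for I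
    using slabs_bound[OF assms that] m unfolding disjoint_intervals_def in_interval.simps of_int_le_iff
    by fastforce+
  have 2: "disjoint_intervals (?lo + 1, ?hi) (- ?hi, - ?lo - 1)"
    using m unfolding disjoint_intervals_def in_interval.simps of_int_le_iff by fastforce
  show ?case using Suc 1 2 by (simp del: power_Suc)
qed

text \<open>An integer exceeds a power iff it exceeds its integer part. So, as far as integers are
  concerned, a slab lies in a single slice; the values 0, 1 and -1 belong to the slices 0, 1 and
  -1.\<close>

lemma slabs_in_slice:
  assumes "0 < B" and "B \<le> A" and "I \<in> set (slabs A B k)" and \<delta>: "1 + \<delta> = real_of_int A / real_of_int B"
  shows "\<exists>k. \<forall>v :: int. in_interval I (of_int v) \<longrightarrow> in_slice \<delta> k (of_int v)"
  using assms(3)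
proof (induction k)
  case 0
  have ge: "1 + \<delta> \<ge> 1" unfolding \<delta> using assms by simp
  consider "I = (0, 0)" | "I = (1, 1)" | "I = (-1, -1)" using 0 by auto
  then show ?case
  proof cases
    case 1
    then show ?thesis by (intro exI[of _ 0]) (auto simp: in_slice_def)
  next
    case 2
    then show ?thesis using ge by (intro exI[of _ 1]) (auto simp: in_slice_def)
  next
    case 3
    have "\<forall>v. in_interval I (of_int v) \<longrightarrow> v = -1" using 3 by (auto simp flip: of_int_minus)
    then show ?thesis using ge by (intro exI[of _ "-1"]) (auto simp: in_slice_def)
  qed
next
  case (Suc k)
  let ?lo = "A ^ k div B ^ k" and ?hi = "A ^ Suc k div B ^ Suc k"
  have fl: "A ^ l div B ^ l = \<lfloor>(1 + \<delta>) ^ l\<rfloor>" for l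
    unfolding \<delta> power_divide of_int_power[symmetric] by (rule floor_divide_of_int_eq[symmetric])
  have lo: "(1 + \<delta>) ^ k \<le> real_of_int v" if "?lo + 1 \<le> v" for v
    using that unfolding fl by linarith
  have hi: "real_of_int v \<le> (1 + \<delta>) ^ Suc k" if "v \<le> ?hi" for v
    using that unfolding fl by linarith
  consider "I = (?lo + 1, ?hi)" | "I = (- ?hi, - ?lo - 1)" | "I \<in> set (slabs A B k)"
    using Suc.prems by (auto simp del: power_Suc)
  then show ?case
  proof cases
    case 1
    have "in_slice \<delta> (int (Suc k)) (of_int v)" if "in_interval I (of_int v)" for v
    proof -
      have "?lo + 1 \<le> v" "v \<le> ?hi" using that 1 unfolding in_interval.simps of_int_le_iff by auto
      then show ?thesis using lo hi unfolding in_slice_def by (simp add: power_int_def nat_add_distrib)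
    qed
    then show ?thesis by blast
  next
    case 2
    have "in_slice \<delta> (- int (Suc k)) (of_int v)" if "in_interval I (of_int v)" for v
    proof -
      have "- ?hi \<le> v" "v \<le> - ?lo - 1" using that 2 unfolding in_interval.simps of_int_le_iff by auto
      then have "(1 + \<delta>) ^ k \<le> real_of_int (- v)" "real_of_int (- v) \<le> (1 + \<delta>) ^ Suc k"
        by (intro lo hi; linarith)+
      then show ?thesis unfolding in_slice_def by (simp add: power_int_def nat_add_distrib)
    qed
    then show ?thesis by blast
  next
    case 3
    then show ?thesis using Suc.IH by blast
  qed
qed

section \<open>Cells and their number\<close>

definition has_int :: "'n::finite row list \<Rightarrow> bool" where
  "has_int C \<longleftrightarrow> polyhedron_of C \<inter> int_points \<noteq> {}"

fun slab_rows :: "'n::finite row \<Rightarrow> int \<times> int \<Rightarrow> 'n row list" where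
  "slab_rows (a, c) (lo, hi) = [(a, hi - c), (- a, c - lo)]"

definition refine :: "(int \<times> int) list \<Rightarrow> 'n::finite row \<Rightarrow> 'n row list list \<Rightarrow> 'n row list list" where
  "refine Is r Cs = filter has_int (concat (map (\<lambda>C. map (\<lambda>I. slab_rows r I @ C) Is) Cs))"

definition cells :: "(int \<times> int) list \<Rightarrow> 'n::finite row list \<Rightarrow> 'n row list \<Rightarrow> 'n row list list" where
  "cells Is rs fs = fold (refine Is) fs (filter has_int [rs])"

lemma cells_snoc: "cells Is rs (fs @ [r]) = refine Is r (cells Is rs fs)"
  by (simp add: cells_def)

lemma real_vec_minus [simp]: "real_vec (- a) = - real_vec a"
  by (simp add: real_vec_def vec_eq_iff)

lemma polyhedron_of_slab_rows:
  "polyhedron_of (slab_rows r I @ C) = polyhedron_of C \<inter> {x. in_interval I (affine_form r x)}"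
  by (cases r; cases I) (auto simp: polyhedron_of_def affine_form_def algebra_simps)

lemma cells_exact:
  assumes "C \<in> set (cells Is rs fs)"
  shows "has_int C \<and> (\<exists>Js. length Js = length fs \<and> set Js \<subseteq> set Is \<and>
    polyhedron_of C = polyhedron_of rs \<inter> {x. \<forall>j<length fs. in_interval (Js ! j) (affine_form (fs ! j) x)})"
  using assms
proof (induction fs arbitrary: C rule: rev_induct)
  case Nil
  then show ?case by (auto simp: cells_def split: if_splits)
next
  case (snoc r fs)
  then obtain D I where D: "D \<in> set (cells Is rs fs)" "I \<in> set Is" "C = slab_rows r I @ D" "has_int C"
    unfolding cells_snoc refine_def by auto
  obtain Js where Js: "length Js = length fs" "set Js \<subseteq> set Is"
    "polyhedron_of D = polyhedron_of rs \<inter> {x. \<forall>j<length fs. in_interval (Js ! j) (affine_form (fs ! j) x)}"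
    using snoc.IH[OF D(1)] by blast
  have "polyhedron_of C = polyhedron_of rs \<inter>
      {x. \<forall>j<length (fs @ [r]). in_interval ((Js @ [I]) ! j) (affine_form ((fs @ [r]) ! j) x)}"
    unfolding D(3) polyhedron_of_slab_rows Js(3)
    using Js(1) by (auto simp: nth_append less_Suc_eq)
  then show ?case using D Js by (intro conjI exI[of _ "Js @ [I]"]) auto
qed

lemma cells_subset: "C \<in> set (cells Is rs fs) \<Longrightarrow> polyhedron_of C \<subseteq> polyhedron_of rs"
  using cells_exact by blast

text \<open>The point itself witnesses that the cells containing it pass the test for integer
  points.\<close>

lemma cells_cover:
  assumes "x \<in> polyhedron_of rs \<inter> int_points"
    and "\<And>r. r \<in> set fs \<Longrightarrow> \<exists>I\<in>set Is. in_interval I (affine_form r x)"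
  shows "\<exists>C\<in>set (cells Is rs fs). x \<in> polyhedron_of C"
  using assms(2)
proof (induction fs rule: rev_induct)
  case Nil
  then show ?case using assms(1) by (auto simp: cells_def has_int_def)
next
  case (snoc r fs)
  then obtain C where C: "C \<in> set (cells Is rs fs)" "x \<in> polyhedron_of C" by auto
  obtain I where I: "I \<in> set Is" "in_interval I (affine_form r x)" using snoc.prems[of r] by force
  have x: "x \<in> polyhedron_of (slab_rows r I @ C)" unfolding polyhedron_of_slab_rows using C I by simp
  moreover from this have "has_int (slab_rows r I @ C)" using assms(1) unfolding has_int_def by blast
  ultimately have "slab_rows r I @ C \<in> set (cells Is rs (fs @ [r]))"
    unfolding cells_snoc refine_def using C(1) I(1) by auto
  then show ?case using x by blast
qed

lemma affine_form_of_int: "x \<in> int_points \<Longrightarrow> \<exists>v :: int. affine_form r x = of_int v"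
proof -
  assume "x \<in> int_points"
  then obtain z where "x = real_vec z" by (auto simp: int_points_def)
  then have "affine_form r x = of_int ((\<Sum>i\<in>UNIV. fst r $ i * z $ i) + snd r)"
    by (simp add: affine_form_def inner_vec_def real_vec_def)
  then show ?thesis by blast
qed

text \<open>Cells cut from the same cell differ in the interval of the new form; cells cut from
  different ones inherit their disjointness.\<close>

lemma cells_disjoint:
  assumes "sorted_wrt disjoint_intervals Is"
  shows "sorted_wrt (\<lambda>C D. polyhedron_of C \<inter> polyhedron_of D \<inter> int_points = {}) (cells Is rs fs)"
proof (induction fs rule: rev_induct)
  case Nil
  then show ?case by (simp add: cells_def)
next
  case (snoc r fs)
  let ?R = "\<lambda>C D. polyhedron_of C \<inter> polyhedron_of D \<inter> int_points = {}"
  have row: "sorted_wrt ?R (map (\<lambda>I. slab_rows r I @ C) Js)" if "sorted_wrt disjoint_intervals Js" for C Js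
    unfolding sorted_wrt_map
  proof (rule sorted_wrt_mono_rel[OF _ that])
    fix I J assume "disjoint_intervals I J"
    then show "?R (slab_rows r I @ C) (slab_rows r J @ C)"
      unfolding polyhedron_of_slab_rows disjoint_intervals_def using affine_form_of_int[of _ r] by fastforce
  qed
  have "sorted_wrt ?R (concat (map (\<lambda>C. map (\<lambda>I. slab_rows r I @ C) Is) Cs))" if "sorted_wrt ?R Cs" for Cs
    using that
  proof (induction Cs)
    case (Cons C Cs)
    have "?R (slab_rows r I @ C) (slab_rows r J @ D)" if "D \<in> set Cs" for I J D
      using Cons.prems that unfolding polyhedron_of_slab_rows by auto
    then show ?case using Cons row[OF assms] by (auto simp: sorted_wrt_append)
  qed simp
  from this[OF snoc] show ?case
    unfolding cells_snoc refine_def by (rule sorted_wrt_filter)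
qed

text \<open>One half-space for each form and each lower end suffices: as the intervals are disjoint
  and cover all values, the lower ends not exceeding a value determine its interval. So integer
  points in different cells have different sign patterns, and these are counted by
  \<open>card_sign_patterns\<close>.\<close>

lemma length_cells_le:
  fixes rs :: "'n::finite row list"
  assumes disj: "sorted_wrt disjoint_intervals Is"
    and cover: "\<And>x r. x \<in> polyhedron_of rs \<inter> int_points \<Longrightarrow> r \<in> set fs \<Longrightarrow>
       \<exists>I\<in>set Is. in_interval I (affine_form r x)"
  shows "length (cells Is rs fs) \<le> (length fs * length Is + 1) ^ CARD('n)"
proof -
  define X :: "'n row set" where "X = (\<lambda>(r, I). (fst r, snd r - fst I)) ` (set fs \<times> set Is)"
  have "card X \<le> card (set fs \<times> set Is)" unfolding X_def by (rule card_image_le) simp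
  also have "\<dots> = card (set fs) * card (set Is)" by (rule card_cartesian_product)
  also have "\<dots> \<le> length fs * length Is" by (intro mult_mono card_length) auto
  finally have X: "card X \<le> length fs * length Is" .
  have finX: "finite X" unfolding X_def by simp
  let ?Cs = "cells Is rs fs"
  have "\<forall>k<length ?Cs. \<exists>x. x \<in> polyhedron_of (?Cs ! k) \<inter> int_points"
    using cells_exact[of _ Is rs fs] unfolding has_int_def by (meson all_not_in_conv nth_mem)
  then obtain pt where pt: "\<And>k. k < length ?Cs \<Longrightarrow> pt k \<in> polyhedron_of (?Cs ! k) \<inter> int_points" by metis
  have same: "y \<in> polyhedron_of C"
    if C: "C \<in> set ?Cs" and x: "x \<in> polyhedron_of C \<inter> int_points" and y: "y \<in> polyhedron_of rs \<inter> int_points"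
      and xy: "sign_pattern X x = sign_pattern X y" for C x y
  proof -
    obtain Js where Js: "length Js = length fs" "set Js \<subseteq> set Is"
      "polyhedron_of C = polyhedron_of rs \<inter> {x. \<forall>j<length fs. in_interval (Js ! j) (affine_form (fs ! j) x)}"
      using cells_exact[OF C] by blast
    have "in_interval (Js ! j) (affine_form (fs ! j) y)" if j: "j < length fs" for j
    proof -
      obtain a c where r: "fs ! j = (a, c)" by (cases "fs ! j")
      obtain lo hi where I: "Js ! j = (lo, hi)" by (cases "Js ! j")
      have mem: "(a, c) \<in> set fs" "(lo, hi) \<in> set Is" using j Js(1,2) r I nth_mem[of j fs] nth_mem[of j Js] by auto
      obtain v where v: "affine_form (a, c) x = of_int v" using affine_form_of_int x by blast
      obtain w where w: "affine_form (a, c) y = of_int w" using affine_form_of_int y by blast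
      have test: "of_int lo' \<le> affine_form (a, c) x \<longleftrightarrow> of_int lo' \<le> affine_form (a, c) y"
        if "(lo', hi') \<in> set Is" for lo' hi'
      proof -
        have "(a, c - lo') \<in> X" unfolding X_def using mem that by force
        then have "affine_form (a, c - lo') x \<ge> 0 \<longleftrightarrow> affine_form (a, c - lo') y \<ge> 0"
          using xy unfolding sign_pattern_def by blast
        then show ?thesis by (simp add: affine_form_def algebra_simps)
      qed
      have vI: "lo \<le> v" "v \<le> hi" using x j Js(3) r I v by auto
      \<comment> \<open>By covering, the value at \<open>y\<close> has an interval of its own.
        Comparing it with the interval of \<open>x\<close> recovers the upper end, about which the
        sign pattern says nothing directly.\<close>
      obtain lo' hi' where J: "(lo', hi') \<in> set Is" "in_interval (lo', hi') (affine_form (a, c) y)"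
        using cover[OF y mem(1)] by auto
      then have wJ: "lo' \<le> w" "w \<le> hi'" using w by auto
      have "lo \<le> w" using test[OF mem(2)] vI(1) v w by simp
      have "lo' \<le> v" using test[OF J(1)] wJ(1) v w by simp
      have "(lo, hi) = (lo', hi') \<or> disjoint_intervals (lo, hi) (lo', hi') \<or> disjoint_intervals (lo', hi') (lo, hi)"
        using disj mem(2) J(1) unfolding sorted_wrt_iff_nth_less in_set_conv_nth
        by (metis linorder_neqE_nat)
      then have "w \<le> hi"
      proof
        assume "(lo, hi) = (lo', hi')"
        then show ?thesis using wJ by simp
      next
        assume "disjoint_intervals (lo, hi) (lo', hi') \<or> disjoint_intervals (lo', hi') (lo, hi)"
        \<comment> \<open>Since \<open>lo' \<le> v\<close>, disjointness gives
          \<open>v > hi'\<close>, whence \<open>w \<le> hi' < v \<le> hi\<close>.\<close>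
        then have "\<not> (lo \<le> u \<and> u \<le> hi \<and> lo' \<le> u \<and> u \<le> hi')" for u
          unfolding disjoint_intervals_def in_interval.simps of_int_le_iff by blast
        from this[of v] this[of w] show ?thesis using vI wJ \<open>lo \<le> w\<close> \<open>lo' \<le> v\<close> by linarith
      qed
      then show ?thesis using \<open>lo \<le> w\<close> r I w by simp
    qed
    then show ?thesis unfolding Js(3) using y by auto
  qed
  have "inj_on (\<lambda>k. sign_pattern X (pt k)) {..<length ?Cs}"
  proof (rule inj_onI, rule ccontr)
    fix k l assume kl: "k \<in> {..<length ?Cs}" "l \<in> {..<length ?Cs}"
      "sign_pattern X (pt k) = sign_pattern X (pt l)" "k \<noteq> l"
    have sub: "pt m \<in> polyhedron_of rs \<inter> int_points" if "m < length ?Cs" for m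
      using pt[OF that] cells_subset[of "?Cs ! m" Is rs fs] that by auto
    have "pt l \<in> polyhedron_of (?Cs ! k)" "pt k \<in> polyhedron_of (?Cs ! l)"
      using same[of "?Cs ! k" "pt k" "pt l"] same[of "?Cs ! l" "pt l" "pt k"] pt sub kl by auto
    then have "pt l \<in> polyhedron_of (?Cs ! k) \<inter> polyhedron_of (?Cs ! l) \<inter> int_points"
      "pt k \<in> polyhedron_of (?Cs ! l) \<inter> polyhedron_of (?Cs ! k) \<inter> int_points"
      using pt kl by auto
    moreover have "k < l \<or> l < k" using kl by linarith
    ultimately show False
      using cells_disjoint[OF disj, of rs fs] kl unfolding sorted_wrt_iff_nth_less by auto
  qed
  then have "length ?Cs = card ((\<lambda>k. sign_pattern X (pt k)) ` {..<length ?Cs})" by (simp add: card_image)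
  also have "\<dots> \<le> card (sign_pattern X ` UNIV)"
  proof (rule card_mono)
    show "finite (sign_pattern X ` UNIV)"
      by (rule finite_subset[of _ "Pow X"]) (use finX in \<open>auto simp: sign_pattern_def\<close>)
  qed auto
  also have "\<dots> \<le> (card X + 1) ^ CARD('n)" by (rule card_sign_patterns[OF finX])
  also have "\<dots> \<le> (length fs * length Is + 1) ^ CARD('n)" using X by (intro power_mono) auto
  finally show ?thesis .
qed

text \<open>All forms are cut with the common \<open>\<delta>\<close>, while \<open>s\<close> has
  its own \<open>\<zeta>\<close>. Slicing is applied with accuracy
  \<open>\<zeta> * \<delta>\<close>, which divided by \<open>\<zeta>\<close> is
  \<open>\<delta>\<close>; as \<open>s\<close> is nonnegative, a larger accuracy \<open>e\<close>
  only weakens the conclusion.\<close>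

lemma cell_slicing:
  assumes AB: "0 < B" "B \<le> A" and \<delta>: "1 + \<delta> = real_of_int A / real_of_int B" "\<delta> > 0"
    and C: "C \<in> set (cells (slabs A B m) rs fs)"
    and prm: "slicing_parameters s (polyhedron_of rs) (cs, \<zeta>)" "set cs \<subseteq> set fs" "real \<zeta> * \<delta> \<le> e"
    and pos: "\<And>x. x \<in> polyhedron_of rs \<Longrightarrow> s x \<ge> 0"
    and xy: "x \<in> polyhedron_of C \<inter> int_points" "y \<in> polyhedron_of C \<inter> int_points"
  shows "s x \<le> (1 + e) * s y"
proof -
  obtain Js where Js: "length Js = length fs" "set Js \<subseteq> set (slabs A B m)"
    "polyhedron_of C = polyhedron_of rs \<inter> {x. \<forall>j<length fs. in_interval (Js ! j) (affine_form (fs ! j) x)}"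
    using cells_exact[OF C] by blast
  have "\<exists>k. \<forall>z\<in>polyhedron_of C \<inter> int_points. in_slice \<delta> k (affine_form r z)" if r: "r \<in> set fs" for r
  proof -
    obtain j where j: "j < length fs" "fs ! j = r" using r by (auto simp: in_set_conv_nth)
    have "Js ! j \<in> set (slabs A B m)" using j Js(1,2) by auto
    then obtain k where k: "\<forall>v :: int. in_interval (Js ! j) (of_int v) \<longrightarrow> in_slice \<delta> k (of_int v)"
      using slabs_in_slice[OF AB _ \<delta>(1)] by blast
    have "in_slice \<delta> k (affine_form r z)" if z: "z \<in> polyhedron_of C \<inter> int_points" for z
    proof -
      obtain v where v: "affine_form r z = of_int v" using affine_form_of_int[of z r] z by auto
      have "in_interval (Js ! j) (affine_form r z)" using z j Js(3) by auto
      then show ?thesis using k v by simp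
    qed
    then show ?thesis by blast
  qed
  \<comment> \<open>The slice index is attached to the form itself, so it can be read off for the
    entries of \<open>cs\<close> wherever they stand in \<open>fs\<close>.\<close>
  then obtain \<kappa> where \<kappa>: "\<And>r z. r \<in> set fs \<Longrightarrow> z \<in> polyhedron_of C \<inter> int_points \<Longrightarrow> in_slice \<delta> (\<kappa> r) (affine_form r z)"
    by metis
  have \<zeta>: "\<zeta> \<ge> 1" using prm(1) by (simp add: slicing_parameters_def)
  have "z \<in> slice cs (\<lambda>j. \<kappa> (cs ! j)) ((real \<zeta> * \<delta>) / real \<zeta>)" if "z \<in> polyhedron_of C \<inter> int_points" for z
    unfolding mem_slice_iff
  proof (intro allI impI)
    fix j assume "j < length cs"
    then have "cs ! j \<in> set fs" using prm(2) nth_mem by blast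
    from \<kappa>[OF this that] show "in_slice ((real \<zeta> * \<delta>) / real \<zeta>) (\<kappa> (cs ! j)) (affine_form (cs ! j) z)"
      using \<zeta> by simp
  qed
  moreover have "real \<zeta> * \<delta> > 0" using \<zeta> \<delta>(2) by simp
  ultimately have "s x \<le> (1 + real \<zeta> * \<delta>) * s y"
    using prm(1) xy Js(3) unfolding slicing_parameters_def by blast
  also have "\<dots> \<le> (1 + e) * s y" using prm(3) pos[of y] xy Js(3) by (intro mult_right_mono) auto
  finally show ?thesis .
qed


section \<open>Approximation on a cell\<close>

text \<open>The three cases of an approximate solution as a relation between values alone, so that a
  point of a cell can be judged against the optimum over the polytope.\<close>

definition approx_min :: "real \<Rightarrow> real \<Rightarrow> real \<Rightarrow> bool" where
  "approx_min \<epsilon> v m \<longleftrightarrow> m > 0 \<and> v \<le> (1 + \<epsilon>) * m \<or> m < 0 \<and> v \<le> 1 / (1 + \<epsilon>) * m \<or> m = 0 \<and> v = m"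

lemma eps_approx_iff:
  "eps_approx f P \<epsilon> x \<longleftrightarrow> x \<in> P \<inter> int_points \<and>
     (\<exists>w. is_arg_min f (\<lambda>y. y \<in> P \<inter> int_points) w \<and> approx_min \<epsilon> (f x) (f w))"
  by (simp add: eps_approx_def approx_min_def)

lemma approx_min_better: "approx_min \<epsilon> v m \<Longrightarrow> m \<le> v' \<Longrightarrow> v' \<le> v \<Longrightarrow> approx_min \<epsilon> v' m"
  unfolding approx_min_def by auto

text \<open>Passing from \<open>F\<close> to \<open>h\<close> and back costs a factor
  \<open>1 + e\<close> each, and the scheme for \<open>h\<close> a third, hence the cube. Here
  \<open>u\<close> minimizes \<open>F\<close> and \<open>w\<close> minimizes \<open>h\<close> on the
  cell, and \<open>z\<close> is the output of the scheme.\<close>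

lemma approx_min_cell:
  fixes g s :: "'j \<Rightarrow> 'a \<Rightarrow> real"
  assumes fin: "finite J" and e: "e > 0" "(1 + e) ^ 3 \<le> 1 + \<epsilon>"
    and F: "\<And>x. F x = (\<Sum>j\<in>J. g j x * s j x)" and h: "\<And>x. h x = (\<Sum>j\<in>J. g j x * s j y)"
    and ratio: "\<And>j x x'. j \<in> J \<Longrightarrow> x \<in> C \<Longrightarrow> x' \<in> C \<Longrightarrow> s j x \<le> (1 + e) * s j x'"
    and pos: "\<And>j x. j \<in> J \<Longrightarrow> x \<in> C \<Longrightarrow> s j x \<ge> 0"
    and sign: "\<And>j k x. j \<in> J \<Longrightarrow> k \<in> J \<Longrightarrow> x \<in> C \<Longrightarrow> sgn (g j x) = sgn (g k x)"
    and y: "y \<in> C" "\<exists>j\<in>J. s j y > 0"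
    and u: "u \<in> C" "\<And>x. x \<in> C \<Longrightarrow> F u \<le> F x"
    and z: "z \<in> C" "is_arg_min h (\<lambda>x. x \<in> C) w" "approx_min e (h z) (h w)"
  shows "approx_min \<epsilon> (F z) (F u)"
proof -
  obtain i where i: "i \<in> J" "s i y > 0" using y by blast
  \<comment> \<open>A zero of \<open>s i\<close> in the cell would force
    \<open>s i y \<le> 0\<close>.\<close>
  have si: "s i x > 0" if "x \<in> C" for x
  proof (rule ccontr)
    assume "\<not> s i x > 0"
    then have "s i x = 0" using pos[OF i(1) that] by simp
    then show False using ratio[OF i(1) y(1) that] i(2) by simp
  qed
  \<comment> \<open>At a fixed \<open>x\<close> all \<open>g j x\<close> have the same sign, so the
    estimates for the \<open>s j\<close> add up termwise. Unless the \<open>g j x\<close> vanish,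
    the summand \<open>i\<close> keeps both sums away from 0.\<close>
  have key: "h x > 0 \<and> F x > 0 \<and> F x \<le> (1 + e) * h x \<and> h x \<le> (1 + e) * F x \<or>
     h x < 0 \<and> F x < 0 \<and> (1 + e) * h x \<le> F x \<and> (1 + e) * F x \<le> h x \<or> h x = 0 \<and> F x = 0"
    if x: "x \<in> C" for x
  proof -
    consider "g i x > 0" | "g i x < 0" | "g i x = 0" by linarith
    then show ?thesis
    proof cases
      case 1
      then have g: "g j x > 0" if "j \<in> J" for j using sign[OF that i(1) x] by (simp add: sgn_1_pos)
      have "F x \<le> (\<Sum>j\<in>J. (1 + e) * (g j x * s j y))" unfolding F
      proof (rule sum_mono)
        fix j assume j: "j \<in> J"
        have "g j x * s j x \<le> g j x * ((1 + e) * s j y)"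
          using g[OF j] ratio[OF j x y(1)] by (intro mult_left_mono) auto
        then show "g j x * s j x \<le> (1 + e) * (g j x * s j y)" by (simp add: algebra_simps)
      qed
      moreover have "h x \<le> (\<Sum>j\<in>J. (1 + e) * (g j x * s j x))" unfolding h
      proof (rule sum_mono)
        fix j assume j: "j \<in> J"
        have "g j x * s j y \<le> g j x * ((1 + e) * s j x)"
          using g[OF j] ratio[OF j y(1) x] by (intro mult_left_mono) auto
        then show "g j x * s j y \<le> (1 + e) * (g j x * s j x)" by (simp add: algebra_simps)
      qed
      moreover have "F x > 0" unfolding F
        by (rule sum_pos2[OF fin i(1)]) (use g i si[OF x] pos[OF _ x] in \<open>auto simp: less_imp_le\<close>)
      moreover have "h x > 0" unfolding h
        by (rule sum_pos2[OF fin i(1)]) (use g i pos[OF _ y(1)] in \<open>auto simp: less_imp_le\<close>)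
      ultimately show ?thesis by (simp add: F h sum_distrib_left)
    next
      case 2
      then have g: "g j x < 0" if "j \<in> J" for j using sign[OF that i(1) x] by (simp add: sgn_1_neg)
      have "F x \<ge> (\<Sum>j\<in>J. (1 + e) * (g j x * s j y))" unfolding F
      proof (rule sum_mono)
        fix j assume j: "j \<in> J"
        have "g j x * s j x \<ge> g j x * ((1 + e) * s j y)"
          using g[OF j] ratio[OF j x y(1)] by (intro mult_left_mono_neg) auto
        then show "g j x * s j x \<ge> (1 + e) * (g j x * s j y)" by (simp add: algebra_simps)
      qed
      moreover have "h x \<ge> (\<Sum>j\<in>J. (1 + e) * (g j x * s j x))" unfolding h
      proof (rule sum_mono)
        fix j assume j: "j \<in> J"
        have "g j x * s j y \<ge> g j x * ((1 + e) * s j x)"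
          using g[OF j] ratio[OF j y(1) x] by (intro mult_left_mono_neg) auto
        then show "g j x * s j y \<ge> (1 + e) * (g j x * s j x)" by (simp add: algebra_simps)
      qed
      moreover have "(\<Sum>j\<in>J. - (g j x * s j x)) > 0"
      proof (rule sum_pos2[OF fin i(1)])
        show "- (g i x * s i x) > 0" using mult_neg_pos[OF g[OF i(1)] si[OF x]] by simp
        show "- (g j x * s j x) \<ge> 0" if "j \<in> J" for j
          using mult_nonpos_nonneg[OF less_imp_le[OF g[OF that]] pos[OF that x]] by simp
      qed
      then have "F x < 0" by (simp add: F sum_negf)
      moreover have "(\<Sum>j\<in>J. - (g j x * s j y)) > 0"
      proof (rule sum_pos2[OF fin i(1)])
        show "- (g i x * s i y) > 0" using mult_neg_pos[OF g[OF i(1)] i(2)] by simp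
        show "- (g j x * s j y) \<ge> 0" if "j \<in> J" for j
          using mult_nonpos_nonneg[OF less_imp_le[OF g[OF that]] pos[OF that y(1)]] by simp
      qed
      then have "h x < 0" by (simp add: h sum_negf)
      ultimately show ?thesis by (simp add: F h sum_distrib_left)
    next
      case 3
      then have "g j x = 0" if "j \<in> J" for j using sign[OF that i(1) x] by (simp add: sgn_0_0)
      then show ?thesis by (simp add: F h)
    qed
  qed
  have w: "w \<in> C" "\<And>x. x \<in> C \<Longrightarrow> h w \<le> h x" using z(2) by (auto simp: is_arg_min_linorder)
  consider "F u > 0" | "F u < 0" | "F u = 0" by linarith
  then show ?thesis
  proof cases
    case 1
    have hw: "h w > 0" using key[OF w(1)] u(2)[OF w(1)] 1 by linarith
    have hz: "h z \<le> (1 + e) * h w" using z(3) hw by (auto simp: approx_min_def)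
    have "F z \<le> (1 + e) * h z" using key[OF z(1)] u(2)[OF z(1)] 1 by linarith
    also have "\<dots> \<le> (1 + e) * ((1 + e) * h w)" using hz e by simp
    also have "\<dots> \<le> (1 + e) * ((1 + e) * h u)" using w(2)[OF u(1)] e by simp
    also have "\<dots> \<le> (1 + e) * ((1 + e) * ((1 + e) * F u))"
      using key[OF u(1)] 1 e by (intro mult_left_mono) auto
    also have "\<dots> = (1 + e) ^ 3 * F u" by (simp add: power3_eq_cube)
    also have "\<dots> \<le> (1 + \<epsilon>) * F u" using e 1 by (intro mult_right_mono) auto
    finally show ?thesis using 1 by (simp add: approx_min_def)
  next
    case 2
    have hu: "h u < 0" "(1 + e) * h u \<le> F u" using key[OF u(1)] 2 by auto
    have hw: "h w < 0" using w(2)[OF u(1)] hu by simp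
    then have hz: "(1 + e) * h z \<le> h w" using z(3) e by (auto simp: approx_min_def field_simps)
    have "(1 + e) * h z < 0" using hz hw by simp
    then have "h z < 0" using e by (simp add: mult_less_0_iff)
    then have Fz: "(1 + e) * F z \<le> h z" using key[OF z(1)] by linarith
    \<comment> \<open>The factors stand with \<open>F z\<close>, since for negative values the loss
      in each step is a factor \<open>1 / (1 + e)\<close>.\<close>
    have "(1 + e) ^ 3 * F z = (1 + e) * ((1 + e) * ((1 + e) * F z))" by (simp add: power3_eq_cube)
    also have "\<dots> \<le> (1 + e) * ((1 + e) * h z)" using Fz e by simp
    also have "\<dots> \<le> (1 + e) * h w" using hz e by simp
    also have "\<dots> \<le> (1 + e) * h u" using w(2)[OF u(1)] e by simp
    also have "\<dots> \<le> F u" by (rule hu(2))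
    finally have *: "(1 + e) ^ 3 * F z \<le> F u" .
    have Fz0: "F z < 0" using key[OF z(1)] \<open>h z < 0\<close> by linarith
    have "(1 + \<epsilon>) * F z \<le> (1 + e) ^ 3 * F z" using e Fz0 by (intro mult_right_mono_neg) auto
    then have "(1 + \<epsilon>) * F z \<le> F u" using * by linarith
    moreover have "1 + \<epsilon> > 0" using e by (smt (verit) zero_less_power)
    ultimately have "F z \<le> 1 / (1 + \<epsilon>) * F u" by (simp add: field_simps)
    then show ?thesis using 2 by (simp add: approx_min_def)
  next
    case 3
    have "h w = 0" using key[OF u(1)] key[OF w(1)] u(2)[OF w(1)] w(2)[OF u(1)] 3 by linarith
    then have "h z = 0" using z(3) by (auto simp: approx_min_def)
    then have "F z = 0" using key[OF z(1)] by linarith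
    then show ?thesis using 3 by (simp add: approx_min_def)
  qed
qed


section \<open>Encodings of rows, intervals and summands\<close>

definition enc_row :: "'n::finite row \<Rightarrow> val" where
  "enc_row r = VList [enc_vec (fst r), VInt (snd r)]"

definition enc_interval :: "int \<times> int \<Rightarrow> val" where
  "enc_interval I = VList [VInt (fst I), VInt (snd I)]"

definition enc_summand :: "'n::finite summand \<Rightarrow> val" where
  "enc_summand t = VList [fst t, enc_slicing (snd (snd t))]"

definition enc_term :: "real \<times> val \<Rightarrow> val" where
  "enc_term t = VList [VNum (fst t), snd t]"

lemma enc_rows_eq: "enc_rows rs = VList (map enc_row rs)"
  by (simp add: enc_rows_def enc_row_def case_prod_beta')

lemma enc_instance_eq: "enc_instance ts rs = VList [VList (map enc_summand ts), enc_rows rs]"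
  by (simp add: enc_instance_def enc_summand_def case_prod_beta')

lemma poly_comp_row_vec:
  "poly_comp \<sigma> I orc S E (\<lambda>i. enc_row (r i)) \<Longrightarrow> poly_comp \<sigma> I orc S E (\<lambda>i. enc_vec (fst (r i)))"
  unfolding enc_row_def by (rule poly_comp_hd)

lemma poly_comp_row_const:
  "poly_comp \<sigma> I orc S E (\<lambda>i. enc_row (r i)) \<Longrightarrow> poly_comp \<sigma> I orc S E (\<lambda>i. VInt (snd (r i)))"
  unfolding enc_row_def by (rule poly_comp_hd[OF poly_comp_tl])

lemma poly_comp_row:
  assumes "poly_comp \<sigma> I orc S E (\<lambda>i. enc_vec (a i))" and "poly_comp \<sigma> I orc S E (\<lambda>i. VInt (c i))"
  shows "poly_comp \<sigma> I orc S E (\<lambda>i. enc_row (a i, c i))"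
  unfolding enc_row_def fst_conv snd_conv by (intro poly_comp_Cons poly_comp_Nil assms)

lemma poly_comp_interval_lo:
  "poly_comp \<sigma> I orc S E (\<lambda>i. enc_interval (r i)) \<Longrightarrow> poly_comp \<sigma> I orc S E (\<lambda>i. VInt (fst (r i)))"
  unfolding enc_interval_def by (rule poly_comp_hd)

lemma poly_comp_interval_hi:
  "poly_comp \<sigma> I orc S E (\<lambda>i. enc_interval (r i)) \<Longrightarrow> poly_comp \<sigma> I orc S E (\<lambda>i. VInt (snd (r i)))"
  unfolding enc_interval_def by (rule poly_comp_hd[OF poly_comp_tl])

lemma poly_comp_interval:
  assumes "poly_comp \<sigma> I orc S E (\<lambda>i. VInt (a i))" and "poly_comp \<sigma> I orc S E (\<lambda>i. VInt (c i))"
  shows "poly_comp \<sigma> I orc S E (\<lambda>i. enc_interval (a i, c i))"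
  unfolding enc_interval_def fst_conv snd_conv by (intro poly_comp_Cons poly_comp_Nil assms)

lemma poly_comp_summand_enc:
  "poly_comp \<sigma> I orc S E (\<lambda>i. enc_summand (t i)) \<Longrightarrow> poly_comp \<sigma> I orc S E (\<lambda>i. fst (t i))"
  unfolding enc_summand_def by (rule poly_comp_hd)

lemma poly_comp_summand_forms:
  "poly_comp \<sigma> I orc S E (\<lambda>i. enc_summand (t i)) \<Longrightarrow>
   poly_comp \<sigma> I orc S E (\<lambda>i. VList (map enc_row (fst (snd (snd (t i))))))"
  unfolding enc_summand_def enc_slicing_def enc_rows_eq by (rule poly_comp_hd[OF poly_comp_hd[OF poly_comp_tl]])

lemma poly_comp_summand_zeta:
  "poly_comp \<sigma> I orc S E (\<lambda>i. enc_summand (t i)) \<Longrightarrow>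
   poly_comp \<sigma> I orc S E (\<lambda>i. VList (replicate (snd (snd (snd (t i)))) (VList [])))"
  unfolding enc_summand_def enc_slicing_def
  by (rule poly_comp_hd[OF poly_comp_tl[OF poly_comp_hd[OF poly_comp_tl]]])

lemma poly_comp_uminus_vec:
  assumes "poly_comp \<sigma> I orc S E (\<lambda>i. enc_vec (a i))"
  shows "poly_comp \<sigma> I orc S E (\<lambda>i. enc_vec (- a i))"
proof -
  have "poly_comp \<sigma> I orc S E (\<lambda>i. VList (map (\<lambda>k. VInt (- (a i $ k))) coords))"
    by (rule poly_comp_map[where ey = "\<lambda>i k. VInt (a i $ k)"])
       (use assms in \<open>auto simp: enc_vec_def intro: poly_comp_uminus poly_comp_head\<close>)
  then show ?thesis by (simp add: enc_vec_def)
qed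

lemma poly_comp_slab_rows:
  assumes r: "poly_comp \<sigma> I orc S E (\<lambda>i. enc_row (r i))" and J: "poly_comp \<sigma> I orc S E (\<lambda>i. enc_interval (J i))"
    and C: "poly_comp \<sigma> I orc S E (\<lambda>i. enc_rows (C i))"
  shows "poly_comp \<sigma> I orc S E (\<lambda>i. enc_rows (slab_rows (r i) (J i) @ C i))"
proof -
  have "poly_comp \<sigma> I orc S E (\<lambda>i. VList (enc_row (fst (r i), snd (J i) - snd (r i)) #
      enc_row (- fst (r i), snd (r i) - fst (J i)) # map enc_row (C i)))"
    by (intro poly_comp_Cons poly_comp_row poly_comp_uminus_vec poly_comp_diff poly_comp_row_vec[OF r]
        poly_comp_row_const[OF r] poly_comp_interval_lo[OF J] poly_comp_interval_hi[OF J] C[unfolded enc_rows_eq])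
  moreover have "enc_rows (slab_rows (r i) (J i) @ C i) = VList (enc_row (fst (r i), snd (J i) - snd (r i)) #
      enc_row (- fst (r i), snd (r i) - fst (J i)) # map enc_row (C i))" for i
    by (cases "r i"; cases "J i") (simp add: enc_rows_eq)
  ultimately show ?thesis by simp
qed

lemma vsize_VInt_power: "vsize \<sigma> (VInt (a ^ k)) \<le> 2 + k * vsize \<sigma> (VInt a)"
proof (induction k)
  case 0
  then show ?case using vsize_VInt_le[of 1 1 \<sigma>] by simp
next
  case (Suc k)
  then show ?case using vsize_VInt_mult[of \<sigma> a "a ^ k"] by (simp del: vsize.simps)
qed

lemma vsize_slabs:
  assumes "0 < B" and "B \<le> A"
  shows "vsize \<sigma> (VList (map enc_interval (slabs A B k))) \<le> 1 + (2 * k + 3) * (9 + 2 * k * vsize \<sigma> (VInt A))"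
proof -
  have e: "1 \<le> A ^ k div B ^ k" "A ^ k div B ^ k \<le> A ^ k"
    using div_power_ge_1[OF assms, of k] abs_div_le[of "A ^ k" "B ^ k"] assms by auto
  \<comment> \<open>The summand 1 is for the lower ends of empty intervals, which exceed the upper
    end by 1.\<close>
  have bnd: "\<bar>fst I\<bar> \<le> A ^ k div B ^ k + 1 \<and> \<bar>snd I\<bar> \<le> A ^ k div B ^ k + 1" if "I \<in> set (slabs A B k)" for I
    using that
  proof (induction k)
    case (Suc k)
    then show ?case
      using div_power_mono[OF assms, of k] div_power_ge_1[OF assms, of k] by (fastforce simp del: power_Suc)
  qed auto
  have sz: "vsize \<sigma> (VInt x) \<le> 4 + k * vsize \<sigma> (VInt A)" if "\<bar>x\<bar> \<le> A ^ k div B ^ k + 1" for x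
  proof -
    have "vsize \<sigma> (VInt x) \<le> vsize \<sigma> (VInt (A ^ k + 1))" using that e by (intro vsize_VInt_mono) auto
    also have "\<dots> \<le> vsize \<sigma> (VInt (A ^ k)) + vsize \<sigma> (VInt 1)" by (rule vsize_VInt_add)
    also have "\<dots> \<le> 4 + k * vsize \<sigma> (VInt A)"
      using vsize_VInt_power[of \<sigma> A k] vsize_VInt_le[of 1 1 \<sigma>] by (simp del: vsize.simps)
    finally show ?thesis .
  qed
  have "vsize \<sigma> (VList (map enc_interval (slabs A B k))) \<le>
      1 + length (map enc_interval (slabs A B k)) * (9 + 2 * k * vsize \<sigma> (VInt A))"
  proof (rule vsize_VList_le)
    fix x assume "x \<in> set (map enc_interval (slabs A B k))"
    then obtain I where I: "I \<in> set (slabs A B k)" "x = enc_interval I" by auto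
    show "vsize \<sigma> x \<le> 9 + 2 * k * vsize \<sigma> (VInt A)"
      using sz[of "fst I"] sz[of "snd I"] bnd[OF I(1)] I(2) by (simp add: enc_interval_def)
  qed
  then show ?thesis by (simp add: length_slabs)
qed

lemma vsize_enc_vec_minus: "vsize \<sigma> (enc_vec (- a)) = vsize \<sigma> (enc_vec a)"
  by (simp add: enc_vec_def o_def)

lemma vsize_slab_rows:
  assumes "r \<in> set fs" and "I \<in> set Is"
  shows "vsize \<sigma> (enc_rows (slab_rows r I @ C)) \<le>
    vsize \<sigma> (enc_rows C) + (2 * vsize \<sigma> (enc_rows fs) + 2 * vsize \<sigma> (VList (map enc_interval Is)))"
proof -
  obtain a c where r: "r = (a, c)" by (cases r)
  obtain lo hi where I: "I = (lo, hi)" by (cases I)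
  have "vsize \<sigma> (enc_row (a, c)) \<le> vsize \<sigma> (enc_rows fs)"
    unfolding enc_rows_eq by (rule vsize_nth_le) (use assms r in auto)
  moreover have "vsize \<sigma> (enc_interval (lo, hi)) \<le> vsize \<sigma> (VList (map enc_interval Is))"
    by (rule vsize_nth_le) (use assms I in auto)
  ultimately show ?thesis
    using vsize_VInt_diff[of \<sigma> hi c] vsize_VInt_diff[of \<sigma> c lo] vsize_enc_vec_minus[of \<sigma> a]
    unfolding r I enc_rows_eq by (simp add: enc_row_def enc_interval_def)
qed

text \<open>Each form adds two rows whose size is bounded by the input, so cells grow additively.
  The increment refers to the full list \<open>fs'\<close>, which makes it the same for every prefix
  \<open>fs\<close>.\<close>

lemma vsize_cells:
  assumes "C \<in> set (cells Is rs fs)" and "set fs \<subseteq> set fs'"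
  shows "vsize \<sigma> (enc_rows C) \<le> vsize \<sigma> (enc_rows rs) +
    length fs * (2 * vsize \<sigma> (enc_rows fs') + 2 * vsize \<sigma> (VList (map enc_interval Is)))"
  using assms
proof (induction fs arbitrary: C rule: rev_induct)
  case Nil
  then show ?case by (auto simp: cells_def split: if_splits)
next
  case (snoc r fs)
  then obtain D I where D: "D \<in> set (cells Is rs fs)" "I \<in> set Is" "C = slab_rows r I @ D"
    unfolding cells_snoc refine_def by auto
  show ?case using snoc.IH[OF D(1)] vsize_slab_rows[of r fs' I Is \<sigma> D] snoc.prems D by simp
qed


section \<open>The algorithm\<close>

text \<open>The indices of the algorithm's families. Besides the encoded input an instance carries
  the functions \<open>s_j\<close> and the oracle, which programs reach only through
  queries.\<close>

record ('n::finite) inst =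
  summands :: "'n summand list"
  rows_of :: "'n row list"
  answers :: oracle_fun
  eps_num :: int
  eps_den :: int

definition forms :: "'n::finite inst \<Rightarrow> 'n row list" where
  "forms i = concat (map (\<lambda>t. fst (snd (snd t))) (summands i))"

text \<open>A sum in place of a maximum: it bounds the \<open>\<zeta>\<close> of every summand and
  is the length of the concatenated unary codes.\<close>

definition zeta :: "'n::finite inst \<Rightarrow> nat" where
  "zeta i = sum_list (map (\<lambda>t. snd (snd (snd t))) (summands i))"

text \<open>With \<open>\<epsilon> = p / q\<close> and \<open>\<epsilon>' = p / (7 (p + q))\<close> one has \<open>(1 + \<epsilon>')\<^sup>3 \<le> 1 + \<epsilon>\<close>. All functions are
  sliced with the common parameter \<open>\<delta> = \<epsilon>' / zeta\<close>, where \<open>1 + \<delta> = ratio_num / ratio_den\<close>.\<close>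

definition fine_den :: "'n::finite inst \<Rightarrow> int" where
  "fine_den i = 7 * (eps_num i + eps_den i)"

definition ratio_den :: "'n::finite inst \<Rightarrow> int" where
  "ratio_den i = fine_den i * int (zeta i)"

definition ratio_num :: "'n::finite inst \<Rightarrow> int" where
  "ratio_num i = eps_num i + ratio_den i"

text \<open>For integers \<open>\<bar>x\<bar> \<le> x * x\<close>, so the sum of the squares bounds
  all entries at once without a case distinction on signs.\<close>

definition square_entries :: "'n::finite row \<Rightarrow> int list" where
  "square_entries r = snd r * snd r # map (\<lambda>k. fst r $ k * fst r $ k) coords"

definition entry_bound :: "'n::finite inst \<Rightarrow> int" where
  "entry_bound i = 1 + sum_list (concat (map square_entries (forms i @ rows_of i)))"

definition value_bound :: "'n::finite inst \<Rightarrow> int" where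
  "value_bound i = (int CARD('n) * fact CARD('n) + 1) * entry_bound i ^ (CARD('n) + 1)"

text \<open>The first exponent at which the cuts reach the bound for the values;
  \<open>step_bound\<close> shows that there is one. The loop finds it by testing.\<close>

definition steps :: "'n::finite inst \<Rightarrow> nat" where
  "steps i = (LEAST k. value_bound i \<le> ratio_num i ^ k div ratio_den i ^ k)"

definition intervals :: "'n::finite inst \<Rightarrow> (int \<times> int) list" where
  "intervals i = slabs (ratio_num i) (ratio_den i) (steps i)"

definition final_cells :: "'n::finite inst \<Rightarrow> 'n row list list" where
  "final_cells i = cells (intervals i) (rows_of i) (forms i)"

definition inst_env :: "'n::finite inst \<Rightarrow> val list" where
  "inst_env i = [VInt (eps_num i), VInt (eps_den i), enc_instance (summands i) (rows_of i)]"

text \<open>The rounded-up \<open>1 / \<epsilon>\<close> is part of the size, as running times are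
  to be polynomial in it.\<close>

definition inst_size :: "(real \<Rightarrow> nat) \<Rightarrow> 'n::finite inst \<Rightarrow> nat" where
  "inst_size \<sigma> i = nat \<lceil>real_of_int (eps_den i) / real_of_int (eps_num i)\<rceil> + vsize \<sigma> (VList (inst_env i))"

lemma coords_set: "set (coords :: 'n::finite list) = UNIV"
proof -
  have "\<exists>xs :: 'n list. distinct xs \<and> set xs = UNIV"
    using finite_distinct_list[of "UNIV :: 'n set"] by auto
  from someI_ex[OF this] show ?thesis unfolding coords_def by simp
qed

lemma abs_le_square: "\<bar>x\<bar> \<le> x * x" for x :: int
proof (cases "x = 0")
  case False
  then have "\<bar>x\<bar> * 1 \<le> \<bar>x\<bar> * \<bar>x\<bar>" by (intro mult_left_mono) auto
  then show ?thesis by simp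
qed simp

lemma entry_bound:
  assumes "r \<in> set (forms i) \<union> set (rows_of i)"
  shows "\<bar>fst r $ k\<bar> \<le> entry_bound i" and "\<bar>snd r\<bar> \<le> entry_bound i"
proof -
  let ?xs = "concat (map square_entries (forms i @ rows_of i))"
  have nn: "0 \<le> x" if "x \<in> set ?xs" for x using that by (auto simp: square_entries_def)
  have mem: "fst r $ k * fst r $ k \<in> set ?xs" "snd r * snd r \<in> set ?xs"
    using assms by (auto simp: square_entries_def coords_set)
  from member_le_sum_list[OF mem(1) nn] member_le_sum_list[OF mem(2) nn] show "\<bar>fst r $ k\<bar> \<le> entry_bound i" "\<bar>snd r\<bar> \<le> entry_bound i"
    unfolding entry_bound_def using abs_le_square[of "fst r $ k"] abs_le_square[of "snd r"] by linarith+
qed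

lemma entry_bound_ge_1: "entry_bound i \<ge> 1"
proof -
  have "0 \<le> sum_list (concat (map square_entries (forms i @ rows_of i)))"
    by (rule sum_list_nonneg) (auto simp: square_entries_def)
  then show ?thesis by (simp add: entry_bound_def)
qed

text \<open>For basic functions it is only assumed that suitable outputs exist. Here they are named
  by the functions \<open>basic_out\<close> and \<open>conic_out\<close>, since
  \<open>poly_comp\<close> speaks about families of definite values.\<close>

locale basic_scheme =
  fixes \<P> :: "(real ^ 'n::finite) set set"
    and dec :: "val \<Rightarrow> (real ^ 'n \<Rightarrow> real) option"
    and K :: "real set"
    and \<sigma> :: "real \<Rightarrow> nat"
    and b :: nat
    and basic_prog :: com and basic_out :: "val \<Rightarrow> 'n row list \<Rightarrow> int \<Rightarrow> int \<Rightarrow> val" and basic_deg :: nat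
    and conic_prog :: com and conic_out :: "(real \<times> val) list \<Rightarrow> val" and conic_deg :: nat
  assumes polytopes: "\<And>P. P \<in> \<P> \<Longrightarrow> int_polytope P"
    and closed: "closed_under_subpolytopes \<P>"
    and basic_time: "\<And>u rs p q. u \<in> dom dec \<Longrightarrow> polyhedron_of rs \<in> \<P> \<Longrightarrow> p > 0 \<Longrightarrow> q > 0 \<Longrightarrow>
      \<exists>t. computes \<sigma> no_oracle basic_prog (VList [VInt p, VInt q, VList [u, enc_rows rs]]) t (basic_out u rs p q) \<and>
        real t \<le> real basic_deg * (1 / (real_of_int p / real_of_int q) +
          real (vsize \<sigma> (VList [VInt p, VInt q, VList [u, enc_rows rs]]))) ^ basic_deg"
    and basic_empty: "\<And>u rs p q. u \<in> dom dec \<Longrightarrow> polyhedron_of rs \<in> \<P> \<Longrightarrow> p > 0 \<Longrightarrow> q > 0 \<Longrightarrow>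
      polyhedron_of rs \<inter> int_points = {} \<Longrightarrow> basic_out u rs p q = VInt 0"
    and basic_approx: "\<And>u rs p q. u \<in> dom dec \<Longrightarrow> polyhedron_of rs \<in> \<P> \<Longrightarrow> p > 0 \<Longrightarrow> q > 0 \<Longrightarrow>
      polyhedron_of rs \<inter> int_points \<noteq> {} \<Longrightarrow> \<exists>z. basic_out u rs p q = enc_vec z \<and>
        eps_approx (the (dec u)) (polyhedron_of rs) (real_of_int p / real_of_int q) (real_vec z)"
    and conic: "\<And>us. us \<noteq> [] \<Longrightarrow> \<forall>(r, u) \<in> set us. r \<in> K \<and> r > 0 \<and> u \<in> dom dec \<Longrightarrow>
      (\<exists>t. computes \<sigma> no_oracle conic_prog (VList (map enc_term us)) t (conic_out us) \<and>
         t \<le> conic_deg * vsize \<sigma> (VList (map enc_term us)) ^ conic_deg) \<and>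
      dec (conic_out us) = Some (\<lambda>x. \<Sum>(r, u) \<leftarrow> us. r * the (dec u) x)"
    and sign: "\<And>f g P x. f \<in> ran dec \<Longrightarrow> g \<in> ran dec \<Longrightarrow> P \<in> \<P> \<Longrightarrow> x \<in> P \<Longrightarrow> sgn (f x) = sgn (g x)"
begin

definition insts :: "'n inst set" where
  "insts = {i. eps_num i > 0 \<and> eps_den i > 0 \<and> polyhedron_of (rows_of i) \<in> \<P> \<and> summands i \<noteq> [] \<and>
     (\<forall>(u, s, prm) \<in> set (summands i).
        u \<in> dom dec \<and> s \<in> sliceable_functions \<P> \<and> slicing_parameters s (polyhedron_of (rows_of i)) prm \<and>
        answers_bounded \<sigma> b (enc_instance (summands i) (rows_of i)) (polyhedron_of (rows_of i)) s) \<and>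
     (\<forall>j < length (summands i).
        evaluation_oracle K (answers i) (int j + 1) (\<Union>\<P>) (fst (snd (summands i ! j)))) \<and>
     evaluation_oracle K (answers i) 0 (\<Union>\<P>) (sum_of_products dec (summands i)) \<and>
     answers_bounded \<sigma> b (enc_instance (summands i) (rows_of i)) (polyhedron_of (rows_of i))
       (sum_of_products dec (summands i))}"

section \<open>The parameters of an instance in polynomial time\<close>

abbreviation inst_comp :: "('n inst \<Rightarrow> val) \<Rightarrow> bool" where
  "inst_comp f \<equiv> poly_comp \<sigma> insts answers (inst_size \<sigma>) inst_env f"

lemma inst_env_poly: "poly_env \<sigma> insts (inst_size \<sigma>) inst_env"
  unfolding poly_env_def by (rule poly_bdd_mono[OF poly_bdd_size]) (simp add: inst_size_def)

lemma inst_comp_lift: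
  assumes "inst_comp f" and "\<And>j. j \<in> J \<Longrightarrow> \<pi> j \<in> insts"
  shows "poly_comp \<sigma> J (\<lambda>j. answers (\<pi> j)) (\<lambda>j. inst_size \<sigma> (\<pi> j)) (\<lambda>j. inst_env (\<pi> j)) (\<lambda>j. f (\<pi> j))"
  by (rule poly_comp_reindex[OF assms(1) inst_env_poly]) (use assms(2) in auto)

lemma inst_comp_bdd: "inst_comp f \<Longrightarrow> poly_bdd insts (inst_size \<sigma>) (\<lambda>i. vsize \<sigma> (f i))"
  by (rule poly_comp_vsize[OF _ inst_env_poly])

lemma comp_eps_num: "inst_comp (\<lambda>i. VInt (eps_num i))"
  unfolding inst_env_def by (rule poly_comp_head)

lemma comp_eps_den: "inst_comp (\<lambda>i. VInt (eps_den i))"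
  unfolding inst_env_def by (rule poly_comp_second)

lemma comp_instance: "inst_comp (\<lambda>i. enc_instance (summands i) (rows_of i))"
  unfolding inst_env_def by (rule poly_comp_third)

lemma comp_summands: "inst_comp (\<lambda>i. VList (map enc_summand (summands i)))"
  by (rule poly_comp_hd[OF comp_instance[unfolded enc_instance_eq]])

lemma comp_rows: "inst_comp (\<lambda>i. enc_rows (rows_of i))"
  by (rule poly_comp_hd[OF poly_comp_tl[OF comp_instance[unfolded enc_instance_eq]]])

lemma comp_forms: "inst_comp (\<lambda>i. enc_rows (forms i))"
proof -
  have "inst_comp (\<lambda>i. VList (concat (map (\<lambda>t. map enc_row (fst (snd (snd t)))) (summands i))))"
    by (rule poly_comp_concat_map[OF comp_summands]) (rule poly_comp_summand_forms[OF poly_comp_head])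
  then show ?thesis by (simp add: enc_rows_eq forms_def map_concat o_def)
qed

lemma comp_zeta: "inst_comp (\<lambda>i. VInt (int (zeta i)))"
proof -
  have "inst_comp (\<lambda>i. VList (concat (map (\<lambda>t. replicate (snd (snd (snd t))) (VList [])) (summands i))))"
    by (rule poly_comp_concat_map[OF comp_summands]) (rule poly_comp_summand_zeta[OF poly_comp_head])
  from poly_comp_length[OF this] show ?thesis by (simp add: zeta_def length_concat o_def)
qed

lemma comp_fine_den: "inst_comp (\<lambda>i. VInt (fine_den i))"
  unfolding fine_den_def by (intro poly_comp_mult poly_comp_add poly_comp_int comp_eps_num comp_eps_den)

lemma comp_ratio_den: "inst_comp (\<lambda>i. VInt (ratio_den i))"
  unfolding ratio_den_def by (intro poly_comp_mult comp_fine_den comp_zeta)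

lemma comp_ratio_num: "inst_comp (\<lambda>i. VInt (ratio_num i))"
  unfolding ratio_num_def by (intro poly_comp_add comp_eps_num comp_ratio_den)

lemma comp_entry_bound: "inst_comp (\<lambda>i. VInt (entry_bound i))"
proof -
  have rows: "inst_comp (\<lambda>i. VList (map enc_row (forms i @ rows_of i)))"
    using poly_comp_append[OF comp_forms[unfolded enc_rows_eq] comp_rows[unfolded enc_rows_eq]] by simp
  have "inst_comp (\<lambda>i. VList (concat (map (\<lambda>r. map VInt (square_entries r)) (forms i @ rows_of i))))"
  proof (rule poly_comp_concat_map[OF rows])
    let ?J = "{j. fst j \<in> insts \<and> snd j \<in> set (forms (fst j) @ rows_of (fst j))}"
    let ?E = "\<lambda>j. enc_row (snd j) # inst_env (fst j)"
    have r: "poly_comp \<sigma> ?J (\<lambda>j. answers (fst j)) (\<lambda>j. inst_size \<sigma> (fst j)) ?E (\<lambda>j. enc_row (snd j))"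
      by (rule poly_comp_head)
    have "poly_comp \<sigma> ?J (\<lambda>j. answers (fst j)) (\<lambda>j. inst_size \<sigma> (fst j)) ?E
       (\<lambda>j. VList (map (\<lambda>k. VInt (fst (snd j) $ k * fst (snd j) $ k)) coords))"
      by (rule poly_comp_map[OF poly_comp_row_vec[OF r, unfolded enc_vec_def]])
         (intro poly_comp_mult poly_comp_head)
    then have "poly_comp \<sigma> ?J (\<lambda>j. answers (fst j)) (\<lambda>j. inst_size \<sigma> (fst j)) ?E
       (\<lambda>j. VList (VInt (snd (snd j) * snd (snd j)) #
          map (\<lambda>k. VInt (fst (snd j) $ k * fst (snd j) $ k)) coords))"
      by (intro poly_comp_Cons poly_comp_mult poly_comp_row_const[OF r])
    then show "poly_comp \<sigma> ?J (\<lambda>j. answers (fst j)) (\<lambda>j. inst_size \<sigma> (fst j)) ?E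
       (\<lambda>j. VList (map VInt (square_entries (snd j))))"
      by (simp add: square_entries_def o_def)
  qed
  then have "inst_comp (\<lambda>i. VList (map VInt (concat (map square_entries (forms i @ rows_of i)))))"
    by (simp add: map_concat o_def)
  from poly_comp_add[OF poly_comp_int[of _ _ _ _ _ 1] poly_comp_sum_list[OF this]]
  show ?thesis by (simp add: entry_bound_def)
qed

lemma comp_value_bound: "inst_comp (\<lambda>i. VInt (value_bound i))"
  unfolding value_bound_def by (intro poly_comp_mult poly_comp_power poly_comp_int comp_entry_bound)

lemma zeta_ge:
  assumes "i \<in> insts" and "(u, s, cs, z) \<in> set (summands i)"
  shows "1 \<le> z" and "z \<le> zeta i"
proof -
  have "slicing_parameters s (polyhedron_of (rows_of i)) (cs, z)"
    using assms unfolding insts_def by fastforce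
  then show "1 \<le> z" by (simp add: slicing_parameters_def)
  have "z \<in> set (map (\<lambda>t. snd (snd (snd t))) (summands i))" using assms(2) by force
  then show "z \<le> zeta i" unfolding zeta_def by (rule member_le_sum_list) simp
qed

lemma zeta_ge_1: "i \<in> insts \<Longrightarrow> zeta i \<ge> 1"
proof -
  assume i: "i \<in> insts"
  then have "hd (summands i) \<in> set (summands i)" by (simp add: insts_def)
  moreover obtain u s cs z where "hd (summands i) = (u, s, cs, z)" by (rule prod_cases4)
  ultimately have "(u, s, cs, z) \<in> set (summands i)" by simp
  from zeta_ge[OF i this] show ?thesis by simp
qed

lemma ratio_props:
  assumes "i \<in> insts"
  shows "0 < ratio_den i" and "ratio_den i \<le> ratio_num i" and "0 < ratio_num i" and "0 < fine_den i"
proof -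
  have p: "eps_num i > 0" "eps_den i > 0" using assms by (auto simp: insts_def)
  then show fd: "0 < fine_den i" by (simp add: fine_den_def)
  show "0 < ratio_den i" unfolding ratio_den_def using fd zeta_ge_1[OF assms] by simp
  then show "ratio_den i \<le> ratio_num i" "0 < ratio_num i" using p by (auto simp: ratio_num_def)
qed

section \<open>The number of cuts\<close>

definition step_bound :: "'n inst \<Rightarrow> nat" where
  "step_bound i = (nat (ratio_den i div eps_num i) + 1) * vsize \<sigma> (VInt (value_bound i))"

text \<open>Bernoulli's inequality: for \<open>w \<ge> 1 / \<delta>\<close> the power
  \<open>(1 + \<delta>) ^ w\<close> is at least 2, and as many doublings as the value bound has
  binary digits reach it. Here \<open>\<delta> = eps_num / ratio_den\<close>.\<close>

lemma step_bound:
  assumes "i \<in> insts"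
  shows "value_bound i \<le> ratio_num i ^ step_bound i div ratio_den i ^ step_bound i"
proof -
  let ?A = "ratio_num i" and ?B = "ratio_den i" and ?p = "eps_num i"
  define w where "w = nat (?B div ?p) + 1"
  define l where "l = vsize \<sigma> (VInt (value_bound i))"
  have p: "?p > 0" using assms by (simp add: insts_def)
  note r = ratio_props[OF assms]
  have AB: "real_of_int ?A / real_of_int ?B = 1 + real_of_int ?p / real_of_int ?B"
    using r by (simp add: ratio_num_def add_divide_distrib)
  have "?B \<le> int w * ?p"
  proof -
    have "?B div ?p \<ge> 0" using r p by (simp add: pos_imp_zdiv_nonneg_iff)
    moreover have "?B < (?B div ?p + 1) * ?p"
    proof -
      have "?B = ?B div ?p * ?p + ?B mod ?p" "?B mod ?p < ?p" using p by simp_all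
      then have "?B < ?B div ?p * ?p + ?p" by linarith
      then show ?thesis by (simp add: distrib_right)
    qed
    ultimately show ?thesis by (simp add: w_def add.commute)
  qed
  then have "real_of_int ?B \<le> real w * real_of_int ?p" by (metis of_int_le_iff of_int_mult of_int_of_nat_eq)
  then have "2 \<le> 1 + real w * (real_of_int ?p / real_of_int ?B)" using r by (simp add: field_simps)
  also have "\<dots> \<le> (1 + real_of_int ?p / real_of_int ?B) ^ w"
    by (rule Bernoulli_inequality) (use p r in \<open>simp add: order_trans[of _ 0]\<close>)
  finally have two: "2 \<le> (real_of_int ?A / real_of_int ?B) ^ w" unfolding AB .
  have "real_of_int (value_bound i) \<le> 2 ^ l"
  proof -
    have "\<bar>value_bound i\<bar> < 2 ^ (l - 1)" unfolding l_def by (rule abs_less_vsize)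
    also have "\<dots> \<le> (2::int) ^ l" by (rule power_increasing) auto
    finally have "value_bound i \<le> 2 ^ l" by linarith
    then show ?thesis by (metis of_int_le_iff of_int_numeral of_int_power)
  qed
  also have "\<dots> \<le> ((real_of_int ?A / real_of_int ?B) ^ w) ^ l" using two by (intro power_mono) auto
  also have "\<dots> = (real_of_int ?A / real_of_int ?B) ^ step_bound i"
    by (simp only: step_bound_def w_def l_def power_mult)
  also have "\<dots> = real_of_int (?A ^ step_bound i) / real_of_int (?B ^ step_bound i)"
    by (simp add: power_divide)
  finally have "value_bound i \<le> \<lfloor>real_of_int (?A ^ step_bound i) / real_of_int (?B ^ step_bound i)\<rfloor>"
    by (simp add: le_floor_iff)
  then show ?thesis by (simp only: floor_divide_of_int_eq)
qed

lemma steps_props: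
  assumes "i \<in> insts"
  shows "value_bound i \<le> ratio_num i ^ steps i div ratio_den i ^ steps i" and "steps i \<le> step_bound i"
    and "k < steps i \<Longrightarrow> ratio_num i ^ k div ratio_den i ^ k < value_bound i"
  unfolding steps_def
  by (rule LeastI[where P = "\<lambda>k. value_bound i \<le> ratio_num i ^ k div ratio_den i ^ k", OF step_bound[OF assms]])
     (rule Least_le[where P = "\<lambda>k. value_bound i \<le> ratio_num i ^ k div ratio_den i ^ k", OF step_bound[OF assms]],
      use not_less_Least in force)

text \<open>The quotient is \<open>7 + 7 / \<epsilon>\<close>. It governs both the number of cuts
  and the time of the calls with the finer accuracy \<open>\<epsilon>'\<close>.\<close>

lemma ratio_bdd:
  "poly_bdd insts (inst_size \<sigma>) (\<lambda>i. nat \<lceil>real_of_int (fine_den i) / real_of_int (eps_num i)\<rceil>)"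
proof -
  have "poly_bdd insts (inst_size \<sigma>) (\<lambda>i. 7 + 7 * inst_size \<sigma> i)"
    by (intro poly_bdd_add poly_bdd_mult poly_bdd_const poly_bdd_size)
  then show ?thesis
  proof (rule poly_bdd_mono)
    fix i assume i: "i \<in> insts"
    let ?r = "real_of_int (eps_den i) / real_of_int (eps_num i)"
    have pos: "eps_num i > 0" "eps_den i > 0" using i by (auto simp: insts_def)
    then have "real_of_int (fine_den i) / real_of_int (eps_num i) = 7 + 7 * ?r"
      by (simp add: fine_den_def field_simps)
    also have "\<dots> \<le> 7 + 7 * of_int \<lceil>?r\<rceil>" using le_of_int_ceiling[of ?r] by linarith
    also have "\<dots> \<le> 7 + 7 * real (inst_size \<sigma> i)"
    proof -
      have "real_of_int \<lceil>?r\<rceil> = real (nat \<lceil>?r\<rceil>)" using pos by (simp add: of_nat_nat)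
      also have "\<dots> \<le> real (inst_size \<sigma> i)" unfolding inst_size_def by (intro of_nat_mono le_add1)
      finally have "real_of_int \<lceil>?r\<rceil> \<le> real (inst_size \<sigma> i)" .
      then show ?thesis by linarith
    qed
    finally show "nat \<lceil>real_of_int (fine_den i) / real_of_int (eps_num i)\<rceil> \<le> 7 + 7 * inst_size \<sigma> i"
      by (simp add: nat_le_iff ceiling_le_iff)
  qed
qed

text \<open>The unary encoding enters here: the value of \<open>zeta\<close>, and not just its
  binary length, is polynomial. It is a factor in the bound for the number of cuts.\<close>

lemma zeta_bdd: "poly_bdd insts (inst_size \<sigma>) zeta"
proof (rule poly_bdd_mono[OF inst_comp_bdd])
  show "inst_comp (\<lambda>i. VList (concat (map (\<lambda>t. replicate (snd (snd (snd t))) (VList [])) (summands i))))"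
    by (rule poly_comp_concat_map[OF comp_summands]) (rule poly_comp_summand_zeta[OF poly_comp_head])
  fix i :: "'n inst"
  let ?xs = "concat (map (\<lambda>t. replicate (snd (snd (snd t))) (VList [])) (summands i))"
  have "zeta i = length ?xs" by (simp add: zeta_def length_concat o_def)
  then show "zeta i \<le> vsize \<sigma> (VList ?xs)" using length_le_vsize[of ?xs \<sigma>] by linarith
qed

lemma steps_bdd: "poly_bdd insts (inst_size \<sigma>) steps"
proof -
  have "poly_bdd insts (inst_size \<sigma>) (\<lambda>i.
      (nat \<lceil>real_of_int (fine_den i) / real_of_int (eps_num i)\<rceil> * zeta i + 1) * vsize \<sigma> (VInt (value_bound i)))"
    by (intro poly_bdd_mult poly_bdd_add poly_bdd_const ratio_bdd zeta_bdd inst_comp_bdd comp_value_bound)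
  then show ?thesis
  proof (rule poly_bdd_mono)
    fix i assume i: "i \<in> insts"
    let ?r = "real_of_int (fine_den i) / real_of_int (eps_num i)"
    have pos: "eps_num i > 0" "fine_den i > 0" using i ratio_props[OF i] by (auto simp: insts_def)
    have "real_of_int (ratio_den i div eps_num i) \<le> real_of_int (ratio_den i) / real_of_int (eps_num i)"
      by (rule real_of_int_div4)
    also have "\<dots> = ?r * real (zeta i)" by (simp add: ratio_den_def)
    also have "\<dots> \<le> real_of_int \<lceil>?r\<rceil> * real (zeta i)" by (intro mult_right_mono) auto
    also have "real_of_int \<lceil>?r\<rceil> = real (nat \<lceil>?r\<rceil>)" using pos by (simp add: of_nat_nat)
    finally have "real_of_int (ratio_den i div eps_num i) \<le> real_of_int (int (nat \<lceil>?r\<rceil> * zeta i))"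
      by (simp only: of_int_of_nat_eq of_nat_mult of_int_mult)
    then have "nat (ratio_den i div eps_num i) \<le> nat \<lceil>?r\<rceil> * zeta i"
      unfolding of_int_le_iff by linarith
    then have "step_bound i \<le> (nat \<lceil>?r\<rceil> * zeta i + 1) * vsize \<sigma> (VInt (value_bound i))"
      unfolding step_bound_def by (intro mult_right_mono) auto
    then show "steps i \<le> (nat \<lceil>?r\<rceil> * zeta i + 1) * vsize \<sigma> (VInt (value_bound i))"
      using steps_props(2)[OF i] by linarith
  qed
qed

lemma comp_intervals: "inst_comp (\<lambda>i. VList (map enc_interval (intervals i)))"
proof -
  \<comment> \<open>The state carries the powers along with the cuts, so each round multiplies them
    once more. Their binary length grows only linearly with the number of rounds.\<close>
  define st where "st i k = VList [VInt (ratio_num i ^ k), VInt (ratio_den i ^ k),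
    VList (map enc_interval (slabs (ratio_num i) (ratio_den i) k))]" for i :: "'n inst" and k
  define cnd where "cnd i k = VInt (of_bool (ratio_num i ^ k div ratio_den i ^ k < value_bound i))"
    for i :: "'n inst" and k
  let ?J = "{j :: 'n inst \<times> nat. fst j \<in> insts \<and> snd j \<le> steps (fst j)}"
  let ?J' = "{j :: 'n inst \<times> nat. fst j \<in> insts \<and> snd j < steps (fst j)}"
  have J: "{(i, k). i \<in> insts \<and> k \<le> steps i} = ?J" "{(i, k). i \<in> insts \<and> k < steps i} = ?J'" by auto
  let ?orc = "\<lambda>j :: 'n inst \<times> nat. answers (fst j)" and ?S = "\<lambda>j :: 'n inst \<times> nat. inst_size \<sigma> (fst j)"
  let ?E = "\<lambda>j. st (fst j) (snd j) # inst_env (fst j)"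
  have a: "poly_comp \<sigma> L ?orc ?S ?E (\<lambda>j. VInt (ratio_num (fst j) ^ snd j))" for L
    unfolding st_def by (rule poly_comp_hd, rule poly_comp_head)
  have c: "poly_comp \<sigma> L ?orc ?S ?E (\<lambda>j. VInt (ratio_den (fst j) ^ snd j))" for L
    unfolding st_def by (rule poly_comp_hd, rule poly_comp_tl, rule poly_comp_head)
  have s: "poly_comp \<sigma> L ?orc ?S ?E (\<lambda>j. VList (map enc_interval (slabs (ratio_num (fst j)) (ratio_den (fst j)) (snd j))))" for L
    unfolding st_def by (rule poly_comp_hd, rule poly_comp_tl, rule poly_comp_tl, rule poly_comp_head)
  have A: "poly_comp \<sigma> ?J' ?orc ?S ?E (\<lambda>j. VInt (ratio_num (fst j)))"
    by (rule poly_comp_weaken, rule inst_comp_lift[OF comp_ratio_num]) auto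
  have B: "poly_comp \<sigma> ?J' ?orc ?S ?E (\<lambda>j. VInt (ratio_den (fst j)))"
    by (rule poly_comp_weaken, rule inst_comp_lift[OF comp_ratio_den]) auto
  have V: "poly_comp \<sigma> ?J ?orc ?S ?E (\<lambda>j. VInt (value_bound (fst j)))"
    by (rule poly_comp_weaken, rule inst_comp_lift[OF comp_value_bound]) auto
  have "inst_comp (\<lambda>i. st i (steps i))"
  proof (rule poly_comp_while[where cnd = cnd])
    have "inst_comp (\<lambda>i. VList [VInt 1, VInt 1, VList [enc_interval (0, 0), enc_interval (1, 1), enc_interval (-1, -1)]])"
      by (intro poly_comp_Cons poly_comp_Nil poly_comp_int poly_comp_interval)
    then show "inst_comp (\<lambda>i. st i 0)" by (simp add: st_def)
    show "poly_comp \<sigma> {(i, k). i \<in> insts \<and> k \<le> steps i} ?orc ?S (\<lambda>(i, k). st i k # inst_env i) (\<lambda>(i, k). cnd i k)"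
      unfolding J case_prod_beta' cnd_def by (intro poly_comp_less poly_comp_div a c V)
    have "poly_comp \<sigma> ?J' ?orc ?S ?E (\<lambda>j.
      VList [VInt (ratio_num (fst j) ^ snd j * ratio_num (fst j)), VInt (ratio_den (fst j) ^ snd j * ratio_den (fst j)),
        VList (enc_interval (ratio_num (fst j) ^ snd j div ratio_den (fst j) ^ snd j + 1,
             (ratio_num (fst j) ^ snd j * ratio_num (fst j)) div (ratio_den (fst j) ^ snd j * ratio_den (fst j))) #
           enc_interval (- ((ratio_num (fst j) ^ snd j * ratio_num (fst j)) div (ratio_den (fst j) ^ snd j * ratio_den (fst j))),
             - (ratio_num (fst j) ^ snd j div ratio_den (fst j) ^ snd j) - 1) #
           map enc_interval (slabs (ratio_num (fst j)) (ratio_den (fst j)) (snd j)))])"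
      by (intro poly_comp_Cons poly_comp_Nil poly_comp_mult poly_comp_interval poly_comp_add poly_comp_diff
          poly_comp_uminus poly_comp_div poly_comp_int a c s A B)
    then show "poly_comp \<sigma> {(i, k). i \<in> insts \<and> k < steps i} ?orc ?S (\<lambda>(i, k). st i k # inst_env i)
        (\<lambda>(i, k). st i (Suc k))"
      unfolding J case_prod_beta' by (rule poly_comp_cong) (simp_all add: st_def mult.commute)
    show "poly_bdd insts (inst_size \<sigma>) steps" by (rule steps_bdd)
    let ?T = "\<lambda>i. 2 + (2 + steps i * vsize \<sigma> (VInt (ratio_num i))) + (2 + steps i * vsize \<sigma> (VInt (ratio_den i))) +
      (2 * steps i + 3) * (9 + 2 * steps i * vsize \<sigma> (VInt (ratio_num i)))"
    have T: "poly_bdd insts (inst_size \<sigma>) ?T"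
      by (intro poly_bdd_add poly_bdd_mult poly_bdd_const steps_bdd inst_comp_bdd comp_ratio_num comp_ratio_den)
    have "poly_bdd ?J ?S (\<lambda>j. ?T (fst j))" by (rule poly_bdd_fst[OF T]) auto
    then show "poly_bdd {(i, k). i \<in> insts \<and> k \<le> steps i} ?S (\<lambda>(i, k). vsize \<sigma> (st i k))"
      unfolding J case_prod_beta'
    proof (rule poly_bdd_mono)
      fix j assume j: "j \<in> ?J"
      obtain i k where ik: "j = (i, k)" by (cases j)
      then have k: "i \<in> insts" "k \<le> steps i" using j by auto
      have 1: "vsize \<sigma> (VInt (ratio_num i ^ k)) \<le> 2 + steps i * vsize \<sigma> (VInt (ratio_num i))"
        using vsize_VInt_power[of \<sigma> "ratio_num i" k] mult_right_mono[OF k(2), of "vsize \<sigma> (VInt (ratio_num i))"]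
        by linarith
      have 2: "vsize \<sigma> (VInt (ratio_den i ^ k)) \<le> 2 + steps i * vsize \<sigma> (VInt (ratio_den i))"
        using vsize_VInt_power[of \<sigma> "ratio_den i" k] mult_right_mono[OF k(2), of "vsize \<sigma> (VInt (ratio_den i))"]
        by linarith
      have "vsize \<sigma> (VList (map enc_interval (slabs (ratio_num i) (ratio_den i) k))) \<le>
          1 + (2 * k + 3) * (9 + 2 * k * vsize \<sigma> (VInt (ratio_num i)))"
        by (rule vsize_slabs) (use ratio_props[OF k(1)] in auto)
      also have "\<dots> \<le> 1 + (2 * steps i + 3) * (9 + 2 * steps i * vsize \<sigma> (VInt (ratio_num i)))"
        using k(2) by (intro add_mono mult_mono) auto
      finally have 3: "vsize \<sigma> (VList (map enc_interval (slabs (ratio_num i) (ratio_den i) k))) \<le>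
          1 + (2 * steps i + 3) * (9 + 2 * steps i * vsize \<sigma> (VInt (ratio_num i)))" .
      have "vsize \<sigma> (st i k) = 1 + vsize \<sigma> (VInt (ratio_num i ^ k)) + vsize \<sigma> (VInt (ratio_den i ^ k)) +
          vsize \<sigma> (VList (map enc_interval (slabs (ratio_num i) (ratio_den i) k)))"
        by (simp add: st_def)
      then show "vsize \<sigma> (st (fst j) (snd j)) \<le> ?T (fst j)"
        unfolding ik fst_conv snd_conv using 1 2 3 by linarith
    qed
  qed (use steps_props in \<open>auto simp: cnd_def not_less\<close>)
  then have "inst_comp (\<lambda>i. VList (map enc_interval (slabs (ratio_num i) (ratio_den i) (steps i))))"
    unfolding st_def by (rule poly_comp_hd[OF poly_comp_tl[OF poly_comp_tl]])
  then show ?thesis by (simp add: intervals_def)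
qed

end


lemma enc_vec_not_VInt [simp]: "enc_vec z \<noteq> VInt k" "VInt k \<noteq> enc_vec z"
  by (simp_all add: enc_vec_def)

section \<open>Calls of the programs for basic functions\<close>

context basic_scheme
begin

text \<open>This lets the scheme be called on every cell, including those without integer
  points.\<close>

lemma subpolytope_mem:
  assumes "polyhedron_of C \<subseteq> polyhedron_of rs" and "polyhedron_of rs \<in> \<P>"
  shows "polyhedron_of C \<in> \<P>"
proof -
  have "bounded (polyhedron_of C)"
    using assms polytopes unfolding int_polytope_def by (meson bounded_subset)
  then have "int_polytope (polyhedron_of C)" unfolding int_polytope_def by blast
  then show ?thesis using closed assms unfolding closed_under_subpolytopes_def by blast
qed

text \<open>The time of the scheme is polynomial in the inverse of its accuracy
  \<open>p / q\<close>, whence the premise that \<open>q / p\<close> be polynomially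
  bounded.\<close>

lemma poly_comp_basic:
  assumes u: "poly_comp \<sigma> J orc S E u" and C: "poly_comp \<sigma> J orc S E (\<lambda>j. enc_rows (C j))"
    and p: "poly_comp \<sigma> J orc S E (\<lambda>j. VInt (p j))" and q: "poly_comp \<sigma> J orc S E (\<lambda>j. VInt (q j))"
    and valid: "\<And>j. j \<in> J \<Longrightarrow> u j \<in> dom dec \<and> polyhedron_of (C j) \<in> \<P> \<and> p j > 0 \<and> q j > 0"
    and eps: "poly_bdd J S (\<lambda>j. nat \<lceil>real_of_int (q j) / real_of_int (p j)\<rceil>)"
  shows "poly_comp \<sigma> J orc S E (\<lambda>j. basic_out (u j) (C j) (p j) (q j))"
proof (rule poly_compI)
  assume env: "poly_env \<sigma> J S E"
  let ?v = "\<lambda>j. VList [VInt (p j), VInt (q j), VList [u j, enc_rows (C j)]]"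
  have v: "poly_comp \<sigma> J orc S E ?v"
    by (intro poly_comp_Cons poly_comp_Nil u C p q)
  let ?N = "\<lambda>j. nat \<lceil>real_of_int (q j) / real_of_int (p j)\<rceil> + vsize \<sigma> (?v j)"
  let ?T = "\<lambda>j. basic_deg * ?N j ^ basic_deg"
  show ?thesis
  proof (rule poly_comp_call[OF v])
    show "poly_bdd J S ?T"
      by (intro poly_bdd_mult poly_bdd_power poly_bdd_add poly_bdd_const eps poly_comp_vsize[OF v env])
    fix j assume "j \<in> J"
    then obtain t where t: "computes \<sigma> no_oracle basic_prog (?v j) t (basic_out (u j) (C j) (p j) (q j))"
      "real t \<le> real basic_deg * (1 / (real_of_int (p j) / real_of_int (q j)) + real (vsize \<sigma> (?v j))) ^ basic_deg"
      using basic_time[of "u j" "C j" "p j" "q j"] valid by blast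
    have "1 / (real_of_int (p j) / real_of_int (q j)) \<le> real (nat \<lceil>real_of_int (q j) / real_of_int (p j)\<rceil>)"
      by (simp add: real_nat_ceiling_ge)
    moreover have "0 \<le> 1 / (real_of_int (p j) / real_of_int (q j))" using valid[OF \<open>j \<in> J\<close>] by simp
    ultimately have "(1 / (real_of_int (p j) / real_of_int (q j)) + real (vsize \<sigma> (?v j))) ^ basic_deg \<le> real (?N j) ^ basic_deg"
      by (intro power_mono) (simp_all del: vsize.simps)
    then have "real basic_deg * (1 / (real_of_int (p j) / real_of_int (q j)) + real (vsize \<sigma> (?v j))) ^ basic_deg
        \<le> real basic_deg * real (?N j) ^ basic_deg"
      by (rule mult_left_mono) simp
    with t(2) have "real t \<le> real (?T j)" by (simp only: of_nat_mult of_nat_power)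
    then have "t \<le> ?T j" by (simp only: of_nat_le_iff)
    then show "\<exists>t\<le>?T j. computes \<sigma> (orc j) basic_prog (?v j) t (basic_out (u j) (C j) (p j) (q j))"
      using computes_no_oracle[OF t(1)] by blast
  qed
qed

lemma poly_comp_conic:
  assumes us: "poly_comp \<sigma> J orc S E (\<lambda>j. VList (map enc_term (us j)))"
    and valid: "\<And>j. j \<in> J \<Longrightarrow> us j \<noteq> [] \<and> (\<forall>(r, u) \<in> set (us j). r \<in> K \<and> r > 0 \<and> u \<in> dom dec)"
  shows "poly_comp \<sigma> J orc S E (\<lambda>j. conic_out (us j))"
proof (rule poly_compI)
  assume env: "poly_env \<sigma> J S E"
  let ?T = "\<lambda>j. conic_deg * vsize \<sigma> (VList (map enc_term (us j))) ^ conic_deg"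
  show ?thesis
  proof (rule poly_comp_call[OF us])
    show "poly_bdd J S ?T"
      by (intro poly_bdd_mult poly_bdd_power poly_bdd_const poly_comp_vsize[OF us env])
    fix j assume "j \<in> J"
    then obtain t where t: "computes \<sigma> no_oracle conic_prog (VList (map enc_term (us j))) t (conic_out (us j))" "t \<le> ?T j"
      using conic[of "us j"] valid by blast
    then show "\<exists>t\<le>?T j. computes \<sigma> (orc j) conic_prog (VList (map enc_term (us j))) t (conic_out (us j))"
      using computes_no_oracle by blast
  qed
qed

lemma basic_out_point:
  assumes "u \<in> dom dec" and "polyhedron_of C \<in> \<P>" and "p > 0" and "q > 0" and "has_int C"
  shows "\<exists>z. basic_out u C p q = enc_vec z \<and> real_vec z \<in> polyhedron_of C"
  using basic_approx[OF assms(1-4)] assms(5) unfolding has_int_def eps_approx_def by blast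

text \<open>Accuracy 1 and any basic function turn the scheme into a test for integer points; codes
  of vectors are lists and so differ from the answer \<open>VInt 0\<close>.\<close>

lemma basic_out_iff:
  assumes "u \<in> dom dec" and "polyhedron_of C \<in> \<P>"
  shows "basic_out u C 1 1 \<noteq> VInt 0 \<longleftrightarrow> has_int C"
proof (cases "has_int C")
  case True
  then show ?thesis using basic_out_point[OF assms, of 1 1] by auto
next
  case False
  then show ?thesis using basic_empty[OF assms, of 1 1] by (simp add: has_int_def)
qed

lemma poly_comp_basic_1:
  assumes u: "poly_comp \<sigma> J orc S E u" and C: "poly_comp \<sigma> J orc S E (\<lambda>j. enc_rows (C j))"
    and valid: "\<And>j. j \<in> J \<Longrightarrow> u j \<in> dom dec \<and> polyhedron_of (C j) \<in> \<P>"
  shows "poly_comp \<sigma> J orc S E (\<lambda>j. basic_out (u j) (C j) 1 1)"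
  by (rule poly_comp_basic[OF u C poly_comp_int poly_comp_int]) (use valid in auto)

lemma poly_comp_has_int:
  assumes u: "poly_comp \<sigma> J orc S E u" and C: "poly_comp \<sigma> J orc S E (\<lambda>j. enc_rows (C j))"
    and valid: "\<And>j. j \<in> J \<Longrightarrow> u j \<in> dom dec \<and> polyhedron_of (C j) \<in> \<P>"
  shows "poly_comp \<sigma> J orc S E (\<lambda>j. VInt (of_bool (has_int (C j))))"
proof -
  have "poly_comp \<sigma> J orc S E (\<lambda>j. if has_int (C j) then VInt 1 else VInt 0)"
    by (rule poly_comp_if[OF poly_comp_basic_1[OF assms]])
       (use basic_out_iff valid in \<open>auto intro: poly_comp_int\<close>)
  then show ?thesis by (simp only: of_bool_def if_distrib[of VInt])
qed

text \<open>The tests for integer points need some basic function; the first summand supplies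
  one.\<close>

definition first_enc :: "'n inst \<Rightarrow> val" where
  "first_enc i = fst (hd (summands i))"

lemma comp_first_enc: "inst_comp first_enc"
proof -
  have "inst_comp (\<lambda>i. VList (enc_summand (hd (summands i)) # map enc_summand (tl (summands i))))"
    by (rule poly_comp_cong[OF comp_summands]) (auto simp: insts_def list.map(2)[symmetric] simp del: list.map(2))
  from poly_comp_summand_enc[OF poly_comp_hd[OF this]] show ?thesis unfolding first_enc_def .
qed

lemma inst_summand:
  assumes "i \<in> insts" and "(u, s, cs, z) \<in> set (summands i)"
  shows "u \<in> dom dec" and "s \<in> sliceable_functions \<P>"
    and "slicing_parameters s (polyhedron_of (rows_of i)) (cs, z)"
    and "answers_bounded \<sigma> b (enc_instance (summands i) (rows_of i)) (polyhedron_of (rows_of i)) s"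
  using assms unfolding insts_def by fastforce+

lemma inst_region: "i \<in> insts \<Longrightarrow> polyhedron_of (rows_of i) \<in> \<P>"
  by (simp add: insts_def)

lemma inst_bounded: "i \<in> insts \<Longrightarrow> bounded (polyhedron_of (rows_of i))"
  using inst_region polytopes unfolding int_polytope_def by blast

lemma first_enc_dom: "i \<in> insts \<Longrightarrow> first_enc i \<in> dom dec"
proof -
  assume i: "i \<in> insts"
  then have "hd (summands i) \<in> set (summands i)" by (simp add: insts_def)
  moreover obtain u s cs z where "hd (summands i) = (u, s, cs, z)" by (rule prod_cases4)
  ultimately show ?thesis using inst_summand(1)[OF i, of u s cs z] by (simp add: first_enc_def)
qed

section \<open>Construction of the cells\<close>

lemma intervals_cover:
  assumes i: "i \<in> insts" and x: "x \<in> polyhedron_of (rows_of i) \<inter> int_points" and r: "r \<in> set (forms i)"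
  shows "\<exists>I\<in>set (intervals i). in_interval I (affine_form r x)"
proof -
  obtain v where v: "affine_form r x = of_int v" using affine_form_of_int x by blast
  have "\<bar>affine_form r x\<bar> \<le> real_of_int (value_bound i)"
    unfolding value_bound_def
    by (rule affine_form_bound[OF inst_bounded[OF i] _ entry_bound_ge_1])
       (use x r entry_bound[of _ i] in fastforce)+
  then have "\<bar>v\<bar> \<le> value_bound i" unfolding v by linarith
  then have "\<bar>v\<bar> \<le> ratio_num i ^ steps i div ratio_den i ^ steps i" using steps_props(1)[OF i] by linarith
  from slabs_cover[OF this] show ?thesis unfolding v intervals_def .
qed

lemma intervals_disjoint: "i \<in> insts \<Longrightarrow> sorted_wrt disjoint_intervals (intervals i)"
  unfolding intervals_def by (rule slabs_disjoint) (rule ratio_props; assumption)+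

text \<open>Formulated so as to include the prefixes of the list of forms, because the intermediate
  lists of cells must be polynomial too.\<close>

lemma length_cells_inst:
  assumes i: "i \<in> insts" and fs: "set fs \<subseteq> set (forms i)" "length fs \<le> length (forms i)"
  shows "length (cells (intervals i) (rows_of i) fs) \<le> (length (forms i) * length (intervals i) + 1) ^ CARD('n)"
proof -
  have "length (cells (intervals i) (rows_of i) fs) \<le> (length fs * length (intervals i) + 1) ^ CARD('n)"
    by (rule length_cells_le[OF intervals_disjoint[OF i]]) (use intervals_cover[OF i] fs in blast)
  also have "\<dots> \<le> (length (forms i) * length (intervals i) + 1) ^ CARD('n)"
    using fs(2) by (intro power_mono add_mono mult_right_mono) auto
  finally show ?thesis .
qed

lemma cell_mem: "i \<in> insts \<Longrightarrow> C \<in> set (cells Is (rows_of i) fs) \<Longrightarrow> polyhedron_of C \<in> \<P>"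
  by (rule subpolytope_mem[OF cells_subset inst_region])

text \<open>A fold over the forms. The premise on sizes is met since in every round the number of
  cells (\<open>length_cells_inst\<close>) and the size of each (\<open>vsize_cells\<close>) are
  polynomial.\<close>

lemma comp_final_cells: "inst_comp (\<lambda>i. VList (map enc_rows (final_cells i)))"
proof -
  define Cs where "Cs j = cells (intervals (fst j)) (rows_of (fst j)) (take (snd j) (forms (fst j)))" for j :: "'n inst \<times> nat"
  define acc where "acc i k = VList (map enc_rows (Cs (i, k)))" for i k
  let ?xs = "\<lambda>i :: 'n inst. map enc_row (forms i)"
  have "inst_comp (\<lambda>i. acc i (length (?xs i)))"
  proof (rule poly_comp_fold[OF comp_forms[unfolded enc_rows_eq]])
    have h: "inst_comp (\<lambda>i. VInt (of_bool (has_int (rows_of i))))"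
      by (rule poly_comp_has_int[OF comp_first_enc comp_rows]) (simp add: first_enc_dom inst_region)
    have "inst_comp (\<lambda>i. if has_int (rows_of i) then VList [enc_rows (rows_of i)] else VList [])"
    proof (rule poly_comp_If[OF h])
      show "poly_comp \<sigma> {i \<in> insts. has_int (rows_of i)} answers (inst_size \<sigma>) inst_env
        (\<lambda>i. VList [enc_rows (rows_of i)])"
        by (intro poly_comp_Cons poly_comp_Nil inst_comp_lift[where \<pi> = "\<lambda>i. i", OF comp_rows]) auto
    qed (rule poly_comp_Nil)
    moreover have "acc i 0 = (if has_int (rows_of i) then VList [enc_rows (rows_of i)] else VList [])" for i
      by (simp add: acc_def Cs_def cells_def)
    ultimately show "inst_comp (\<lambda>i. acc i 0)" by simp
    let ?J = "{j. fst j \<in> insts \<and> snd j < length (?xs (fst j))}"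
    let ?orc = "\<lambda>j :: 'n inst \<times> nat. answers (fst j)" and ?S = "\<lambda>j :: 'n inst \<times> nat. inst_size \<sigma> (fst j)"
    define r where "r j = forms (fst j) ! snd j" for j :: "'n inst \<times> nat"
    define L where "L j = concat (map (\<lambda>C. map (\<lambda>I. slab_rows (r j) I @ C) (intervals (fst j))) (Cs j))" for j
    let ?E = "\<lambda>j. VList (map enc_rows (Cs j)) # enc_row (r j) # inst_env (fst j)"
    have "poly_comp \<sigma> ?J ?orc ?S ?E (\<lambda>j. VList (concat (map
        (\<lambda>C. map (\<lambda>I. enc_rows (slab_rows (r j) I @ C)) (intervals (fst j))) (Cs j))))"
    proof (rule poly_comp_concat_map[where ey = "\<lambda>_. enc_rows"])
      show "poly_comp \<sigma> ?J ?orc ?S ?E (\<lambda>j. VList (map enc_rows (Cs j)))" by (rule poly_comp_head)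
      let ?J1 = "{m. fst m \<in> ?J \<and> snd m \<in> set (Cs (fst m))}"
      let ?orc1 = "\<lambda>m. ?orc (fst m)" and ?S1 = "\<lambda>m. ?S (fst m)"
      let ?E1 = "\<lambda>m. enc_rows (snd m) # ?E (fst m)"
      show "poly_comp \<sigma> ?J1 ?orc1 ?S1 ?E1
        (\<lambda>m. VList (map (\<lambda>I. enc_rows (slab_rows (r (fst m)) I @ snd m)) (intervals (fst (fst m)))))"
      proof (rule poly_comp_map[where ey = "\<lambda>_. enc_interval"])
        show "poly_comp \<sigma> ?J1 ?orc1 ?S1 ?E1 (\<lambda>m. VList (map enc_interval (intervals (fst (fst m)))))"
          by (rule poly_comp_weaken, rule poly_comp_weaken, rule poly_comp_weaken,
              rule inst_comp_lift[where \<pi> = "\<lambda>m. fst (fst m)", OF comp_intervals]) auto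
      qed (intro poly_comp_slab_rows poly_comp_second poly_comp_head,
           rule poly_comp_weaken, rule poly_comp_weaken, rule poly_comp_weaken, rule poly_comp_head)
    qed
    moreover have "concat (map (\<lambda>C. map (\<lambda>I. enc_rows (slab_rows (r j) I @ C)) (intervals (fst j))) (Cs j))
        = map enc_rows (L j)" for j
      by (simp add: L_def map_concat o_def)
    ultimately have L: "poly_comp \<sigma> ?J ?orc ?S ?E (\<lambda>j. VList (map enc_rows (L j)))" by simp
    \<comment> \<open>Before the test, \<open>L j\<close> may contain cells without integer points.
      As sub-polytopes they belong to \<open>\<P>\<close> as well, so the test may be called on
      them.\<close>
    have Lm: "polyhedron_of C \<in> \<P>" if ij: "j \<in> ?J" and C: "C \<in> set (L j)" for j C
    proof -
      obtain D I where D: "D \<in> set (Cs j)" "C = slab_rows (r j) I @ D" using C unfolding L_def by auto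
      have "polyhedron_of C \<subseteq> polyhedron_of D" unfolding D(2) polyhedron_of_slab_rows by blast
      moreover have "polyhedron_of D \<in> \<P>" using cell_mem[of "fst j" D] D(1) ij unfolding Cs_def by simp
      ultimately show ?thesis by (rule subpolytope_mem)
    qed
    have "poly_comp \<sigma> ?J ?orc ?S ?E (\<lambda>j. VList (map enc_rows (filter has_int (L j))))"
    proof (rule poly_comp_filter[where ey = "\<lambda>_. enc_rows", OF L])
      let ?J1 = "{m. fst m \<in> ?J \<and> snd m \<in> set (L (fst m))}"
      let ?orc1 = "\<lambda>m. ?orc (fst m)" and ?S1 = "\<lambda>m. ?S (fst m)"
      let ?E1 = "\<lambda>m. enc_rows (snd m) # ?E (fst m)"
      show "poly_comp \<sigma> ?J1 ?orc1 ?S1 ?E1 (\<lambda>m. VInt (of_bool (has_int (snd m))))"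
      proof (rule poly_comp_has_int)
        show "poly_comp \<sigma> ?J1 ?orc1 ?S1 ?E1 (\<lambda>m. first_enc (fst (fst m)))"
          by (rule poly_comp_weaken, rule poly_comp_weaken, rule poly_comp_weaken,
              rule inst_comp_lift[where \<pi> = "\<lambda>m. fst (fst m)", OF comp_first_enc]) auto
        show "poly_comp \<sigma> ?J1 ?orc1 ?S1 ?E1 (\<lambda>m. enc_rows (snd m))" by (rule poly_comp_head)
        fix m assume m: "m \<in> ?J1"
        show "first_enc (fst (fst m)) \<in> dom dec \<and> polyhedron_of (snd m) \<in> \<P>"
          using m Lm[of "fst m" "snd m"] first_enc_dom by blast
      qed
    qed
    then show "poly_comp \<sigma> ?J ?orc ?S (\<lambda>j. acc (fst j) (snd j) # ?xs (fst j) ! snd j # inst_env (fst j))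
        (\<lambda>j. acc (fst j) (Suc (snd j)))"
    proof (rule poly_comp_cong)
      fix j assume j: "j \<in> ?J"
      then show "?E j = acc (fst j) (snd j) # ?xs (fst j) ! snd j # inst_env (fst j)"
        by (simp add: acc_def r_def)
      have "take (Suc (snd j)) (forms (fst j)) = take (snd j) (forms (fst j)) @ [r j]"
        using j by (simp add: take_Suc_conv_app_nth r_def)
      then have "Cs (fst j, Suc (snd j)) = filter has_int (L j)"
        by (simp add: Cs_def cells_snoc refine_def L_def)
      then show "VList (map enc_rows (filter has_int (L j))) = acc (fst j) (Suc (snd j))"
        by (simp add: acc_def)
    qed
    let ?J' = "{j. fst j \<in> insts \<and> snd j \<le> length (?xs (fst j))}"
    let ?F = "\<lambda>i. vsize \<sigma> (enc_rows (forms i))" and ?V = "\<lambda>i. vsize \<sigma> (VList (map enc_interval (intervals i)))"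
    \<comment> \<open>Number of cells times size of a cell, with the lengths of lists replaced by
      the sizes of their encodings.\<close>
    let ?T = "\<lambda>i. 1 + (?F i * ?V i + 1) ^ CARD('n) * (vsize \<sigma> (enc_rows (rows_of i)) + ?F i * (2 * ?F i + 2 * ?V i))"
    have T: "poly_bdd insts (inst_size \<sigma>) ?T"
      by (intro poly_bdd_add poly_bdd_mult poly_bdd_power poly_bdd_const inst_comp_bdd comp_forms comp_rows comp_intervals)
    have "poly_bdd ?J' ?S (\<lambda>j. ?T (fst j))" by (rule poly_bdd_fst[OF T]) auto
    then show "poly_bdd ?J' ?S (\<lambda>j. vsize \<sigma> (acc (fst j) (snd j)))"
    proof (rule poly_bdd_mono)
      fix j assume j: "j \<in> ?J'"
      obtain i k where ik: "j = (i, k)" by (cases j)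
      then have i: "i \<in> insts" using j by simp
      have lf: "length (forms i) \<le> ?F i" "length (intervals i) \<le> ?V i"
        using length_le_vsize[of "map enc_row (forms i)" \<sigma>] length_le_vsize[of "map enc_interval (intervals i)" \<sigma>]
        unfolding enc_rows_eq by simp_all
      have "vsize \<sigma> (acc i k) \<le> 1 + length (map enc_rows (Cs j)) *
          (vsize \<sigma> (enc_rows (rows_of i)) + length (forms i) * (2 * ?F i + 2 * ?V i))"
        unfolding acc_def ik
      proof (rule vsize_VList_le)
        fix v assume "v \<in> set (map enc_rows (Cs (i, k)))"
        then obtain C where C: "C \<in> set (cells (intervals i) (rows_of i) (take k (forms i)))" "v = enc_rows C"
          by (auto simp: Cs_def)
        have "vsize \<sigma> v \<le> vsize \<sigma> (enc_rows (rows_of i)) + length (take k (forms i)) * (2 * ?F i + 2 * ?V i)"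
          unfolding C(2) by (rule vsize_cells[OF C(1)]) (rule set_take_subset)
        also have "\<dots> \<le> vsize \<sigma> (enc_rows (rows_of i)) + length (forms i) * (2 * ?F i + 2 * ?V i)"
          by (intro add_left_mono mult_right_mono) auto
        finally show "vsize \<sigma> v \<le> vsize \<sigma> (enc_rows (rows_of i)) + length (forms i) * (2 * ?F i + 2 * ?V i)" .
      qed
      also have "\<dots> \<le> ?T i"
      proof (intro add_left_mono mult_mono)
        have "length (map enc_rows (Cs j)) \<le> (length (forms i) * length (intervals i) + 1) ^ CARD('n)"
          unfolding ik Cs_def length_map fst_conv snd_conv
          by (rule length_cells_inst[OF i]) (auto simp: set_take_subset)
        also have "\<dots> \<le> (?F i * ?V i + 1) ^ CARD('n)"
          using lf by (intro power_mono add_right_mono mult_mono) auto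
        finally show "length (map enc_rows (Cs j)) \<le> (?F i * ?V i + 1) ^ CARD('n)" .
      qed (use lf in auto)
      finally show "vsize \<sigma> (acc (fst j) (snd j)) \<le> ?T (fst j)" unfolding ik by simp
    qed
  qed
  then show ?thesis by (simp add: acc_def Cs_def final_cells_def)
qed

text \<open>The reference point \<open>y\<close> of the cell, decoded from the output of the test
  for integer points.\<close>

definition point :: "'n inst \<Rightarrow> 'n row list \<Rightarrow> int ^ 'n" where
  "point i C = (SOME z. basic_out (first_enc i) C 1 1 = enc_vec z \<and> real_vec z \<in> polyhedron_of C)"

definition weights :: "'n inst \<Rightarrow> 'n row list \<Rightarrow> (real \<times> val) list" where
  "weights i C = map (\<lambda>t. (fst (snd t) (real_vec (point i C)), fst t)) (summands i)"

definition pos_weights :: "'n inst \<Rightarrow> 'n row list \<Rightarrow> (real \<times> val) list" where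
  "pos_weights i C = filter (\<lambda>w. fst w > 0) (weights i C)"

definition candidate :: "'n inst \<Rightarrow> 'n row list \<Rightarrow> val" where
  "candidate i C = (if pos_weights i C \<noteq> []
     then basic_out (conic_out (pos_weights i C)) C (eps_num i) (fine_den i) else enc_vec (point i C))"

lemma final_cells_props:
  assumes "i \<in> insts" and "C \<in> set (final_cells i)"
  shows "has_int C" and "polyhedron_of C \<in> \<P>" and "polyhedron_of C \<subseteq> polyhedron_of (rows_of i)"
  using cells_exact cell_mem cells_subset assms unfolding final_cells_def by blast+

lemma point:
  assumes "i \<in> insts" and "C \<in> set (final_cells i)"
  shows "basic_out (first_enc i) C 1 1 = enc_vec (point i C)" and "real_vec (point i C) \<in> polyhedron_of C"
proof -
  have "\<exists>z. basic_out (first_enc i) C 1 1 = enc_vec z \<and> real_vec z \<in> polyhedron_of C"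
    by (rule basic_out_point) (use first_enc_dom final_cells_props assms in auto)
  from someI_ex[OF this] show "basic_out (first_enc i) C 1 1 = enc_vec (point i C)"
    "real_vec (point i C) \<in> polyhedron_of C" unfolding point_def by auto
qed

lemma summand_value:
  assumes i: "i \<in> insts" and k: "k < length (summands i)" and z: "real_vec z \<in> polyhedron_of (rows_of i)"
  shows "answers i (VList [VInt (int k + 1), enc_vec z]) = Some (VNum (fst (snd (summands i ! k)) (real_vec z)))"
    and "fst (snd (summands i ! k)) (real_vec z) \<in> K"
    and "\<sigma> (fst (snd (summands i ! k)) (real_vec z)) \<le>
      b * (vsize \<sigma> (enc_instance (summands i) (rows_of i)) + vsize \<sigma> (enc_vec z)) ^ b"
    and "fst (snd (summands i ! k)) (real_vec z) \<ge> 0"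
    and "fst (summands i ! k) \<in> dom dec"
proof -
  have zP: "real_vec z \<in> \<Union>\<P>" using z inst_region[OF i] by blast
  have "evaluation_oracle K (answers i) (int k + 1) (\<Union>\<P>) (fst (snd (summands i ! k)))"
    using i k by (simp add: insts_def)
  then show "answers i (VList [VInt (int k + 1), enc_vec z]) = Some (VNum (fst (snd (summands i ! k)) (real_vec z)))"
    "fst (snd (summands i ! k)) (real_vec z) \<in> K" using zP unfolding evaluation_oracle_def by blast+
  obtain u s cs \<zeta> where t: "summands i ! k = (u, s, cs, \<zeta>)" by (rule prod_cases4)
  then have "(u, s, cs, \<zeta>) \<in> set (summands i)" using nth_mem[OF k] by simp
  note p = inst_summand[OF i this]
  show "\<sigma> (fst (snd (summands i ! k)) (real_vec z)) \<le>
      b * (vsize \<sigma> (enc_instance (summands i) (rows_of i)) + vsize \<sigma> (enc_vec z)) ^ b"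
    using p(4) z unfolding t answers_bounded_def by simp
  have "sliceable s (polyhedron_of (rows_of i))"
    using p(2) inst_region[OF i] unfolding sliceable_functions_def by blast
  then show "fst (snd (summands i ! k)) (real_vec z) \<ge> 0"
    using z unfolding t sliceable_def by simp
  show "fst (summands i ! k) \<in> dom dec" using p(1) t by simp
qed

text \<open>The scalars are values of the evaluation oracles and therefore lie in
  \<open>K\<close>.\<close>

lemma pos_weights_valid:
  assumes "i \<in> insts" and "C \<in> set (final_cells i)"
  shows "\<forall>(r, u) \<in> set (pos_weights i C). r \<in> K \<and> r > 0 \<and> u \<in> dom dec"
proof
  fix w assume "w \<in> set (pos_weights i C)"
  then obtain k where k: "k < length (summands i)" "fst w > 0"
    "w = (fst (snd (summands i ! k)) (real_vec (point i C)), fst (summands i ! k))"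
    by (auto simp: pos_weights_def weights_def in_set_conv_nth)
  have "real_vec (point i C) \<in> polyhedron_of (rows_of i)"
    using point(2)[OF assms] final_cells_props(3)[OF assms] by blast
  from summand_value(2,5)[OF assms(1) k(1) this] show "case w of (r, u) \<Rightarrow> r \<in> K \<and> r > 0 \<and> u \<in> dom dec"
    using k by simp
qed

text \<open>An arbitrary set of pairs, because a case distinction restricts the index set
  (\<open>poly_comp_if\<close>), and these facts are also used inside the cases of
  \<open>candidate\<close>.\<close>

context
  fixes J :: "('n inst \<times> 'n row list) set"
  assumes J: "J \<subseteq> {j. fst j \<in> insts \<and> snd j \<in> set (final_cells (fst j))}"
begin

abbreviation cell_comp :: "('n inst \<times> 'n row list \<Rightarrow> val) \<Rightarrow> bool" where
  "cell_comp f \<equiv> poly_comp \<sigma> J (\<lambda>j. answers (fst j)) (\<lambda>j. inst_size \<sigma> (fst j))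
    (\<lambda>j. enc_rows (snd j) # inst_env (fst j)) f"

lemma cell_env_poly:
  "poly_env \<sigma> J (\<lambda>j. inst_size \<sigma> (fst j)) (\<lambda>j. enc_rows (snd j) # inst_env (fst j))"
proof (rule poly_env_Cons)
  show "poly_env \<sigma> J (\<lambda>j. inst_size \<sigma> (fst j)) (\<lambda>j. inst_env (fst j))"
    by (rule poly_env_fst[OF inst_env_poly]) (use J in auto)
  have "poly_bdd J (\<lambda>j. inst_size \<sigma> (fst j)) (\<lambda>j. vsize \<sigma> (VList (map enc_rows (final_cells (fst j)))))"
    by (rule poly_bdd_fst[OF inst_comp_bdd[OF comp_final_cells]]) (use J in auto)
  then show "poly_bdd J (\<lambda>j. inst_size \<sigma> (fst j)) (\<lambda>j. vsize \<sigma> (enc_rows (snd j)))"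
    by (rule poly_bdd_mono) (rule vsize_nth_le, use J in auto)
qed

lemma comp_point: "cell_comp (\<lambda>j. enc_vec (point (fst j) (snd j)))"
proof (rule poly_comp_cong)
  show "cell_comp (\<lambda>j. basic_out (first_enc (fst j)) (snd j) 1 1)"
  proof (rule poly_comp_basic_1[OF _ poly_comp_head])
    show "cell_comp (\<lambda>j. first_enc (fst j))"
      by (rule poly_comp_weaken, rule inst_comp_lift[OF comp_first_enc]) (use J in auto)
  qed (use J final_cells_props(2) first_enc_dom in blast)
qed (use J point(1) in auto)

lemma comp_weights: "cell_comp (\<lambda>j. VList (map enc_term (weights (fst j) (snd j))))"
proof (rule poly_comp_let[OF comp_point])
  let ?E = "\<lambda>j. enc_vec (point (fst j) (snd j)) # enc_rows (snd j) # inst_env (fst j)"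
  let ?orc = "\<lambda>j :: 'n inst \<times> 'n row list. answers (fst j)"
  let ?S = "\<lambda>j :: 'n inst \<times> 'n row list. inst_size \<sigma> (fst j)"
  have "poly_comp \<sigma> J ?orc ?S ?E (\<lambda>j. VList (map
      (\<lambda>k. enc_term (fst (snd (summands (fst j) ! k)) (real_vec (point (fst j) (snd j))), fst (summands (fst j) ! k)))
      [0..<length (summands (fst j))]))"
  \<comment> \<open>The map runs over positions because the function of the \<open>k\<close>-th
    summand, counted from 0, answers to the tag \<open>k + 1\<close>.\<close>
  proof (rule poly_comp_map_idx[where ey = "\<lambda>_. enc_summand"])
    show "poly_comp \<sigma> J ?orc ?S ?E (\<lambda>j. VList (map enc_summand (summands (fst j))))"
      by (rule poly_comp_weaken, rule poly_comp_weaken, rule inst_comp_lift[OF comp_summands]) (use J in auto)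
    let ?J1 = "{m. fst m \<in> J \<and> snd m < length (summands (fst (fst m)))}"
    let ?E1 = "\<lambda>m. VInt (int (snd m)) # enc_summand (summands (fst (fst m)) ! snd m) # ?E (fst m)"
    let ?v = "\<lambda>m. VNum (fst (snd (summands (fst (fst m)) ! snd m)) (real_vec (point (fst (fst m)) (snd (fst m)))))"
    have pt: "fst (fst m) \<in> insts" "real_vec (point (fst (fst m)) (snd (fst m))) \<in> polyhedron_of (rows_of (fst (fst m)))"
      if "m \<in> ?J1" for m
      using that J point(2)[of "fst (fst m)" "snd (fst m)"] final_cells_props(3)[of "fst (fst m)" "snd (fst m)"] by auto
    have q: "poly_comp \<sigma> ?J1 (\<lambda>m. ?orc (fst m)) (\<lambda>m. ?S (fst m)) ?E1 ?v"
    proof (rule poly_comp_query)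
      show "poly_comp \<sigma> ?J1 (\<lambda>m. ?orc (fst m)) (\<lambda>m. ?S (fst m)) ?E1
        (\<lambda>m. VList [VInt (int (snd m) + 1), enc_vec (point (fst (fst m)) (snd (fst m)))])"
        by (intro poly_comp_Cons poly_comp_Nil poly_comp_add poly_comp_int poly_comp_head poly_comp_third)
      show "?orc (fst m) (VList [VInt (int (snd m) + 1), enc_vec (point (fst (fst m)) (snd (fst m)))]) = Some (?v m)"
        if m: "m \<in> ?J1" for m
        by (rule summand_value(1)[OF pt(1)[OF m] _ pt(2)[OF m]]) (use m in simp)
      let ?T = "\<lambda>j. 1 + b * (vsize \<sigma> (enc_instance (summands (fst j)) (rows_of (fst j))) +
         vsize \<sigma> (enc_vec (point (fst j) (snd j)))) ^ b"
      have 1: "poly_bdd J ?S (\<lambda>j. vsize \<sigma> (enc_instance (summands (fst j)) (rows_of (fst j))))"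
        by (rule poly_bdd_fst[OF inst_comp_bdd[OF comp_instance]]) (use J in auto)
      have "poly_bdd J ?S ?T"
        by (intro poly_bdd_add poly_bdd_mult poly_bdd_power poly_bdd_const 1 poly_comp_vsize[OF comp_point cell_env_poly])
      then have "poly_bdd ?J1 (\<lambda>m. ?S (fst m)) (\<lambda>m. ?T (fst m))" by (rule poly_bdd_fst) auto
      then show "poly_bdd ?J1 (\<lambda>m. ?S (fst m)) (\<lambda>m. vsize \<sigma> (?v m))"
      proof (rule poly_bdd_mono)
        fix m assume m: "m \<in> ?J1"
        show "vsize \<sigma> (?v m) \<le> ?T (fst m)"
          using summand_value(3)[OF pt(1)[OF m] _ pt(2)[OF m], of "snd m"] m by simp
      qed
    qed
    show "poly_comp \<sigma> ?J1 (\<lambda>m. ?orc (fst m)) (\<lambda>m. ?S (fst m)) ?E1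
      (\<lambda>m. enc_term (fst (snd (summands (fst (fst m)) ! snd m)) (real_vec (point (fst (fst m)) (snd (fst m)))),
         fst (summands (fst (fst m)) ! snd m)))"
      unfolding enc_term_def fst_conv snd_conv
      by (intro poly_comp_Cons poly_comp_Nil q) (rule poly_comp_summand_enc[OF poly_comp_second])
  qed
  moreover have "map (\<lambda>k. enc_term (fst (snd (summands i ! k)) (real_vec (point i C)), fst (summands i ! k)))
      [0..<length (summands i)] = map enc_term (weights i C)" for i C
    by (rule nth_equalityI) (auto simp: weights_def)
  ultimately show "poly_comp \<sigma> J ?orc ?S ?E (\<lambda>j. VList (map enc_term (weights (fst j) (snd j))))" by simp
qed

lemma comp_pos_weights: "cell_comp (\<lambda>j. VList (map enc_term (pos_weights (fst j) (snd j))))"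
  unfolding pos_weights_def
proof (rule poly_comp_filter[where ey = "\<lambda>_. enc_term", OF comp_weights])
  let ?J1 = "{m. fst m \<in> J \<and> snd m \<in> set (weights (fst (fst m)) (snd (fst m)))}"
  let ?E1 = "\<lambda>m. enc_term (snd m) # enc_rows (snd (fst m)) # inst_env (fst (fst m))"
  have "poly_comp \<sigma> ?J1 (\<lambda>m. answers (fst (fst m))) (\<lambda>m. inst_size \<sigma> (fst (fst m))) ?E1 (\<lambda>m. VNum (fst (snd m)))"
    unfolding enc_term_def by (rule poly_comp_hd, rule poly_comp_head)
  from poly_comp_num_less[OF poly_comp_num_const[of _ _ _ _ _ 0] this]
  show "poly_comp \<sigma> ?J1 (\<lambda>m. answers (fst (fst m))) (\<lambda>m. inst_size \<sigma> (fst (fst m))) ?E1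
    (\<lambda>m. VInt (of_bool (fst (snd m) > 0)))" by simp
qed

end

lemma comp_candidate:
  "poly_comp \<sigma> {j. fst j \<in> insts \<and> snd j \<in> set (final_cells (fst j))}
    (\<lambda>j. answers (fst j)) (\<lambda>j. inst_size \<sigma> (fst j))
    (\<lambda>j. enc_rows (snd j) # inst_env (fst j)) (\<lambda>j. candidate (fst j) (snd j))"
  unfolding candidate_def
proof (rule poly_comp_if)
  let ?J = "{j. fst j \<in> insts \<and> snd j \<in> set (final_cells (fst j))}"
  show "poly_comp \<sigma> ?J (\<lambda>j. answers (fst j)) (\<lambda>j. inst_size \<sigma> (fst j))
    (\<lambda>j. enc_rows (snd j) # inst_env (fst j)) (\<lambda>j. kind_val (VList (map enc_term (pos_weights (fst j) (snd j)))))"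
    by (rule poly_comp_kind[OF comp_pos_weights]) simp
  let ?J1 = "{j \<in> ?J. pos_weights (fst j) (snd j) \<noteq> []}"
  have J1: "?J1 \<subseteq> ?J" by blast
  show "poly_comp \<sigma> ?J1 (\<lambda>j. answers (fst j)) (\<lambda>j. inst_size \<sigma> (fst j))
    (\<lambda>j. enc_rows (snd j) # inst_env (fst j))
    (\<lambda>j. basic_out (conic_out (pos_weights (fst j) (snd j))) (snd j) (eps_num (fst j)) (fine_den (fst j)))"
  proof (rule poly_comp_basic[OF _ poly_comp_head])
    show "poly_comp \<sigma> ?J1 (\<lambda>j. answers (fst j)) (\<lambda>j. inst_size \<sigma> (fst j))
      (\<lambda>j. enc_rows (snd j) # inst_env (fst j)) (\<lambda>j. conic_out (pos_weights (fst j) (snd j)))"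
      by (rule poly_comp_conic[OF comp_pos_weights[OF J1]]) (use pos_weights_valid in blast)
    show "poly_comp \<sigma> ?J1 (\<lambda>j. answers (fst j)) (\<lambda>j. inst_size \<sigma> (fst j))
      (\<lambda>j. enc_rows (snd j) # inst_env (fst j)) (\<lambda>j. VInt (eps_num (fst j)))"
      by (rule poly_comp_weaken, rule inst_comp_lift[OF comp_eps_num]) auto
    show "poly_comp \<sigma> ?J1 (\<lambda>j. answers (fst j)) (\<lambda>j. inst_size \<sigma> (fst j))
      (\<lambda>j. enc_rows (snd j) # inst_env (fst j)) (\<lambda>j. VInt (fine_den (fst j)))"
      by (rule poly_comp_weaken, rule inst_comp_lift[OF comp_fine_den]) auto
    show "poly_bdd ?J1 (\<lambda>j. inst_size \<sigma> (fst j)) (\<lambda>j. nat \<lceil>real_of_int (fine_den (fst j)) / real_of_int (eps_num (fst j))\<rceil>)"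
      by (rule poly_bdd_fst[OF ratio_bdd]) auto
    fix j assume j: "j \<in> ?J1"
    then have i: "fst j \<in> insts" "snd j \<in> set (final_cells (fst j))" by auto
    have "conic_out (pos_weights (fst j) (snd j)) \<in> dom dec"
      using conic[of "pos_weights (fst j) (snd j)"] pos_weights_valid[OF i] j by blast
    moreover have "eps_num (fst j) > 0" using i by (simp add: insts_def)
    ultimately show "conic_out (pos_weights (fst j) (snd j)) \<in> dom dec \<and> polyhedron_of (snd j) \<in> \<P> \<and>
        eps_num (fst j) > 0 \<and> fine_den (fst j) > 0"
      using final_cells_props(2)[OF i] ratio_props(4)[OF i(1)] by simp
  qed
  show "poly_comp \<sigma> {j \<in> ?J. \<not> pos_weights (fst j) (snd j) \<noteq> []} (\<lambda>j. answers (fst j)) (\<lambda>j. inst_size \<sigma> (fst j))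
    (\<lambda>j. enc_rows (snd j) # inst_env (fst j)) (\<lambda>j. enc_vec (point (fst j) (snd j)))"
    by (rule comp_point) blast
qed simp

definition chosen :: "'n inst \<Rightarrow> 'n row list \<Rightarrow> int ^ 'n" where
  "chosen i C = (SOME z. candidate i C = enc_vec z \<and>
     real_vec z \<in> polyhedron_of C \<and>
     (pos_weights i C \<noteq> [] \<longrightarrow> eps_approx (the (dec (conic_out (pos_weights i C)))) (polyhedron_of C)
       (real_of_int (eps_num i) / real_of_int (fine_den i)) (real_vec z)) \<and>
     (pos_weights i C = [] \<longrightarrow> z = point i C))"

lemma chosen:
  assumes "i \<in> insts" and "C \<in> set (final_cells i)"
  shows "candidate i C = enc_vec (chosen i C)" and "real_vec (chosen i C) \<in> polyhedron_of C"
    and "pos_weights i C \<noteq> [] \<Longrightarrow> eps_approx (the (dec (conic_out (pos_weights i C)))) (polyhedron_of C)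
       (real_of_int (eps_num i) / real_of_int (fine_den i)) (real_vec (chosen i C))"
    and "pos_weights i C = [] \<Longrightarrow> chosen i C = point i C"
proof -
  have "\<exists>z. candidate i C = enc_vec z \<and>
     real_vec z \<in> polyhedron_of C \<and>
     (pos_weights i C \<noteq> [] \<longrightarrow> eps_approx (the (dec (conic_out (pos_weights i C)))) (polyhedron_of C)
       (real_of_int (eps_num i) / real_of_int (fine_den i)) (real_vec z)) \<and>
     (pos_weights i C = [] \<longrightarrow> z = point i C)"
  proof (cases "pos_weights i C = []")
    case True
    then show ?thesis using point(2)[OF assms] by (auto simp: candidate_def)
  next
    case False
    have "conic_out (pos_weights i C) \<in> dom dec" using conic[OF False pos_weights_valid[OF assms]] by blast
    from basic_approx[OF this final_cells_props(2)[OF assms], of "eps_num i" "fine_den i"]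
    obtain z where "basic_out (conic_out (pos_weights i C)) C (eps_num i) (fine_den i) = enc_vec z"
      "eps_approx (the (dec (conic_out (pos_weights i C)))) (polyhedron_of C)
        (real_of_int (eps_num i) / real_of_int (fine_den i)) (real_vec z)"
      using assms(1) ratio_props(4)[OF assms(1)] final_cells_props(1)[OF assms] by (auto simp: insts_def has_int_def)
    then show ?thesis using False by (intro exI[of _ z]) (auto simp: candidate_def eps_approx_def)
  qed
  from someI_ex[OF this, folded chosen_def] show "candidate i C = enc_vec (chosen i C)" "real_vec (chosen i C) \<in> polyhedron_of C"
    "pos_weights i C \<noteq> [] \<Longrightarrow> eps_approx (the (dec (conic_out (pos_weights i C)))) (polyhedron_of C)
       (real_of_int (eps_num i) / real_of_int (fine_den i)) (real_vec (chosen i C))"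
    "pos_weights i C = [] \<Longrightarrow> chosen i C = point i C" by auto
qed

section \<open>Choosing among the candidates\<close>

definition chosen_points :: "'n inst \<Rightarrow> (int ^ 'n) list" where
  "chosen_points i = map (chosen i) (final_cells i)"

definition obj :: "'n inst \<Rightarrow> int ^ 'n \<Rightarrow> real" where
  "obj i z = sum_of_products dec (summands i) (real_vec z)"

definition better :: "'n inst \<Rightarrow> int ^ 'n \<Rightarrow> int ^ 'n \<Rightarrow> int ^ 'n" where
  "better i a z = (if obj i z < obj i a then z else a)"

text \<open>The first point also starts the fold and is then compared with itself; this spares a
  default point.\<close>

definition best :: "'n inst \<Rightarrow> nat \<Rightarrow> int ^ 'n" where
  "best i k = foldl (better i) (hd (chosen_points i)) (take k (chosen_points i))"

definition best_output :: "'n inst \<Rightarrow> val" where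
  "best_output i = (if chosen_points i \<noteq> [] then enc_vec (best i (length (chosen_points i))) else VInt 0)"

lemma foldl_better: "foldl (better i) a zs \<in> insert a (set zs) \<and> (\<forall>z\<in>insert a (set zs). obj i (foldl (better i) a zs) \<le> obj i z)"
proof (induction zs rule: rev_induct)
  case (snoc z zs)
  then show ?case by (fastforce simp: better_def)
qed simp

lemma best_mem: "chosen_points i \<noteq> [] \<Longrightarrow> best i k \<in> set (chosen_points i)"
  using foldl_better[of i "hd (chosen_points i)" "take k (chosen_points i)"] set_take_subset[of k "chosen_points i"]
  unfolding best_def by auto

lemma best_le: "z \<in> set (chosen_points i) \<Longrightarrow> obj i (best i (length (chosen_points i))) \<le> obj i z"
  using foldl_better[of i "hd (chosen_points i)" "chosen_points i"] unfolding best_def by simp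

lemma chosen_points_mem:
  "i \<in> insts \<Longrightarrow> z \<in> set (chosen_points i) \<Longrightarrow> real_vec z \<in> polyhedron_of (rows_of i)"
  using chosen(2) final_cells_props(3) unfolding chosen_points_def by fastforce

lemma comp_chosen_points: "inst_comp (\<lambda>i. VList (map enc_vec (chosen_points i)))"
proof (rule poly_comp_cong)
  show "inst_comp (\<lambda>i. VList (map (candidate i) (final_cells i)))"
    by (rule poly_comp_map[OF comp_final_cells comp_candidate])
qed (auto simp: chosen_points_def chosen(1))

lemma obj_query:
  assumes i: "i \<in> insts" and z: "z \<in> set (chosen_points i)"
  shows "answers i (VList [VInt 0, enc_vec z]) = Some (VNum (obj i z))"
    and "vsize \<sigma> (VNum (obj i z)) \<le> 1 + b * (vsize \<sigma> (enc_instance (summands i) (rows_of i)) +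
      vsize \<sigma> (VList (map enc_vec (chosen_points i)))) ^ b"
proof -
  have P: "real_vec z \<in> polyhedron_of (rows_of i)" by (rule chosen_points_mem[OF assms])
  then have "real_vec z \<in> \<Union>\<P>" using inst_region[OF i] by blast
  then show "answers i (VList [VInt 0, enc_vec z]) = Some (VNum (obj i z))"
    using i unfolding insts_def evaluation_oracle_def obj_def by blast
  have "\<sigma> (obj i z) \<le> b * (vsize \<sigma> (enc_instance (summands i) (rows_of i)) + vsize \<sigma> (enc_vec z)) ^ b"
    using i P unfolding insts_def answers_bounded_def obj_def by blast
  also have "vsize \<sigma> (enc_vec z) \<le> vsize \<sigma> (VList (map enc_vec (chosen_points i)))"
    by (rule vsize_nth_le) (use z in simp)
  finally show "vsize \<sigma> (VNum (obj i z)) \<le> 1 + b * (vsize \<sigma> (enc_instance (summands i) (rows_of i)) +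
      vsize \<sigma> (VList (map enc_vec (chosen_points i)))) ^ b"
    by (simp add: mult_le_mono2 power_mono)
qed

text \<open>The \<open>g_j\<close> are given by encodings without an evaluation oracle of their own,
  so candidates are compared by querying \<open>f\<close> itself, under the tag 0.\<close>

lemma comp_best_output: "inst_comp best_output"
  unfolding best_output_def
proof (rule poly_comp_if)
  show "inst_comp (\<lambda>i. kind_val (VList (map enc_vec (chosen_points i))))"
    by (rule poly_comp_kind[OF comp_chosen_points])
  let ?I = "{i \<in> insts. chosen_points i \<noteq> []}"
  let ?xs = "\<lambda>i. map enc_vec (chosen_points i)"
  have xs: "poly_comp \<sigma> ?I answers (inst_size \<sigma>) inst_env (\<lambda>i. VList (?xs i))"
    by (rule inst_comp_lift[where \<pi> = "\<lambda>i. i", OF comp_chosen_points]) auto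
  have "poly_comp \<sigma> ?I answers (inst_size \<sigma>) inst_env (\<lambda>i. enc_vec (best i (length (?xs i))))"
  proof (rule poly_comp_fold[OF xs])
    have "poly_comp \<sigma> ?I answers (inst_size \<sigma>) inst_env
        (\<lambda>i. VList (enc_vec (hd (chosen_points i)) # map enc_vec (tl (chosen_points i))))"
      by (rule poly_comp_cong[OF xs]) (auto simp: list.map(2)[symmetric] simp del: list.map(2))
    from poly_comp_hd[OF this] show "poly_comp \<sigma> ?I answers (inst_size \<sigma>) inst_env (\<lambda>i. enc_vec (best i 0))"
      by (simp add: best_def)
    let ?J = "{j. fst j \<in> ?I \<and> snd j < length (?xs (fst j))}"
    let ?orc = "\<lambda>j :: 'n inst \<times> nat. answers (fst j)" and ?S = "\<lambda>j :: 'n inst \<times> nat. inst_size \<sigma> (fst j)"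
    let ?a = "\<lambda>j. best (fst j) (snd j)" and ?z = "\<lambda>j. chosen_points (fst j) ! snd j"
    let ?E = "\<lambda>j. enc_vec (?a j) # enc_vec (?z j) # inst_env (fst j)"
    have memb: "fst j \<in> insts" "?a j \<in> set (chosen_points (fst j))" "?z j \<in> set (chosen_points (fst j))"
      if "j \<in> ?J" for j using that best_mem by auto
    have query: "poly_comp \<sigma> ?J ?orc ?S ?E (\<lambda>j. VNum (obj (fst j) (w j)))"
      if w: "poly_comp \<sigma> ?J ?orc ?S ?E (\<lambda>j. enc_vec (w j))"
        and mem: "\<And>j. j \<in> ?J \<Longrightarrow> w j \<in> set (chosen_points (fst j))" for w
    proof (rule poly_comp_query)
      show "poly_comp \<sigma> ?J ?orc ?S ?E (\<lambda>j. VList [VInt 0, enc_vec (w j)])"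
        by (intro poly_comp_Cons poly_comp_Nil poly_comp_int w)
      show "?orc j (VList [VInt 0, enc_vec (w j)]) = Some (VNum (obj (fst j) (w j)))" if "j \<in> ?J" for j
        by (rule obj_query(1)[OF memb(1)[OF that] mem[OF that]])
      let ?T = "\<lambda>i. 1 + b * (vsize \<sigma> (enc_instance (summands i) (rows_of i)) + vsize \<sigma> (VList (?xs i))) ^ b"
      have T: "poly_bdd insts (inst_size \<sigma>) ?T"
        by (intro poly_bdd_add poly_bdd_mult poly_bdd_power poly_bdd_const inst_comp_bdd comp_instance comp_chosen_points)
      have "poly_bdd ?J ?S (\<lambda>j. ?T (fst j))" by (rule poly_bdd_fst[OF T]) auto
      then show "poly_bdd ?J ?S (\<lambda>j. vsize \<sigma> (VNum (obj (fst j) (w j))))"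
        by (rule poly_bdd_mono) (rule obj_query(2)[OF memb(1) mem])
    qed
    have qa: "poly_comp \<sigma> ?J ?orc ?S ?E (\<lambda>j. VNum (obj (fst j) (?a j)))"
      by (rule query[OF poly_comp_head]) (rule memb(2))
    have qz: "poly_comp \<sigma> ?J ?orc ?S ?E (\<lambda>j. VNum (obj (fst j) (?z j)))"
      by (rule query[OF poly_comp_second]) (rule memb(3))
    have "poly_comp \<sigma> ?J ?orc ?S ?E
      (\<lambda>j. if obj (fst j) (?z j) < obj (fst j) (?a j) then enc_vec (?z j) else enc_vec (?a j))"
      by (intro poly_comp_If poly_comp_num_less qa qz poly_comp_head poly_comp_second)
    then show "poly_comp \<sigma> ?J ?orc ?S (\<lambda>j. enc_vec (?a j) # ?xs (fst j) ! snd j # inst_env (fst j))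
        (\<lambda>j. enc_vec (best (fst j) (Suc (snd j))))"
      by (rule poly_comp_cong) (auto simp: best_def take_Suc_conv_app_nth better_def)
    let ?J' = "{j. fst j \<in> ?I \<and> snd j \<le> length (?xs (fst j))}"
    have "poly_bdd ?J' ?S (\<lambda>j. vsize \<sigma> (VList (?xs (fst j))))"
      by (rule poly_bdd_fst[OF inst_comp_bdd[OF comp_chosen_points]]) auto
    then show "poly_bdd ?J' ?S (\<lambda>j. vsize \<sigma> (enc_vec (?a j)))"
      by (rule poly_bdd_mono) (rule vsize_nth_le, use best_mem in auto)
  qed
  then show "poly_comp \<sigma> ?I answers (inst_size \<sigma>) inst_env (\<lambda>i. enc_vec (best i (length (chosen_points i))))"
    by simp
qed (auto intro: poly_comp_int)

end


text \<open>The number 7 is \<open>3 + 3 + 1\<close>, the sum of the binomial coefficients in front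
  of the positive powers of \<open>e\<close>, which suffices while \<open>e \<le> 1\<close>.
  Dividing by \<open>p + q\<close> instead of \<open>q\<close> keeps \<open>e\<close> below
  \<open>1 / 7\<close> however large \<open>p / q\<close> is.\<close>

lemma fine_accuracy:
  assumes "(p::real) > 0" and "q > 0"
  shows "(1 + p / (7 * (p + q))) ^ 3 \<le> 1 + p / q"
proof -
  define e where "e = p / (7 * (p + q))"
  have e: "0 < e" "e \<le> 1 / 7" using assms by (auto simp: e_def field_simps)
  have "e * e \<le> e * (1 / 7)" using e by (intro mult_left_mono) auto
  moreover have "e * (e * e) \<le> e * (1 / 7)"
  proof (intro mult_left_mono)
    have "e * e \<le> 1 / 7 * 1" using e by (intro mult_mono) auto
    then show "e * e \<le> 1 / 7" by simp
  qed (use e in simp)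
  moreover have "(1 + e) ^ 3 = 1 + 3 * e + 3 * (e * e) + e * (e * e)"
    by (simp add: power3_eq_cube algebra_simps)
  ultimately have "(1 + e) ^ 3 \<le> 1 + 7 * e" using e by linarith
  also have "7 * e = p / (p + q)"
    unfolding e_def times_divide_eq_right by (rule mult_divide_mult_cancel_left) simp
  also have "1 + p / (p + q) \<le> 1 + p / q" using assms by (simp add: frac_le)
  finally show ?thesis unfolding e_def .
qed

context basic_scheme
begin

section \<open>Correctness of the output\<close>

lemma cell_ratio:
  assumes i: "i \<in> insts" and C: "C \<in> set (final_cells i)" and k: "k < length (summands i)"
    and xy: "x \<in> polyhedron_of C \<inter> int_points" "y \<in> polyhedron_of C \<inter> int_points"
  shows "fst (snd (summands i ! k)) x \<le>
    (1 + real_of_int (eps_num i) / real_of_int (fine_den i)) * fst (snd (summands i ! k)) y"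
proof -
  obtain u s cs \<zeta> where t: "summands i ! k = (u, s, cs, \<zeta>)" by (rule prod_cases4)
  then have mem: "(u, s, cs, \<zeta>) \<in> set (summands i)" using nth_mem[OF k] by simp
  note r = ratio_props[OF i]
  have p: "eps_num i > 0" using i by (simp add: insts_def)
  let ?\<delta> = "real_of_int (eps_num i) / real_of_int (ratio_den i)"
  have "s x \<le> (1 + real_of_int (eps_num i) / real_of_int (fine_den i)) * s y"
  proof (rule cell_slicing[OF r(1,2) _ _ C[unfolded final_cells_def intervals_def] inst_summand(3)[OF i mem] _ _ _ xy])
    show "1 + ?\<delta> = real_of_int (ratio_num i) / real_of_int (ratio_den i)"
      using r by (simp add: ratio_num_def add_divide_distrib)
    show "0 < ?\<delta>" using p r by simp
    show "set cs \<subseteq> set (forms i)" using mem by (force simp: forms_def)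
    have z: "1 \<le> zeta i" "\<zeta> \<le> zeta i" using zeta_ge_1[OF i] zeta_ge(2)[OF i mem] by auto
    have "real \<zeta> * ?\<delta> \<le> real (zeta i) * ?\<delta>" using z p r by (intro mult_right_mono) auto
    also have "\<dots> = real_of_int (eps_num i) / real_of_int (fine_den i)"
      using z by (simp add: ratio_den_def)
    finally show "real \<zeta> * ?\<delta> \<le> real_of_int (eps_num i) / real_of_int (fine_den i)" .
    fix x assume "x \<in> polyhedron_of (rows_of i)"
    then show "s x \<ge> 0"
      using inst_summand(2)[OF i mem] inst_region[OF i] unfolding sliceable_functions_def sliceable_def by blast
  qed
  then show ?thesis by (simp add: t)
qed

lemma sum_of_products_nth:
  "sum_of_products dec ts x = (\<Sum>k<length ts. the (dec (fst (ts ! k))) x * fst (snd (ts ! k)) x)"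
  by (simp add: sum_of_products_def sum_list_sum_nth case_prod_beta' atLeast0LessThan)

text \<open>The weights are nonnegative, so those that were dropped are 0 and the combination of the
  others is already the full sum over all summands.\<close>

lemma conic_out_value:
  assumes i: "i \<in> insts" and C: "C \<in> set (final_cells i)" and ne: "pos_weights i C \<noteq> []"
  shows "the (dec (conic_out (pos_weights i C))) x = (\<Sum>k<length (summands i).
    the (dec (fst (summands i ! k))) x * fst (snd (summands i ! k)) (real_vec (point i C)))"
proof -
  let ?y = "real_vec (point i C)"
  have y: "?y \<in> polyhedron_of (rows_of i)" using point(2)[OF i C] final_cells_props(3)[OF i C] by blast
  have "the (dec (conic_out (pos_weights i C))) x = (\<Sum>w\<leftarrow>pos_weights i C. fst w * the (dec (snd w)) x)"
    using conic[OF ne pos_weights_valid[OF i C]] by (simp add: case_prod_beta')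
  also have "\<dots> = (\<Sum>w\<leftarrow>weights i C. if fst w > 0 then fst w * the (dec (snd w)) x else 0)"
    unfolding pos_weights_def by (rule sum_list_map_filter')
  also have "\<dots> = (\<Sum>w\<leftarrow>weights i C. fst w * the (dec (snd w)) x)"
  proof (intro arg_cong[where f = sum_list] map_cong refl)
    fix w assume "w \<in> set (weights i C)"
    then obtain k where "k < length (summands i)" "w = (fst (snd (summands i ! k)) ?y, fst (summands i ! k))"
      by (auto simp: weights_def in_set_conv_nth)
    then have "fst w \<ge> 0" using summand_value(4)[OF i _ y] by simp
    then show "(if fst w > 0 then fst w * the (dec (snd w)) x else 0) = fst w * the (dec (snd w)) x" by simp
  qed
  also have "\<dots> = (\<Sum>k<length (summands i).
    the (dec (fst (summands i ! k))) x * fst (snd (summands i ! k)) ?y)"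
    by (simp add: weights_def sum_list_sum_nth atLeast0LessThan mult.commute)
  finally show ?thesis .
qed

text \<open>Only a cell that contains an optimal solution matters. There \<open>u\<close> minimizes
  \<open>f\<close> on the cell too, so the estimate for the cell is an estimate against the global
  optimum.\<close>

lemma chosen_approx:
  assumes i: "i \<in> insts" and C: "C \<in> set (final_cells i)"
    and u: "u \<in> polyhedron_of C \<inter> int_points"
    and min: "\<And>x. x \<in> polyhedron_of (rows_of i) \<inter> int_points \<Longrightarrow>
      sum_of_products dec (summands i) u \<le> sum_of_products dec (summands i) x"
  shows "approx_min (real_of_int (eps_num i) / real_of_int (eps_den i))
    (sum_of_products dec (summands i) (real_vec (chosen i C))) (sum_of_products dec (summands i) u)"
proof -
  let ?F = "sum_of_products dec (summands i)"
  let ?e = "real_of_int (eps_num i) / real_of_int (fine_den i)"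
  let ?Q = "polyhedron_of C \<inter> int_points"
  let ?y = "real_vec (point i C)"
  let ?g = "\<lambda>k. the (dec (fst (summands i ! k)))" and ?s = "\<lambda>k. fst (snd (summands i ! k))"
  have iv: "real_vec v \<in> int_points" for v by (simp add: int_points_def)
  have y: "?y \<in> ?Q" using point(2)[OF i C] iv by blast
  note sub = final_cells_props(3)[OF i C]
  have pos: "?s k x \<ge> 0" if k: "k < length (summands i)" and x: "x \<in> ?Q" for k x
  proof -
    obtain v where v: "x = real_vec v" using x by (auto simp: int_points_def)
    have "real_vec v \<in> polyhedron_of (rows_of i)" using x sub unfolding v by blast
    then show ?thesis unfolding v by (rule summand_value(4)[OF i k])
  qed
  show ?thesis
  proof (cases "pos_weights i C = []")
    case True
    have sy: "?s k ?y = 0" if "k < length (summands i)" for k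
    proof -
      have "\<not> fst w > 0" if "w \<in> set (weights i C)" for w
        using True that unfolding pos_weights_def by (simp add: filter_empty_conv)
      moreover have "(?s k ?y, fst (summands i ! k)) \<in> set (weights i C)"
        using that by (force simp: weights_def)
      ultimately show ?thesis using pos[OF that y] by fastforce
    qed
    \<comment> \<open>Slicing bounds \<open>s_k\<close> on the cell by a multiple of its value at
      the reference point, which is 0.\<close>
    have "?s k x = 0" if "k < length (summands i)" "x \<in> ?Q" for k x
      using cell_ratio[OF i C that(1) that(2) y] pos[OF that] sy[OF that(1)] by simp
    then have "?F x = 0" if "x \<in> ?Q" for x using that unfolding sum_of_products_nth by simp
    then show ?thesis using u y chosen(4)[OF i C True] by (simp add: approx_min_def)
  next
    case False
    let ?h = "the (dec (conic_out (pos_weights i C)))"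
    obtain w where w: "is_arg_min ?h (\<lambda>x. x \<in> ?Q) w" "approx_min ?e (?h (real_vec (chosen i C))) (?h w)"
      using chosen(3)[OF i C False] unfolding eps_approx_iff by blast
    have e: "eps_num i > 0" "eps_den i > 0" using i by (auto simp: insts_def)
    show ?thesis
    proof (rule approx_min_cell[where J = "{..<length (summands i)}" and g = ?g and s = ?s and C = ?Q
          and y = ?y and h = ?h and F = ?F and e = ?e and w = w])
      show "?e > 0" using e ratio_props(4)[OF i] by simp
      show "(1 + ?e) ^ 3 \<le> 1 + real_of_int (eps_num i) / real_of_int (eps_den i)"
        using fine_accuracy[of "real_of_int (eps_num i)" "real_of_int (eps_den i)"] e
        by (simp add: fine_den_def)
      show "\<exists>k\<in>{..<length (summands i)}. ?s k ?y > 0"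
      proof -
        have "hd (pos_weights i C) \<in> set (pos_weights i C)" using False by simp
        then obtain t where "t \<in> set (summands i)" "fst (snd t) ?y > 0"
          by (auto simp: pos_weights_def weights_def)
        then show ?thesis unfolding in_set_conv_nth by blast
      qed
      show "sgn (?g j x) = sgn (?g k x)" if "j \<in> {..<length (summands i)}" "k \<in> {..<length (summands i)}" "x \<in> ?Q" for j k x
      proof (rule sign[OF _ _ final_cells_props(2)[OF i C]])
        have "?y \<in> polyhedron_of (rows_of i)" using y sub by blast
        from summand_value(5)[OF i _ this] show "?g j \<in> ran dec" "?g k \<in> ran dec"
          using that unfolding ran_def by force+
      qed (use that in blast)
      show "?F u \<le> ?F x" if "x \<in> ?Q" for x using min sub that by blast
      show "real_vec (chosen i C) \<in> ?Q" using chosen(2)[OF i C] iv by blast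
      show "?F x = (\<Sum>k\<in>{..<length (summands i)}. ?g k x * ?s k x)" for x by (rule sum_of_products_nth)
      show "?h x = (\<Sum>k\<in>{..<length (summands i)}. ?g k x * ?s k ?y)" for x
        by (rule conic_out_value[OF i C False])
      show "?s k x \<le> (1 + ?e) * ?s k x'" if "k \<in> {..<length (summands i)}" "x \<in> ?Q" "x' \<in> ?Q" for k x x'
        using cell_ratio[OF i C _ that(2,3)] that(1) by blast
      show "?s k x \<ge> 0" if "k \<in> {..<length (summands i)}" "x \<in> ?Q" for k x using pos that by blast
    qed (use y u w in auto)
  qed
qed

text \<open>The best candidate is no worse than that of a cell containing an optimal solution
  \<open>u\<close>, and as a feasible point no better than \<open>u\<close>; values in between are
  approximate as well.\<close>

lemma best_output_correct:
  assumes i: "i \<in> insts"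
  shows "if polyhedron_of (rows_of i) \<inter> int_points = {} then best_output i = VInt 0
    else \<exists>z. best_output i = enc_vec z \<and> eps_approx (sum_of_products dec (summands i)) (polyhedron_of (rows_of i))
      (real_of_int (eps_num i) / real_of_int (eps_den i)) (real_vec z)"
proof (cases "polyhedron_of (rows_of i) \<inter> int_points = {}")
  case True
  have "C \<notin> set (final_cells i)" for C
  proof
    assume "C \<in> set (final_cells i)"
    from final_cells_props(1,3)[OF i this] show False using True unfolding has_int_def by blast
  qed
  then have "final_cells i = []" by (metis last_in_set)
  then show ?thesis using True by (simp add: best_output_def chosen_points_def)
next
  case False
  let ?P = "polyhedron_of (rows_of i) \<inter> int_points" and ?F = "sum_of_products dec (summands i)"
  have "finite ?P" by (rule finite_int_points[OF inst_bounded[OF i]])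
  then obtain u where u: "is_arg_min ?F (\<lambda>x. x \<in> ?P) u" using ex_is_arg_min_if_finite False by blast
  then have uP: "u \<in> ?P" by (simp add: is_arg_min_linorder)
  have min: "?F u \<le> ?F x" if "x \<in> ?P" for x using u that by (simp add: is_arg_min_linorder)
  obtain C where C: "C \<in> set (final_cells i)" "u \<in> polyhedron_of C"
    using cells_cover[OF uP intervals_cover[OF i uP]] unfolding final_cells_def by blast
  let ?z = "best i (length (chosen_points i))"
  have mem: "chosen i C \<in> set (chosen_points i)" using C by (simp add: chosen_points_def)
  then have ne: "chosen_points i \<noteq> []" by auto
  have zP: "real_vec ?z \<in> ?P"
    using chosen_points_mem[OF i best_mem[OF ne]] by (auto simp: int_points_def)
  have "approx_min (real_of_int (eps_num i) / real_of_int (eps_den i)) (?F (real_vec (chosen i C))) (?F u)"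
    by (rule chosen_approx[OF i C(1)]) (use C uP min in blast)+
  moreover have "?F (real_vec ?z) \<le> ?F (real_vec (chosen i C))" using best_le[OF mem] by (simp add: obj_def)
  ultimately have "approx_min (real_of_int (eps_num i) / real_of_int (eps_den i)) (?F (real_vec ?z)) (?F u)"
    using min[OF zP] by (blast intro: approx_min_better)
  then have "eps_approx ?F (polyhedron_of (rows_of i))
      (real_of_int (eps_num i) / real_of_int (eps_den i)) (real_vec ?z)"
    unfolding eps_approx_iff using zP u by blast
  then show ?thesis using False ne by (auto simp: best_output_def)
qed

lemma product_fptas: "\<exists>alg. fptas \<sigma> alg (product_problems \<sigma> K b \<P> dec)"
proof -
  obtain c T where T: "poly_bdd insts (inst_size \<sigma>) T"
    "\<forall>i\<in>insts. \<exists>t\<le>T i. computes \<sigma> (answers i) c (VList (inst_env i)) t (best_output i)"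
    using comp_best_output inst_env_poly unfolding poly_comp_def by blast
  then obtain d where d: "\<And>i. i \<in> insts \<Longrightarrow> T i \<le> (2 + inst_size \<sigma> i) ^ d" unfolding poly_bdd_def by blast
  have "fptas \<sigma> c (product_problems \<sigma> K b \<P> dec)"
    unfolding fptas_def Let_def
  \<comment> \<open>\<open>fptas\<close> uses one number both as factor and as exponent. The
    estimate \<open>2 + inst_size \<sigma> i \<le> 4 * ?B\<close> produces the factor
    \<open>4 ^ d\<close>, and \<open>?B \<ge> 1\<close> allows the exponent to be raised from
    \<open>d\<close> to \<open>4 ^ d\<close>.\<close>
  proof (rule exI[of _ "4 ^ d"], intro ballI allI impI)
    fix X :: "'n problem" and p q :: int
    assume X: "X \<in> product_problems \<sigma> K b \<P> dec" and pq: "p > 0" "q > 0"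
    obtain ts rs orc where X': "X = \<lparr>input = enc_instance ts rs, orac = orc, objective = sum_of_products dec ts,
         region = polyhedron_of rs\<rparr>"
      "polyhedron_of rs \<in> \<P> \<and> ts \<noteq> [] \<and>
        (\<forall>(u, s, prm) \<in> set ts.
           u \<in> dom dec \<and> s \<in> sliceable_functions \<P> \<and>
           slicing_parameters s (polyhedron_of rs) prm \<and>
           answers_bounded \<sigma> b (enc_instance ts rs) (polyhedron_of rs) s) \<and>
        (\<forall>j < length ts. evaluation_oracle K orc (int j + 1) (\<Union>\<P>) (fst (snd (ts ! j)))) \<and>
        evaluation_oracle K orc 0 (\<Union>\<P>) (sum_of_products dec ts) \<and>
        answers_bounded \<sigma> b (enc_instance ts rs) (polyhedron_of rs) (sum_of_products dec ts)"
      using X unfolding product_problems_def by blast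
    define i where "i = \<lparr>summands = ts, rows_of = rs, answers = orc, eps_num = p, eps_den = q\<rparr>"
    have sel: "summands i = ts" "rows_of i = rs" "answers i = orc" "eps_num i = p" "eps_den i = q"
      by (simp_all add: i_def)
    have i: "i \<in> insts" unfolding insts_def i_def using X'(2) pq by simp
    have env: "VList (inst_env i) = VList [VInt p, VInt q, input X]" by (simp add: inst_env_def i_def X'(1))
    obtain t where t: "t \<le> T i" "computes \<sigma> (answers i) c (VList (inst_env i)) t (best_output i)"
      using T(2) i by blast
    let ?\<epsilon> = "real_of_int p / real_of_int q"
    let ?B = "1 / ?\<epsilon> + real (vsize \<sigma> (VList [VInt p, VInt q, input X]))"
    have vs: "real (vsize \<sigma> (VList [VInt p, VInt q, input X])) \<ge> 1" by simp
    have inv: "1 / ?\<epsilon> > 0" using pq by simp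
    \<comment> \<open>The 2 in \<open>poly_bdd\<close> and the rounding of
      \<open>1 / \<epsilon>\<close> add at most 3, which is covered since the input has size at
      least 1.\<close>
    have "real (2 + inst_size \<sigma> i) \<le> 4 * ?B"
    proof -
      have "real (nat \<lceil>real_of_int q / real_of_int p\<rceil>) \<le> 1 / ?\<epsilon> + 1"
        using pq by simp
      moreover have "real (inst_size \<sigma> i) = real (nat \<lceil>real_of_int q / real_of_int p\<rceil>) +
          real (vsize \<sigma> (VList [VInt p, VInt q, input X]))"
        unfolding inst_size_def env by (simp add: i_def)
      moreover have "real (2 + n) \<le> 4 * (a + m)" if "r \<le> a + 1" "real n = r + m" "m \<ge> 1" "a > 0"
        for n :: nat and a m r :: real
        using that by simp
      ultimately show ?thesis using vs inv by blast
    qed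
    then have "real (2 + inst_size \<sigma> i) ^ d \<le> (4 * ?B) ^ d" by (rule power_mono) simp
    also have "\<dots> = 4 ^ d * ?B ^ d" by (rule power_mult_distrib)
    also have "\<dots> \<le> 4 ^ d * ?B ^ (4 ^ d)"
    proof (intro mult_left_mono power_increasing)
      have "d < 2 ^ d" by (rule less_exp)
      also have "(2::nat) ^ d \<le> 4 ^ d" by (rule power_mono) auto
      finally show "d \<le> 4 ^ d" by simp
      show "1 \<le> ?B" using vs inv by linarith
    qed simp
    finally have "real ((2 + inst_size \<sigma> i) ^ d) \<le> real (4 ^ d) * ?B ^ (4 ^ d)" by simp
    moreover have "t \<le> (2 + inst_size \<sigma> i) ^ d" using t(1) d[OF i] by linarith
    ultimately have time: "real t \<le> real (4 ^ d) * ?B ^ (4 ^ d)" by (meson of_nat_mono order_trans)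
    have comp: "computes \<sigma> (orac X) c (VList [VInt p, VInt q, input X]) t (best_output i)"
      using t(2) unfolding env sel by (simp add: X'(1))
    have corr: "if region X \<inter> int_points = {} then best_output i = VInt 0
       else \<exists>z. best_output i = enc_vec z \<and> eps_approx (objective X) (region X) ?\<epsilon> (real_vec z)"
      using best_output_correct[OF i] unfolding sel by (simp add: X'(1))
    show "\<exists>t w. computes \<sigma> (orac X) c (VList [VInt p, VInt q, input X]) t w \<and>
        real t \<le> real (4 ^ d) * ?B ^ (4 ^ d) \<and>
        (if region X \<inter> int_points = {} then w = VInt 0
         else \<exists>z. w = enc_vec z \<and> eps_approx (objective X) (region X) ?\<epsilon> (real_vec z))"
      using comp time corr by blast
  qed
  then show ?thesis by blast
qed

end

theorem theorem2p1:
  fixes \<P> :: "(real ^ 'n::finite) set set"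
    and dec :: "val \<Rightarrow> (real ^ 'n \<Rightarrow> real) option"
    and K :: "real set"
    and \<sigma> :: "real \<Rightarrow> nat"
    and b :: nat
  assumes "\<forall>P \<in> \<P>. int_polytope P"
    and "closed_under_subpolytopes \<P>"
    and "basic_functions \<sigma> K \<P> dec"
  shows "\<exists>alg. fptas \<sigma> alg (product_problems \<sigma> K b \<P> dec)"
proof -
  note bf = assms(3)[unfolded basic_functions_def]
  have conic: "effective_conic \<sigma> K dec" using bf by (elim conjE)
  have basic: "\<exists>c. fptas \<sigma> c (basic_problems \<P> dec)" using bf by (elim conjE)
  have sign: "\<forall>f \<in> ran dec. \<forall>g \<in> ran dec. \<forall>P \<in> \<P>. \<forall>x \<in> P. sgn (f x) = sgn (g x)"
    using bf by (elim conjE)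
  obtain cB dB where B: "\<forall>X \<in> basic_problems \<P> dec. \<forall>p q :: int. p > 0 \<longrightarrow> q > 0 \<longrightarrow>
      (\<exists>t w. computes \<sigma> (orac X) cB (VList [VInt p, VInt q, input X]) t w \<and>
         real t \<le> real dB * (1 / (real_of_int p / real_of_int q) +
           real (vsize \<sigma> (VList [VInt p, VInt q, input X]))) ^ dB \<and>
         (if region X \<inter> int_points = {} then w = VInt 0
          else \<exists>z. w = enc_vec z \<and> eps_approx (objective X) (region X) (real_of_int p / real_of_int q) (real_vec z)))"
    using basic unfolding fptas_def Let_def by (elim exE) (rule that)
  have B': "\<exists>w. (\<exists>t. computes \<sigma> no_oracle cB (VList [VInt p, VInt q, VList [u, enc_rows rs]]) t w \<and>
         real t \<le> real dB * (1 / (real_of_int p / real_of_int q) +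
           real (vsize \<sigma> (VList [VInt p, VInt q, VList [u, enc_rows rs]]))) ^ dB) \<and>
         (if polyhedron_of rs \<inter> int_points = {} then w = VInt 0
          else \<exists>z. w = enc_vec z \<and>
            eps_approx (the (dec u)) (polyhedron_of rs) (real_of_int p / real_of_int q) (real_vec z))"
    if *: "u \<in> dom dec" "polyhedron_of rs \<in> \<P>" "p > 0" "q > 0" for u rs p q
  proof -
    let ?X = "\<lparr>input = VList [u, enc_rows rs], orac = no_oracle, objective = the (dec u), region = polyhedron_of rs\<rparr>"
    have "?X \<in> basic_problems \<P> dec" using * unfolding basic_problems_def by force
    from B[rule_format, OF this *(3,4), unfolded problem.select_convs] show ?thesis
      by (elim exE conjE) (intro exI conjI; assumption)
  qed
  \<comment> \<open>One choice of outputs that meets the time bound and the correctness condition at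
    once, as the locale requires.\<close>
  define out where "out u rs p q = (SOME w. (\<exists>t. computes \<sigma> no_oracle cB (VList [VInt p, VInt q, VList [u, enc_rows rs]]) t w \<and>
         real t \<le> real dB * (1 / (real_of_int p / real_of_int q) +
           real (vsize \<sigma> (VList [VInt p, VInt q, VList [u, enc_rows rs]]))) ^ dB) \<and>
         (if polyhedron_of rs \<inter> int_points = {} then w = VInt 0
          else \<exists>z. w = enc_vec z \<and>
            eps_approx (the (dec u)) (polyhedron_of rs) (real_of_int p / real_of_int q) (real_vec z)))" for u rs p q
  note out = someI_ex[OF B', folded out_def]
  obtain cC dC where C: "\<And>us :: (real \<times> val) list. us \<noteq> [] \<Longrightarrow> \<forall>(r, u) \<in> set us. r \<in> K \<and> r > 0 \<and> u \<in> dom dec \<Longrightarrow>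
      \<exists>t w. computes \<sigma> no_oracle cC (VList (map enc_term us)) t w \<and>
        t \<le> dC * vsize \<sigma> (VList (map enc_term us)) ^ dC \<and> dec w = Some (\<lambda>x. \<Sum>(r, u) \<leftarrow> us. r * the (dec u) x)"
  proof -
    have "(\<lambda>(r, u). VList [VNum r, u]) = enc_term" by (auto simp: enc_term_def)
    then show ?thesis using conic that unfolding effective_conic_def Let_def by auto
  qed
  define conic_out where "conic_out us = (SOME w. (\<exists>t. computes \<sigma> no_oracle cC (VList (map enc_term us)) t w \<and>
        t \<le> dC * vsize \<sigma> (VList (map enc_term us)) ^ dC) \<and> dec w = Some (\<lambda>x. \<Sum>(r, u) \<leftarrow> us. r * the (dec u) x))" for us
  have C': "(\<exists>t. computes \<sigma> no_oracle cC (VList (map enc_term us)) t (conic_out us) \<and>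
        t \<le> dC * vsize \<sigma> (VList (map enc_term us)) ^ dC) \<and>
        dec (conic_out us) = Some (\<lambda>x. \<Sum>(r, u) \<leftarrow> us. r * the (dec u) x)"
    if "us \<noteq> []" "\<forall>(r, u) \<in> set us. r \<in> K \<and> r > 0 \<and> u \<in> dom dec" for us
    unfolding conic_out_def by (rule someI_ex) (use C[OF that] in blast)
  interpret basic_scheme \<P> dec K \<sigma> b cB out dB cC conic_out dC
  proof
    show "int_polytope P" if "P \<in> \<P>" for P using assms(1) that by blast
    show "closed_under_subpolytopes \<P>" by (rule assms(2))
  next
    fix u rs and p q :: int
    assume *: "u \<in> dom dec" "polyhedron_of rs \<in> \<P>" "p > 0" "q > 0"
    show "\<exists>t. computes \<sigma> no_oracle cB (VList [VInt p, VInt q, VList [u, enc_rows rs]]) t (out u rs p q) \<and>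
        real t \<le> real dB * (1 / (real_of_int p / real_of_int q) +
          real (vsize \<sigma> (VList [VInt p, VInt q, VList [u, enc_rows rs]]))) ^ dB"
      using out[OF *] by (rule conjunct1)
    show "out u rs p q = VInt 0" if "polyhedron_of rs \<inter> int_points = {}"
      using out[OF *] that by simp
    show "\<exists>z. out u rs p q = enc_vec z \<and>
        eps_approx (the (dec u)) (polyhedron_of rs) (real_of_int p / real_of_int q) (real_vec z)"
      if "polyhedron_of rs \<inter> int_points \<noteq> {}"
      using out[OF *] that by simp
  next
    fix us
    assume "us \<noteq> []" "\<forall>(r, u) \<in> set us. r \<in> K \<and> r > 0 \<and> u \<in> dom dec"
    then show "(\<exists>t. computes \<sigma> no_oracle cC (VList (map enc_term us)) t (conic_out us) \<and>
        t \<le> dC * vsize \<sigma> (VList (map enc_term us)) ^ dC) \<and>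
        dec (conic_out us) = Some (\<lambda>x. \<Sum>(r, u) \<leftarrow> us. r * the (dec u) x)"
      by (rule C')
  next
    fix f g P x
    assume "f \<in> ran dec" "g \<in> ran dec" "P \<in> \<P>" "x \<in> P"
    then show "sgn (f x) = sgn (g x)" using sign by blast
  qed
  show ?thesis by (rule product_fptas)
qed

end
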